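(* Let $f$ be meromorphic in $\mathbb{D}$ with a direct tract $U$, a component of $\{z\in\mathbb{D}: |f(z)|>R\}$, and let $v$, $B(r)$, $a(r)$, $r_0$, $\beta$, $\delta$, $\varepsilon(r)$ be as in the context. Assume that for some real $\rho_0$ $$\rho(v)=\limsup_{r\to1-}\frac{\log B(r,v)}{\log 1/(1-r)}>\rho_0>0\quad\text{and}\quad \limsup_{r\to1-}\frac{\log a(r)}{\log 1/(1-r)}>\frac{1+\rho_0}{1-2\beta}.$$ Then there exists a set $E\subseteq[r_0,1)$ with $\int_E\frac{dt}{1-t}<\infty$ having both of the following properties. (i) As $r\to1-$ with $r\notin E$, if $|z_r|=r$ and $v(z_r)=B(r)$, then $f(z)\sim f(z_r)\left(\frac{z}{z_r}\right)^{a(r)}$ and $\frac{f'(z)}{f(z)}\sim\frac{a(r)}{z}$ for $|z-z_r|<\varepsilon(r)/2048$. (ii) Let $(r_n)$ be any sequence satisfying $$r_0\le r_n<1,\quad \lim_{n\to\infty}r_n=1,\quad \lim_{n\to\infty}(1-r_n)^{1+\rho_0}a(r_n)^{1-2\beta}=\infty,$$ and let $M$ be a positive integer. Then for all sufficiently large $n$ and all $r$ satisfying $$r_n\le r\le r_n'=1-(1-r_n)^{1+\rho_0},\quad r\notin E,$$ one has $$\frac{\varepsilon(r)}{2048}=\frac{1}{2048\,a(r)^{1-\beta}(\log a(r))^{1+\delta}},$$ and, whenever $|z_r|=r$ and $v(z_r)=B(r)$, the function $f$ satisfies $$f(z)\sim f(z_r)\left(\frac{z}{z_r}\right)^{a(r)}\quad\text{and}\quad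 \frac{f^{(q)}(z)}{f(z)}\sim\frac{a(r)^q}{z^q}\quad\text{for } 1\le q\le M \text{ and } |z-z_r|<\frac{\varepsilon(r)}{2048}.$$
   Context: $\mathbb{D}=\{z\in\mathbb{C}:|z|<1\}$. For $f$ meromorphic in $\mathbb{D}$, a direct tract of $f$ is a component $U$ of the set $\{z\in\mathbb{D}:|f(z)|>R\}$, for some $R\in(0,\infty)$, such that $U$ contains no poles of $f$ but $f$ is unbounded on $U$. Given such $U$ and $R$, define $v(z)=\log|f(z)/R|$ for $z\in U$ and $v(z)=0$ for $z\in\mathbb{D}\setminus U$; $v$ is continuous, subharmonic and unbounded on $\mathbb{D}$. For $0<r<1$ let $B(r)=B(r,v)=\max\{v(z):|z|=r\}$ and $a(r)=rB'(r)=\frac{dB(r)}{d\log r}$. Here $B$ is a non-decreasing convex function of $\log r$, and $a(r)$ is taken to be the right derivative with respect to $\log r$ at the (countably many) points where $B$ is not differentiable; $a$ is non-decreasing and tends to $\infty$ as $r\to1-$. The constants $r_0\in(0,1)$, $\beta$, $\delta$ are chosen with $B(r)\ge2$ and $a(r)\ge2$ for $r_0\le r<1$, $0<\beta\le\frac12$, and $\delta>0$. For $r_0\le r<1$, $$\varepsilon(r)=\min\left\{\frac{1-r}{2\,a(r)^{\beta}(\log a(r))^{1+\delta}},\ \frac{1}{a(r)^{1-\beta}(\log a(r))^{1+\delta}}\right\}.$$ If $\beta=\frac12$ the quotient $(1+\rho_0)/(1-2\beta)$ is read as $+\infty$, so that the hypothesis forces $\beta<\frac12$. $(z/z_r)^{a(r)}$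 means $\exp(a(r)\log(z/z_r))$ with the logarithm vanishing at $z=z_r$. In (i), $X\sim Y$ means $X/Y\to1$ as $r\to1-$, $r\notin E$; in (ii) it means $X/Y\to1$ as $n\to\infty$; in both cases uniformly over the stated $r$, $z$ and the admissible choices of $z_r$. *)

theory Defs
  imports "HOL-Complex_Analysis.Complex_Analysis"
begin

(* Meromorphic functions on the disc are totalised as in nicely_meromorphic_on: the value at a
   pole is 0 and there are no spurious removable singularities.  Since |f| is infinite at a pole,
   poles have to be added to the set {|f| > R} by hand.  Leaving them out would turn punctured
   neighbourhoods of poles into parts of components without poles on which f is unbounded. *)

definition direct_tract :: "(complex \<Rightarrow> complex) \<Rightarrow> real \<Rightarrow> complex set \<Rightarrow> bool" where
  "direct_tract f R U \<longleftrightarrow>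
     0 < R \<and>
     U \<in> components {z \<in> ball 0 1. is_pole f z \<or> R < norm (f z)} \<and>
     (\<forall>z\<in>U. \<not> is_pole f z) \<and>
     \<not> bounded (f ` U)"

definition tract_fun :: "(complex \<Rightarrow> complex) \<Rightarrow> real \<Rightarrow> complex set \<Rightarrow> complex \<Rightarrow> real" where
  "tract_fun f R U z = (if z \<in> U then ln (norm (f z / of_real R)) else 0)"

(* For 0 < r < 1 and continuous v on the unit disc this supremum is a maximum. *)

definition circle_max :: "(complex \<Rightarrow> real) \<Rightarrow> real \<Rightarrow> real" where
  "circle_max v r = (SUP z\<in>sphere 0 r. v z)"

(* Right derivative of B with respect to log r; it is the ordinary derivative r B'(r) wherever
   B is differentiable. *)

definition log_right_deriv :: "(real \<Rightarrow> real) \<Rightarrow> real \<Rightarrow> real" where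
  "log_right_deriv B r = vector_derivative (\<lambda>t. B (exp t)) (at_right (ln r))"

definition tract_eps :: "real \<Rightarrow> real \<Rightarrow> (real \<Rightarrow> real) \<Rightarrow> real \<Rightarrow> real" where
  "tract_eps \<beta> \<delta> a r =
     min ((1 - r) / (2 * a r powr \<beta> * ln (a r) powr (1 + \<delta>)))
         (1 / (a r powr (1 - \<beta>) * ln (a r) powr (1 + \<delta>)))"

(* (z / w)^s with the branch of the logarithm vanishing at z = w.  On a disc around w of radius
   at most |w| this branch is the principal one. *)

definition quot_power :: "complex \<Rightarrow> complex \<Rightarrow> real \<Rightarrow> complex" where
  "quot_power z w s = exp (of_real s * Ln (z / w))"

end

theory Submission
  imports Defs "HOL-Real_Asymp.Real_Asymp"
begin

text \<open>
  Let \<open>z\<^sub>r\<close> be a point of the circle of radius \<open>r\<close> where \<open>v\<close> attains its maximum \<open>B r\<close>, and compare \<open>v\<close> with the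
  harmonic function \<open>u z = B r + a r * ln (|z| / r)\<close>. Since \<open>B\<close> is convex as a function of \<open>ln r\<close> with right
  derivative \<open>a\<close>, the difference \<open>v - u\<close> near \<open>z\<^sub>r\<close> is at most the variation of \<open>a\<close> times the variation of
  \<open>ln |z|\<close>. A Borel type growth lemma (\<open>exceptional_set_exists\<close>) supplies the set \<open>E\<close> outside of which
  \<open>a\<close> varies by \<open>O(a r powr (1 - \<beta>))\<close> within the distance \<open>\<epsilon> r\<close>; there \<open>v - u\<close> is at most some small \<open>\<eta>\<close>, while it
  vanishes at \<open>z\<^sub>r\<close>.

  The main point is that a disc about \<open>z\<^sub>r\<close> of radius comparable to \<open>\<epsilon> r\<close> then lies in the tract
  (\<open>no_holes_near_center\<close>). Since \<open>f\<close> may have zeros and poles outside the tract, the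
  tract need not be simply connected, and its complement has to be excluded by two arguments. A part of the
  complement that meets many circles about \<open>z\<^sub>r\<close> would carry too much logarithmic potential
  (\<open>few_circles_meet_low_set\<close>): there \<open>v - u\<close> is very negative, which would force it to be negative at \<open>z\<^sub>r\<close>.
  Hence many circles lie in the tract. If such a circle surrounds a part of
  the complement, then the winding number of the image of the circle under \<open>f\<close> about the origin is a positive integer,
  and, as in Jensen's formula, \<open>v - u\<close> would have to grow by a definite amount in the mean over
  circles (\<open>ringed_hole_growth\<close>). This contradicts \<open>v - u \<le> \<eta>\<close>. The mean of
  \<open>v - u\<close> over a circle in the tract is read off from its harmonic extension from that circle to the disc, which Laurent splitting provides (\<open>circle_harmonic_extension\<close>).

  Once the disc lies in the tract, the quotient \<open>F\<close> of \<open>f z\<close> and \<open>f z\<^sub>r * (z / z\<^sub>r) ^ a r\<close> is holomorphic without zeros there,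
  \<open>F z\<^sub>r = 1\<close> and \<open>|F| \<le> exp \<eta>\<close>. The Borel--Caratheodory inequality shows that \<open>F\<close> is
  close to \<open>1\<close> and bounds \<open>F' / F\<close> (\<open>near_one_if_log_norm_small\<close>). This gives the asymptotics of \<open>f\<close> and
  \<open>f' / f\<close>. If moreover \<open>a r * \<epsilon> r\<close> is large, which holds for the radii in the second part, all
  logarithmic derivatives follow by rescaling at the scale \<open>1 / a r\<close> (\<open>higher_log_deriv_estimate\<close>).
\<close>

section \<open>Harmonic and subharmonic functions\<close>

text \<open>Harmonicity is encoded without the Laplacian: near the point the function is the real part
  of a holomorphic function. This form is closed under the operations below, and it turns the
  maximum principle for harmonic functions into the maximum modulus principle.\<close>

definition harmonic_at :: "(complex \<Rightarrow> real) \<Rightarrow> complex \<Rightarrow> bool" where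
  "harmonic_at u x \<longleftrightarrow> (\<exists>h. h analytic_on {x} \<and> (\<forall>\<^sub>F z in nhds x. u z = Re (h z)))"

text \<open>For continuous functions on open sets this is subharmonicity, phrased as a localized strong maximum
  principle: whenever the difference of \<open>w\<close> and a harmonic function has a local maximum, it is
  locally constant. In this form it is invariant under subtraction of harmonic functions, and it
  gives the global maximum principles by connectedness and compactness.\<close>

definition subharmonic_on :: "(complex \<Rightarrow> real) \<Rightarrow> complex set \<Rightarrow> bool" where
  "subharmonic_on w S \<longleftrightarrow> continuous_on S w \<and>
     (\<forall>x\<in>S. \<forall>h. h analytic_on {x} \<longrightarrow>
        (\<forall>\<^sub>F z in nhds x. w z - Re (h z) \<le> w x - Re (h x)) \<longrightarrow>
        (\<forall>\<^sub>F z in nhds x. w z - Re (h z) = w x - Re (h x)))"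

lemma harmonic_at_Re: "h analytic_on {x} \<Longrightarrow> harmonic_at (\<lambda>z. Re (h z)) x"
  unfolding harmonic_at_def by (intro exI[of _ h]) auto

lemma harmonic_at_const [simp]: "harmonic_at (\<lambda>z. c) x"
  using harmonic_at_Re[of "\<lambda>_. of_real c" x] by simp

lemma harmonic_at_add:
  assumes "harmonic_at u x" "harmonic_at w x"
  shows "harmonic_at (\<lambda>z. u z + w z) x"
proof -
  obtain h k where h: "h analytic_on {x}" "\<forall>\<^sub>F z in nhds x. u z = Re (h z)"
    and k: "k analytic_on {x}" "\<forall>\<^sub>F z in nhds x. w z = Re (k z)"
    using assms unfolding harmonic_at_def by blast
  show ?thesis unfolding harmonic_at_def
  proof (intro exI conjI)
    show "(\<lambda>z. h z + k z) analytic_on {x}" using h k by (intro analytic_intros)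
    show "\<forall>\<^sub>F z in nhds x. u z + w z = Re (h z + k z)"
      using h(2) k(2) by eventually_elim auto
  qed
qed

lemma harmonic_at_cmult:
  assumes "harmonic_at u x"
  shows "harmonic_at (\<lambda>z. c * u z) x"
proof -
  obtain h where h: "h analytic_on {x}" "\<forall>\<^sub>F z in nhds x. u z = Re (h z)"
    using assms unfolding harmonic_at_def by blast
  show ?thesis unfolding harmonic_at_def
  proof (intro exI conjI)
    show "(\<lambda>z. of_real c * h z) analytic_on {x}" using h by (intro analytic_intros)
    show "\<forall>\<^sub>F z in nhds x. c * u z = Re (of_real c * h z)"
      using h(2) by eventually_elim auto
  qed
qed

lemma harmonic_at_diff:
  assumes "harmonic_at u x" "harmonic_at w x"
  shows "harmonic_at (\<lambda>z. u z - w z) x"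
  using harmonic_at_add[OF assms(1) harmonic_at_cmult[OF assms(2), of "-1"]] by simp

lemma harmonic_at_sum:
  assumes "\<And>i. i \<in> I \<Longrightarrow> harmonic_at (u i) x"
  shows "harmonic_at (\<lambda>z. \<Sum>i\<in>I. u i z) x"
  using assms by (induction I rule: infinite_finite_induct) (auto intro: harmonic_at_add)

lemma harmonic_at_cong:
  assumes "harmonic_at u x" "\<forall>\<^sub>F z in nhds x. u z = w z"
  shows "harmonic_at w x"
proof -
  obtain h where h: "h analytic_on {x}" "\<forall>\<^sub>F z in nhds x. u z = Re (h z)"
    using assms unfolding harmonic_at_def by blast
  have "\<forall>\<^sub>F z in nhds x. w z = Re (h z)"
    using h(2) assms(2) by eventually_elim auto
  with h(1) show ?thesis unfolding harmonic_at_def by blast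
qed

lemma harmonic_at_imp_isCont:
  assumes "harmonic_at u x"
  shows "isCont u x"
proof -
  obtain h where h: "h analytic_on {x}" "\<forall>\<^sub>F z in nhds x. u z = Re (h z)"
    using assms unfolding harmonic_at_def by blast
  have "isCont (\<lambda>z. Re (h z)) x"
    using analytic_at_imp_isCont[OF h(1)] by (rule isCont_Re)
  then show ?thesis using isCont_cong[OF h(2)] by simp
qed

lemma harmonic_at_ln_norm:
  assumes "F analytic_on {x}" "F x \<noteq> 0"
  shows "harmonic_at (\<lambda>z. ln (norm (F z))) x"
proof -
  define G where "G = (\<lambda>z. F z / F x)"
  have G: "G analytic_on {x}"
    unfolding G_def using assms by (intro analytic_intros) auto
  have h: "(\<lambda>z. Ln (F x) + Ln (G z)) analytic_on {x}"
    using G assms(2) by (intro analytic_intros) (auto simp: G_def)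
  have "isCont F x" using analytic_at_imp_isCont[OF assms(1)] .
  then have "\<forall>\<^sub>F z in nhds x. F z \<noteq> 0"
    using assms(2)
    by (simp add: isCont_def tendsto_imp_eventually_ne eventually_nhds_conv_at)
  then have "\<forall>\<^sub>F z in nhds x. ln (norm (F z)) = Re (Ln (F x) + Ln (G z))"
    by eventually_elim (use assms(2) in \<open>simp add: G_def norm_divide ln_div\<close>)
  with h show ?thesis unfolding harmonic_at_def by blast
qed

text \<open>The maximum modulus principle for \<open>exp h\<close>, whose modulus is \<open>exp (Re h)\<close>.\<close>

lemma Re_local_max_imp_locally_const:
  assumes "h analytic_on {x}" "\<forall>\<^sub>F z in nhds x. Re (h z) \<le> Re (h x)"
  shows "\<forall>\<^sub>F z in nhds x. Re (h z) = Re (h x)"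
proof -
  obtain e1 where e1: "e1 > 0" "h holomorphic_on ball x e1"
    using assms(1) by (auto simp: analytic_on_def)
  obtain e2 where e2: "e2 > 0" "\<And>z. dist z x < e2 \<Longrightarrow> Re (h z) \<le> Re (h x)"
    using assms(2) by (auto simp: eventually_nhds_metric)
  define e where "e = min e1 e2"
  have "e > 0" using e1 e2 by (simp add: e_def)
  have "(\<lambda>z. exp (h z)) constant_on ball x e"
  proof (rule maximum_modulus_principle)
    show "(\<lambda>z. exp (h z)) holomorphic_on ball x e"
      by (intro holomorphic_intros holomorphic_on_subset[OF e1(2)]) (auto simp: e_def)
    show "norm (exp (h z)) \<le> norm (exp (h x))" if "z \<in> ball x e" for z
      using that e2 by (simp add: e_def dist_commute)
  qed (use \<open>e > 0\<close> in auto)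
  then have "norm (exp (h z)) = norm (exp (h x))" if "dist z x < e" for z
    using that \<open>e > 0\<close> unfolding constant_on_def by (metis centre_in_ball dist_commute mem_ball)
  then have "Re (h z) = Re (h x)" if "dist z x < e" for z
    using that by simp
  then show ?thesis
    unfolding eventually_nhds_metric using \<open>e > 0\<close> by blast
qed

lemma subharmonic_onI_at:
  assumes "continuous_on S w"
    and "\<And>x h. x \<in> S \<Longrightarrow> h analytic_on {x} \<Longrightarrow>
           \<forall>\<^sub>F z in nhds x. w z - Re (h z) \<le> w x - Re (h x) \<Longrightarrow>
           \<forall>\<^sub>F z in nhds x. w z - Re (h z) = w x - Re (h x)"
  shows "subharmonic_on w S"
  using assms unfolding subharmonic_on_def by blast

lemma harmonic_local_max:
  assumes "harmonic_at u x" "\<forall>\<^sub>F z in nhds x. u z \<le> u x"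
  shows "\<forall>\<^sub>F z in nhds x. u z = u x"
proof -
  obtain h where h: "h analytic_on {x}" "\<forall>\<^sub>F z in nhds x. u z = Re (h z)"
    using assms unfolding harmonic_at_def by blast
  have ux: "u x = Re (h x)" using eventually_nhds_x_imp_x[OF h(2)] .
  have "\<forall>\<^sub>F z in nhds x. Re (h z) \<le> Re (h x)"
    using h(2) assms(2) by eventually_elim (use ux in auto)
  from Re_local_max_imp_locally_const[OF h(1) this] h(2)
  show ?thesis by eventually_elim (use ux in auto)
qed

lemma subharmonic_on_subset: "subharmonic_on w S \<Longrightarrow> T \<subseteq> S \<Longrightarrow> subharmonic_on w T"
  unfolding subharmonic_on_def by (meson continuous_on_subset subsetD)

lemma subharmonic_on_diff_harmonic:
  assumes "subharmonic_on w S" "\<And>x. x \<in> S \<Longrightarrow> harmonic_at u x"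
  shows "subharmonic_on (\<lambda>z. w z - u z) S"
proof (rule subharmonic_onI_at)
  show "continuous_on S (\<lambda>z. w z - u z)"
  proof (rule continuous_on_diff)
    show "continuous_on S w" using assms(1) by (simp add: subharmonic_on_def)
    show "continuous_on S u"
      using assms(2) harmonic_at_imp_isCont by (blast intro: continuous_at_imp_continuous_on)
  qed
next
  fix x h
  assume x: "x \<in> S" "h analytic_on {x}"
    and le: "\<forall>\<^sub>F z in nhds x. w z - u z - Re (h z) \<le> w x - u x - Re (h x)"
  obtain k where k: "k analytic_on {x}" "\<forall>\<^sub>F z in nhds x. u z = Re (k z)"
    using assms(2)[OF x(1)] unfolding harmonic_at_def by blast
  have ux: "u x = Re (k x)" using eventually_nhds_x_imp_x[OF k(2)] .
  have hk: "(\<lambda>z. h z + k z) analytic_on {x}" using x k by (intro analytic_intros)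
  have "\<forall>\<^sub>F z in nhds x. w z - Re (h z + k z) \<le> w x - Re (h x + k x)"
    using le k(2) by eventually_elim (use ux in auto)
  then have "\<forall>\<^sub>F z in nhds x. w z - Re (h z + k z) = w x - Re (h x + k x)"
    using assms(1) x hk unfolding subharmonic_on_def by blast
  then show "\<forall>\<^sub>F z in nhds x. w z - u z - Re (h z) = w x - u x - Re (h x)"
    using k(2) by eventually_elim (use ux in auto)
qed

lemma subharmonic_local_max:
  assumes "subharmonic_on w S" "open S" "x \<in> S" "\<And>z. z \<in> S \<Longrightarrow> w z \<le> w x"
  shows "\<forall>\<^sub>F z in nhds x. w z = w x"
proof -
  have "\<forall>\<^sub>F z in nhds x. w z \<le> w x"
    using eventually_nhds_in_open[OF assms(2,3)] by eventually_elim (use assms in auto)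
  then show ?thesis
    using assms(1,3) unfolding subharmonic_on_def
    by (auto dest!: bspec[of _ _ x] spec[of _ "\<lambda>_. 0"])
qed

text \<open>The set where the maximum is attained is relatively closed by continuity and open by the
  definition of subharmonicity.\<close>

theorem subharmonic_strong_maximum:
  assumes w: "subharmonic_on w S" and S: "open S" "connected S"
    and x: "x \<in> S" and mx: "\<And>z. z \<in> S \<Longrightarrow> w z \<le> w x" and z: "z \<in> S"
  shows "w z = w x"
proof -
  define Z where "Z = {z\<in>S. w z = w x}"
  have "openin (top_of_set S) Z"
  proof -
    have "open Z" unfolding open_subopen[of Z]
    proof
      fix y assume y: "y \<in> Z"
      have "\<forall>\<^sub>F z in nhds y. w z = w y"
        by (rule subharmonic_local_max[OF w S(1)]) (use y mx in \<open>auto simp: Z_def\<close>)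
      moreover have "\<forall>\<^sub>F z in nhds y. z \<in> S"
        by (rule eventually_nhds_in_open) (use S y in \<open>auto simp: Z_def\<close>)
      ultimately have "\<forall>\<^sub>F z in nhds y. z \<in> Z"
        by eventually_elim (use y in \<open>auto simp: Z_def\<close>)
      then show "\<exists>T. open T \<and> y \<in> T \<and> T \<subseteq> Z"
        by (auto simp: eventually_nhds)
    qed
    then show ?thesis by (simp add: S(1) openin_open_eq Z_def)
  qed
  moreover have "closedin (top_of_set S) Z"
    unfolding Z_def using w by (intro continuous_closedin_preimage_constant) (auto simp: subharmonic_on_def)
  moreover have "x \<in> Z" using x by (simp add: Z_def)
  ultimately have "Z = S"
    using S(2) by (metis connected_clopen empty_iff)
  then show ?thesis using z by (auto simp: Z_def)
qed

text \<open>If the maximum over the closure were attained only inside, then the set of maximum points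
  would be compact and open, which is impossible in the plane for a nonempty set.\<close>

theorem subharmonic_maximum_principle:
  assumes w: "subharmonic_on w S" "continuous_on (closure S) w" and S: "open S" "bounded S"
    and le: "\<And>z. z \<in> frontier S \<Longrightarrow> w z \<le> M" and z: "z \<in> S"
  shows "w z \<le> M"
proof -
  have cpt: "compact (closure S)" using S by simp
  obtain x where x: "x \<in> closure S" "\<And>y. y \<in> closure S \<Longrightarrow> w y \<le> w x"
    using continuous_attains_sup[OF cpt _ w(2)] z by (metis closure_subset empty_iff subsetD)
  define Z where "Z = {y\<in>closure S. w y = w x}"
  have "Z \<inter> frontier S \<noteq> {}"
  proof
    assume disj: "Z \<inter> frontier S = {}"
    then have ZS: "Z \<subseteq> S" using S(1) by (auto simp: Z_def frontier_def interior_open)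
    have "compact Z"
      unfolding Z_def using continuous_closedin_preimage_constant[OF w(2), of "w x"] cpt
      by (rule closedin_compact[rotated])
    moreover have "open Z" unfolding open_subopen[of Z]
    proof
      fix y assume y: "y \<in> Z"
      then have yS: "y \<in> S" using ZS by auto
      have "\<forall>\<^sub>F z in nhds y. w z = w y"
        by (rule subharmonic_local_max[OF w(1) S(1) yS])
           (use y x closure_subset in \<open>auto simp: Z_def\<close>)
      moreover have "\<forall>\<^sub>F z in nhds y. z \<in> S"
        by (rule eventually_nhds_in_open[OF S(1) yS])
      ultimately have "\<forall>\<^sub>F z in nhds y. z \<in> Z"
        by eventually_elim (use y closure_subset in \<open>auto simp: Z_def\<close>)
      then show "\<exists>T. open T \<and> y \<in> T \<and> T \<subseteq> Z"
        by (auto simp: eventually_nhds)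
    qed
    moreover have "x \<in> Z" using x by (simp add: Z_def)
    ultimately have "Z = UNIV"
      using clopen[of Z] compact_imp_closed by auto
    then show False using \<open>compact Z\<close> compact_imp_bounded not_bounded_UNIV by metis
  qed
  then have "w x \<le> M" using le by (force simp: Z_def)
  then show ?thesis using x z closure_subset by (meson order_trans subsetD)
qed

section \<open>Harmonic extension from circles in an annulus\<close>

definition cauchy_transform :: "real \<Rightarrow> (complex \<Rightarrow> complex) \<Rightarrow> complex \<Rightarrow> complex" where
  "cauchy_transform s g w =
     contour_integral (circlepath 0 s) (\<lambda>u. g u / (u - w)) / (2 * of_real pi * \<i>)"

lemma cauchy_transform_integrable:
  assumes "continuous_on (sphere 0 s) g" "0 < s" "norm w \<noteq> s"
  shows "(\<lambda>u. g u / (u - w)) contour_integrable_on circlepath 0 s"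
  using assms by (intro contour_integrable_continuous_circlepath continuous_intros) auto

lemma holomorphic_cauchy_transform:
  assumes g: "continuous_on (sphere 0 s) g" and s: "0 < s"
  shows "cauchy_transform s g holomorphic_on - sphere 0 s"
proof -
  let ?G = "\<lambda>w. contour_integral (circlepath 0 s) (\<lambda>u. g u / (u - w))"
  have "\<exists>D. (?G has_field_derivative D) (at w)" if w: "w \<in> UNIV - path_image (circlepath 0 s)" for w
  proof (rule exI)
    show "(?G has_field_derivative
        (of_nat 1 * contour_integral (circlepath 0 s) (\<lambda>u. g u / (u - w) ^ Suc 1))) (at w)"
    proof (rule Cauchy_next_derivative(2)[where S = UNIV and B = "2 * pi * \<bar>s\<bar>"])
      show "((\<lambda>u. g u / (u - w) ^ 1) has_contour_integral ?G w) (circlepath 0 s)"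
        if "w \<in> UNIV - path_image (circlepath 0 s)" for w
        using cauchy_transform_integrable[OF g s, of w] that s
        by (simp add: has_contour_integral_integral)
    qed (use g s w in \<open>auto simp: vector_derivative_circlepath norm_mult\<close>)
  qed
  then have "?G holomorphic_on - sphere 0 s"
    using s by (subst holomorphic_on_open) auto
  then show ?thesis
    unfolding cauchy_transform_def[abs_def] by (intro holomorphic_intros) auto
qed

lemma norm_cauchy_transform_le:
  assumes g: "continuous_on (sphere 0 s) g" and s: "0 < s"
    and M: "\<And>u. norm u = s \<Longrightarrow> norm (g u) \<le> M" and w: "s < norm w"
  shows "norm (cauchy_transform s g w) \<le> s * M / (norm w - s)"
proof -
  have "M \<ge> 0" using order_trans[OF norm_ge_zero M[of "of_real s"]] s by simp
  have "norm (contour_integral (circlepath 0 s) (\<lambda>u. g u / (u - w))) \<le> M / (norm w - s) * (2 * pi * s)"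
  proof (rule has_contour_integral_bound_circlepath)
    show "((\<lambda>u. g u / (u - w)) has_contour_integral
        contour_integral (circlepath 0 s) (\<lambda>u. g u / (u - w))) (circlepath 0 s)"
      using cauchy_transform_integrable[OF g s, of w] w by (simp add: has_contour_integral_integral)
    fix u :: complex assume u: "norm (u - 0) = s"
    have "norm w - s \<le> norm (u - w)" using u norm_triangle_ineq2[of w u] by (simp add: norm_minus_commute)
    then show "norm (g u / (u - w)) \<le> M / (norm w - s)"
      using M[of u] u w \<open>M \<ge> 0\<close> by (auto simp: norm_divide intro!: frac_le)
  qed (use \<open>M \<ge> 0\<close> w s in auto)
  then show ?thesis using s by (simp add: cauchy_transform_def norm_divide norm_mult field_simps)
qed

text \<open>A Cauchy transform tends to zero at infinity, so in the coordinate \<open>1 / w\<close> it has a removable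
  singularity at the origin.\<close>

lemma cauchy_transform_outside:
  assumes g: "continuous_on (sphere 0 s) g" and s: "0 < s"
  obtains k where "k holomorphic_on ball 0 (1/s)" "k 0 = 0"
    "\<And>w. s < norm w \<Longrightarrow> cauchy_transform s g w = k (1 / w)"
proof -
  define c where "c = (\<lambda>y. cauchy_transform s g (1 / y))"
  define k where "k = (\<lambda>y. if y = 0 then 0 else c y)"
  have inv: "s < norm (1 / y)" if "y \<in> ball 0 (1/s) - {0}" for y :: complex
    using that s by (auto simp: norm_divide field_simps)
  obtain M where "\<forall>x\<in>g ` sphere 0 s. norm x \<le> M"
    using compact_imp_bounded[OF compact_continuous_image[OF g compact_sphere]]
    unfolding bounded_iff by blast
  then have M: "norm (g u) \<le> M" if "norm u = s" for u using that by simp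
  have "c \<midarrow>0\<rightarrow> 0"
  proof (rule Lim_null_comparison)
    have "\<forall>\<^sub>F y in at 0. y \<in> ball 0 (1/s) - {0::complex}"
      using s by (intro eventually_at_in_open) auto
    then show "\<forall>\<^sub>F y in at 0. norm (c y) \<le> s * M * norm y / (1 - s * norm y)"
    proof eventually_elim
      case (elim y)
      have "norm (c y) \<le> s * M / (norm (1 / y) - s)"
        unfolding c_def by (rule norm_cauchy_transform_le[OF g s M inv[OF elim]])
      also have "\<dots> = s * M * norm y / (1 - s * norm y)"
        using elim s by (auto simp: norm_divide divide_simps)
      finally show ?case .
    qed
    show "(\<lambda>y. s * M * norm y / (1 - s * norm y)) \<midarrow>0::complex\<rightarrow> 0"
      by (auto intro!: tendsto_eq_intros)
  qed
  moreover have "c holomorphic_on ball 0 (1/s) - {0}"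
    unfolding c_def using holomorphic_cauchy_transform[OF g s] inv
    by (intro holomorphic_on_compose_gen[of "\<lambda>y. 1/y" _ "cauchy_transform s g", unfolded o_def])
       (force intro!: holomorphic_intros)+
  ultimately have "k holomorphic_on ball 0 (1/s)"
    unfolding k_def by (intro removable_singularity) auto
  moreover have "cauchy_transform s g w = k (1 / w)" if "s < norm w" for w
    using that s by (auto simp: k_def c_def)
  ultimately show thesis using that[of k] by (auto simp: k_def)
qed

text \<open>The straight line homotopy moves each point along its ray and therefore stays in the annulus.\<close>

lemma homotopic_circles_annulus:
  assumes "0 \<le> t1" "t1 < s1" "s1 \<le> s2" "s2 < t2"
  shows "homotopic_loops {z::complex. t1 < norm z \<and> norm z < t2} (circlepath 0 s1) (circlepath 0 s2)"
proof (rule homotopic_loops_linear)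
  fix t :: real
  define e where "e = exp (2 * of_real pi * \<i> * of_real t)"
  have ne: "norm e = 1" unfolding e_def by simp
  have eq: "circlepath 0 s t = of_real s * e" for s by (simp add: circlepath e_def)
  show "closed_segment (circlepath 0 s1 t) (circlepath 0 s2 t) \<subseteq> {z. t1 < norm z \<and> norm z < t2}"
  proof
    fix x assume "x \<in> closed_segment (circlepath 0 s1 t) (circlepath 0 s2 t)"
    then obtain u where u: "0 \<le> u" "u \<le> 1" "x = (1 - u) *\<^sub>R (of_real s1 * e) + u *\<^sub>R (of_real s2 * e)"
      unfolding eq by (auto simp: in_segment)
    have "x = of_real ((1 - u) * s1 + u * s2) * e"
      using u(3) by (simp add: scaleR_conv_of_real algebra_simps)
    moreover have "(1 - u) * s1 + u * s2 \<ge> s1" "(1 - u) * s1 + u * s2 \<le> s2"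
      using convex_bound_le[of s1 s2 s2 "1-u" u] convex_bound_le[of "-s1" "-s1" "-s2" "1-u" u] u assms
      by (auto simp: algebra_simps)
    ultimately show "x \<in> {z. t1 < norm z \<and> norm z < t2}"
      using assms ne by (simp add: norm_mult del: of_real_add of_real_mult of_real_diff)
  qed
qed auto

lemma open_annulus: "open {z::complex. t1 < norm z \<and> norm z < t2}"
  by (intro open_Collect_conj open_Collect_less continuous_intros)

text \<open>Cauchy's integral formula for an annulus: the difference quotient of \<open>g\<close> at \<open>z\<close> is holomorphic
  in the whole annulus, hence has the same integral over both circles, and \<open>z\<close> lies inside one of
  them and outside the other.\<close>

lemma laurent_splitting:
  assumes g: "g holomorphic_on {z. t1 < norm z \<and> norm z < t2}"
    and t: "0 \<le> t1" "t1 < s1" "s1 < s2" "s2 < t2"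
    and z: "s1 < norm z" "norm z < s2"
  shows "g z = cauchy_transform s2 g z - cauchy_transform s1 g z"
proof -
  let ?A = "{z::complex. t1 < norm z \<and> norm z < t2}"
  define F where "F = (\<lambda>u. if u = z then deriv g z else (g u - g z) / (u - z))"
  have F: "F holomorphic_on ?A" unfolding F_def by (rule pole_lemma_open[OF g open_annulus])
  have eq: "contour_integral (circlepath 0 s1) F = contour_integral (circlepath 0 s2) F"
    by (rule Cauchy_theorem_homotopic_loops[OF homotopic_circles_annulus open_annulus F]) (use t in auto)
  have int: "contour_integral (circlepath 0 s) F =
      contour_integral (circlepath 0 s) (\<lambda>u. g u / (u - z)) -
      g z * contour_integral (circlepath 0 s) (\<lambda>u. 1 / (u - z))"
    if s: "t1 < s" "s < t2" "norm z \<noteq> s" for s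
  proof -
    have s0: "s > 0" using s t by simp
    have cg: "continuous_on (sphere 0 s) g"
      using holomorphic_on_imp_continuous_on[OF g] by (rule continuous_on_subset) (use s in auto)
    have i1: "(\<lambda>u. g u / (u - z)) contour_integrable_on circlepath 0 s"
      by (rule cauchy_transform_integrable[OF cg s0 s(3)])
    have i2: "(\<lambda>u. 1 / (u - z)) contour_integrable_on circlepath 0 s"
      by (rule cauchy_transform_integrable[OF _ s0 s(3)]) auto
    have "contour_integral (circlepath 0 s) F =
        contour_integral (circlepath 0 s) (\<lambda>u. g u / (u - z) - g z * (1 / (u - z)))"
      by (rule contour_integral_eq) (use s s0 in \<open>auto simp: F_def diff_divide_distrib\<close>)
    also have "\<dots> = contour_integral (circlepath 0 s) (\<lambda>u. g u / (u - z)) -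
        contour_integral (circlepath 0 s) (\<lambda>u. g z * (1 / (u - z)))"
      by (rule contour_integral_diff[OF i1 contour_integrable_lmul[OF i2]])
    also have "contour_integral (circlepath 0 s) (\<lambda>u. g z * (1 / (u - z))) =
        g z * contour_integral (circlepath 0 s) (\<lambda>u. 1 / (u - z))"
      by (rule contour_integral_lmul[OF i2])
    finally show ?thesis .
  qed
  have c2: "contour_integral (circlepath 0 s2) (\<lambda>u. 1 / (u - z)) = 2 * of_real pi * \<i>"
    using Cauchy_integral_circlepath_simple[of "\<lambda>_. 1" 0 s2 z] z
    by (intro contour_integral_unique) auto
  have c1: "contour_integral (circlepath 0 s1) (\<lambda>u. 1 / (u - z)) = 0"
  proof (rule contour_integral_unique[OF Cauchy_theorem_disc_simple[of _ 0 "norm z"]])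
    show "(\<lambda>u. 1 / (u - z)) holomorphic_on ball 0 (norm z)"
      by (intro holomorphic_intros) auto
  qed (use z t in auto)
  have "contour_integral (circlepath 0 s1) (\<lambda>u. g u / (u - z)) =
        contour_integral (circlepath 0 s2) (\<lambda>u. g u / (u - z)) - g z * (2 * of_real pi * \<i>)"
    using eq int[of s1] int[of s2] t z c1 c2 by simp
  then show ?thesis by (simp add: cauchy_transform_def field_simps)
qed

text \<open>The integral is the winding number about the origin of the image of the circle.\<close>

lemma contour_integral_log_deriv_circle:
  assumes F: "F holomorphic_on {z. t1 < norm z \<and> norm z < t2}"
    and nz: "\<And>z. t1 < norm z \<Longrightarrow> norm z < t2 \<Longrightarrow> F z \<noteq> 0"
    and t: "0 \<le> t1" "t1 < s" "s < t2"
  obtains N :: int where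
    "contour_integral (circlepath 0 s) (\<lambda>u. deriv F u / F u) = 2 * of_real pi * \<i> * of_int N"
proof -
  let ?A = "{z::complex. t1 < norm z \<and> norm z < t2}"
  have an: "F analytic_on ?A" using F open_annulus analytic_on_open by blast
  have pi: "path_image (circlepath 0 s) \<subseteq> ?A" using t by auto
  have vp: "valid_path (F \<circ> circlepath 0 s)"
    by (rule valid_path_compose_analytic[OF _ an pi]) auto
  have n0: "0 \<notin> path_image (F \<circ> circlepath 0 s)"
    using nz pi t by (auto simp: path_image_compose)
  have "winding_number (F \<circ> circlepath 0 s) 0 \<in> \<int>"
    by (rule integer_winding_number[OF valid_path_imp_path[OF vp] _ n0])
       (simp add: pathfinish_compose pathstart_compose)
  then obtain N where N: "winding_number (F \<circ> circlepath 0 s) 0 = of_int N"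
    by (auto elim: Ints_cases)
  have "contour_integral (F \<circ> circlepath 0 s) (\<lambda>w. 1 / (w - 0)) =
      contour_integral (circlepath 0 s) (\<lambda>u. deriv F u * (1 / (F u - 0)))"
    by (rule contour_integral_comp_analyticW[OF an _ pi]) auto
  then have "contour_integral (circlepath 0 s) (\<lambda>u. deriv F u / F u) = 2 * of_real pi * \<i> * of_int N"
    using N winding_number_valid_path[OF vp n0] by (simp add: field_simps)
  then show thesis by (rule that)
qed

text \<open>With \<open>N\<close> the winding number, \<open>F' / F - N / z\<close> has vanishing integral over the circles, so
  each of the two parts of its Laurent splitting has a primitive: the inner part in a disc, and the
  outer part, which decays quadratically, in a neighbourhood of infinity. The two primitives form
  a logarithm of \<open>F z / z ^ N\<close>.\<close>

theorem annulus_factorization: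
  assumes F: "F holomorphic_on {z. t1 < norm z \<and> norm z < t2}"
    and nz: "\<And>z. t1 < norm z \<Longrightarrow> norm z < t2 \<Longrightarrow> F z \<noteq> 0"
    and t: "0 \<le> t1" "t1 < s1" "s1 < s2" "s2 < t2"
  obtains h1 h2 and N :: int where
    "h1 holomorphic_on ball 0 s2" "h2 holomorphic_on ball 0 (1/s1)" "h2 0 = 0"
    "\<forall>z. s1 < norm z \<longrightarrow> norm z < s2 \<longrightarrow> F z = z powi N * exp (h1 z + h2 (1 / z))"
proof -
  let ?A = "{z::complex. t1 < norm z \<and> norm z < t2}"
  let ?I = "\<lambda>g. contour_integral (circlepath 0 s1) g"
  define T where "T = {z::complex. s1 < norm z \<and> norm z < s2}"
  have s0: "0 < s1" "0 < s2" using t by auto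
  obtain N where N: "?I (\<lambda>u. deriv F u / F u) = 2 * of_real pi * \<i> * of_int N"
    by (rule contour_integral_log_deriv_circle[OF F nz t(1,2)]) (use t in auto)
  define g where "g = (\<lambda>u. deriv F u / F u - of_int N / u)"
  have dF: "deriv F holomorphic_on ?A" using F open_annulus by (rule holomorphic_deriv)
  have g: "g holomorphic_on ?A"
    unfolding g_def using nz t by (intro holomorphic_intros dF F) auto
  have cont: "continuous_on (sphere 0 s) k" if "k holomorphic_on ?A" "t1 < s" "s < t2" for s k
    using holomorphic_on_imp_continuous_on[OF that(1)]
    by (rule continuous_on_subset) (use that in auto)
  have cg1: "continuous_on (sphere 0 s1) g" and cg2: "continuous_on (sphere 0 s2) g"
    using cont[OF g] t by auto
  have gi: "?I g = 0"
  proof -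
    have "(\<lambda>u. deriv F u / F u) contour_integrable_on circlepath 0 s1"
    proof (rule contour_integrable_continuous_circlepath)
      show "continuous_on (path_image (circlepath 0 s1)) (\<lambda>u. deriv F u / F u)"
        using cont[of "\<lambda>u. deriv F u / F u" s1] dF F nz t by (auto intro!: holomorphic_intros)
    qed
    moreover have "((\<lambda>u. of_int N / (u - 0)) has_contour_integral (2 * of_real pi * \<i> * of_int N)) (circlepath 0 s1)"
      by (rule Cauchy_integral_circlepath_simple) (use s0 in auto)
    ultimately show ?thesis
      unfolding g_def using N
      by (subst contour_integral_diff) (auto simp: contour_integral_unique contour_integrable_on_def)
  qed
  \<comment> \<open>Since the integral of \<open>g\<close> over the inner circle vanishes, its outer part decays quadratically.\<close>
  obtain k where k: "k holomorphic_on ball 0 (1/s1)" "k 0 = 0"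
    "\<And>w. s1 < norm w \<Longrightarrow> cauchy_transform s1 (\<lambda>u. u * g u) w = k (1 / w)"
    by (rule cauchy_transform_outside[of s1 "\<lambda>u. u * g u"])
       (use s0 cg1 in \<open>auto intro!: continuous_intros\<close>)
  have outer: "w * cauchy_transform s1 g w = k (1 / w)" if w: "s1 < norm w" for w
  proof -
    have w0: "w \<noteq> 0" using w s0 by auto
    have i1: "(\<lambda>u. g u / (u - w)) contour_integrable_on circlepath 0 s1"
      by (rule cauchy_transform_integrable[OF cg1 s0(1)]) (use w in auto)
    have i2: "g contour_integrable_on circlepath 0 s1"
      by (rule contour_integrable_continuous_circlepath) (use cg1 s0 in auto)
    have "?I (\<lambda>u. u * g u / (u - w)) = ?I (\<lambda>u. g u + w * (g u / (u - w)))"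
    proof (rule contour_integral_eq)
      fix u assume "u \<in> path_image (circlepath 0 s1)"
      then have "u - w \<noteq> 0" using w s0 by auto
      then show "u * g u / (u - w) = g u + w * (g u / (u - w))"
        by (simp add: divide_simps) (simp add: algebra_simps)
    qed
    also have "\<dots> = ?I g + ?I (\<lambda>u. w * (g u / (u - w)))"
      by (rule contour_integral_add[OF i2 contour_integrable_lmul[OF i1]])
    also have "\<dots> = w * ?I (\<lambda>u. g u / (u - w))"
      using contour_integral_lmul[OF i1] gi by simp
    finally show ?thesis using k(3)[OF w] by (simp add: cauchy_transform_def)
  qed
  obtain k2 where k2: "k2 holomorphic_on ball 0 (1/s1)" "\<And>y. norm y < 1/s1 \<Longrightarrow> k y = y * k2 y"
    by (rule Schwarz3[OF k(1,2)]) auto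
  obtain h20 where h20: "\<And>y. y \<in> ball 0 (1/s1) \<Longrightarrow> (h20 has_field_derivative k2 y) (at y)"
    using holomorphic_convex_primitive'[OF convex_ball open_ball k2(1)] by (metis at_within_open open_ball)
  define h2 where "h2 = (\<lambda>y. h20 y - h20 0)"
  have h2: "(h2 has_field_derivative k2 y) (at y)" if "norm y < 1/s1" for y
    unfolding h2_def using h20[of y] that by (auto intro!: derivative_eq_intros)
  have "cauchy_transform s2 g holomorphic_on ball 0 s2"
    by (rule holomorphic_on_subset[OF holomorphic_cauchy_transform[OF cg2 s0(2)]]) auto
  from holomorphic_convex_primitive'[OF convex_ball open_ball this]
  obtain h10 where h10: "\<And>z. z \<in> ball 0 s2 \<Longrightarrow> (h10 has_field_derivative cauchy_transform s2 g z) (at z)"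
    by (metis at_within_open open_ball)
  define \<Phi> where "\<Phi> = (\<lambda>z. F z * z powi (-N) * exp (- (h10 z + h2 (1 / z))))"
  have "\<exists>c. \<forall>z\<in>T. \<Phi> z = c"
  proof -
    have d\<Phi>: "(\<Phi> has_field_derivative 0) (at z)" if z: "z \<in> T" for z
    proof -
      have zA: "z \<in> ?A" "norm z < s2" "s1 < norm z" and z0: "z \<noteq> 0" and Fz: "F z \<noteq> 0"
        using z t nz by (auto simp: T_def)
      have d1: "(F has_field_derivative deriv F z) (at z)"
        using holomorphic_derivI[OF F open_annulus zA(1)] .
      have iz: "norm (1 / z) < 1 / s1" using zA s0 by (simp add: norm_divide frac_less2)
      have d3: "((\<lambda>z. h2 (1 / z)) has_field_derivative (k2 (1 / z) * (- (1 / z\<^sup>2)))) (at z)"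
      proof (rule DERIV_chain2[where f = h2 and g = "\<lambda>z. 1 / z"])
        show "((\<lambda>z. 1 / z) has_field_derivative - (1 / z\<^sup>2)) (at z)"
          using z0 by (auto intro!: derivative_eq_intros simp: power2_eq_square)
      qed (rule h2[OF iz])
      have d4: "(h10 has_field_derivative cauchy_transform s2 g z) (at z)"
        using h10 zA by auto
      have "k2 (1 / z) / z = z * cauchy_transform s1 g z"
        using outer[of z] k2(2)[OF iz] zA by simp
      then have e: "k2 (1 / z) / z\<^sup>2 = cauchy_transform s1 g z"
        using z0 by (simp add: power2_eq_square field_simps)
      have "g z = cauchy_transform s2 g z - cauchy_transform s1 g z"
        by (rule laurent_splitting[OF g t zA(3,2)])
      then have key: "deriv F z / F z - of_int N / z - (cauchy_transform s2 g z - k2 (1 / z) / z\<^sup>2) = 0"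
        using e by (simp add: g_def)
      have d5: "((\<lambda>z. z powi (-N)) has_field_derivative (z powi (-N)) * (- of_int N / z)) (at z)"
        using z0 by (auto intro!: derivative_eq_intros simp: power_int_diff divide_simps)
      have "(\<Phi> has_field_derivative
         \<Phi> z * (deriv F z / F z - of_int N / z - (cauchy_transform s2 g z - k2 (1 / z) / z\<^sup>2))) (at z)"
        unfolding \<Phi>_def
        by (rule derivative_eq_intros d1 d3 d4 d5 refl)+ (use Fz z0 in \<open>simp add: field_simps\<close>)
      then show ?thesis unfolding key by simp
    qed
    have cT: "connected T" unfolding T_def
      using connected_annulus(1)[of s1 "0::complex" s2] by simp
    have oT: "open T" unfolding T_def by (rule open_annulus)
    have "continuous_on T \<Phi>"
      using d\<Phi> by (meson continuous_at_imp_continuous_on DERIV_isCont)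
    from DERIV_zero_connected_constant[OF cT oT finite.emptyI this] d\<Phi>
    show ?thesis by (metis Diff_iff)
  qed
  then obtain c where c: "\<And>z. z \<in> T \<Longrightarrow> \<Phi> z = c" by blast
  define m where "m = complex_of_real ((s1 + s2) / 2)"
  have nm: "norm m = (s1 + s2) / 2" using s0 by (simp only: m_def norm_of_real) simp
  then have "m \<in> T" using t by (simp add: T_def)
  moreover have "F m \<noteq> 0" "m \<noteq> 0" using nm t s0 nz by auto
  ultimately have "c \<noteq> 0" using c[of m] by (auto simp: \<Phi>_def power_int_not_zero)
  define h1 where "h1 = (\<lambda>z. h10 z + Ln c)"
  show thesis
  proof (rule that)
    show "h1 holomorphic_on ball 0 s2"
      unfolding h1_def holomorphic_on_open[OF open_ball]
      using h10 by (auto intro!: exI derivative_eq_intros)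
    show "h2 holomorphic_on ball 0 (1/s1)"
      unfolding holomorphic_on_open[OF open_ball] using h2 by (metis mem_ball_0)
    show "h2 0 = 0" by (simp add: h2_def)
    show "\<forall>z. s1 < norm z \<longrightarrow> norm z < s2 \<longrightarrow> F z = z powi N * exp (h1 z + h2 (1 / z))"
    proof (intro allI impI)
      fix z :: complex assume z: "s1 < norm z" "norm z < s2"
      then have "\<Phi> z = c" and z0: "z \<noteq> 0" using c s0 by (auto simp: T_def)
      then have "F z = c * z powi N * exp (h10 z + h2 (1 / z))"
      proof -
        have "F z = F z * (z powi (-N) * z powi N) * (exp (- (h10 z + h2 (1 / z))) * exp (h10 z + h2 (1 / z)))"
          using z0 by (simp add: power_int_minus power_int_not_zero flip: exp_add)
        also have "\<dots> = \<Phi> z * z powi N * exp (h10 z + h2 (1 / z))"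
          by (simp only: \<Phi>_def mult_ac)
        finally show ?thesis using \<open>\<Phi> z = c\<close> by simp
      qed
      then show "F z = z powi N * exp (h1 z + h2 (1 / z))"
        using \<open>c \<noteq> 0\<close> by (simp add: h1_def exp_add algebra_simps)
    qed
  qed
qed

text \<open>On the circle of radius \<open>s\<close> one has \<open>1 / z = cnj (z / s\<^sup>2)\<close>. Reflecting the outer factor of
  the factorization in the circle therefore extends \<open>ln |F|\<close> harmonically from the circle into the
  whole disc. The value at the center depends on the radius only through the winding number: it
  is \<open>N * ln s + c\<close>, which plays the role of Jensen's formula.\<close>

theorem circle_harmonic_extension:
  assumes F: "F holomorphic_on {z. t1 < norm z \<and> norm z < t2}"
    and nz: "\<And>z. t1 < norm z \<Longrightarrow> norm z < t2 \<Longrightarrow> F z \<noteq> 0"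
    and t: "0 \<le> t1" "t1 < s1" "s1 < s2" "s2 < t2"
  shows "\<exists>(N :: int) c q. \<forall>s. s1 < s \<and> s < s2 \<longrightarrow> q s analytic_on cball 0 s \<and>
           (\<forall>z. norm z = s \<longrightarrow> Re (q s z) = ln (norm (F z))) \<and> Re (q s 0) = of_int N * ln s + c"
proof -
  obtain h1 h2 N where h:
    "h1 holomorphic_on ball 0 s2" "h2 holomorphic_on ball 0 (1/s1)" "h2 0 = 0"
    "\<forall>z. s1 < norm z \<longrightarrow> norm z < s2 \<longrightarrow> F z = z powi N * exp (h1 z + h2 (1 / z))"
    by (rule annulus_factorization[OF F nz t]) blast
  define q where "q = (\<lambda>s z. of_real (of_int N * ln s) + h1 z + cnj (h2 (cnj (z / of_real (s^2)))))"
  have s0: "0 < s1" using t by simp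
  show ?thesis
  proof (rule exI[of _ N], rule exI[of _ "Re (h1 0)"], rule exI[of _ q], intro allI impI conjI)
    fix s assume "s1 < s \<and> s < s2"
    then have s: "s1 < s" "s < s2" by auto
    define S where "S = ball (0::complex) (min s2 (s\<^sup>2 / s1))"
    have in2: "z / of_real (s^2) \<in> ball 0 (1/s1)" if "z \<in> S" for z
      using that s s0 by (auto simp: S_def norm_divide norm_power field_simps)
    have "cnj ` ball 0 (1/s1) = ball 0 (1/s1)"
    proof (intro equalityI subsetI)
      fix y :: complex assume "y \<in> ball 0 (1/s1)"
      then have "cnj y \<in> ball 0 (1/s1)" by simp
      then show "y \<in> cnj ` ball 0 (1/s1)" by (metis complex_cnj_cnj imageI)
    qed auto
    then have 2: "(\<lambda>y. cnj (h2 (cnj y))) holomorphic_on ball 0 (1/s1)"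
      using holomorphic_on_compose_cnj_cnj[of h2 "ball 0 (1/s1)"] h(2) by (simp add: o_def)
    have "(\<lambda>z. cnj (h2 (cnj (z / of_real (s^2))))) holomorphic_on S"
    proof (rule holomorphic_on_compose_gen[OF _ 2, of "\<lambda>z. z / of_real (s^2)", unfolded o_def])
      show "(\<lambda>z. z / of_real (s^2)) holomorphic_on S"
        using s s0 by (intro holomorphic_intros) auto
      show "(\<lambda>z. z / of_real (s^2)) ` S \<subseteq> ball 0 (1/s1)"
        using in2 by blast
    qed
    moreover have "h1 holomorphic_on S"
      by (rule holomorphic_on_subset[OF h(1)]) (auto simp: S_def)
    ultimately have "q s holomorphic_on S"
      unfolding q_def by (intro holomorphic_intros)
    moreover have "s < s\<^sup>2 / s1"
      using s s0 by (simp add: power2_eq_square pos_less_divide_eq)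
    then have "open S" "cball 0 s \<subseteq> S"
      using s by (auto simp: S_def)
    ultimately show "q s analytic_on cball 0 s"
      by (meson analytic_on_open analytic_on_subset)
    show "Re (q s 0) = of_int N * ln s + Re (h1 0)"
      by (simp add: q_def h(3))
    fix z :: complex assume z: "norm z = s"
    have z0: "z \<noteq> 0" using z s s0 by auto
    have "1 / z = cnj (z / of_real (s\<^sup>2))"
    proof -
      have "z * cnj z = of_real (s\<^sup>2)" unfolding z[symmetric] by (rule complex_norm_square[symmetric])
      then show ?thesis using z0 s s0 by (simp add: field_simps)
    qed
    moreover have "norm (F z) = s powi N * exp (Re (h1 z) + Re (h2 (1 / z)))"
      using h(4)[rule_format, of z] z s by (simp add: norm_mult norm_power_int)
    then have "ln (norm (F z)) = of_int N * ln s + (Re (h1 z) + Re (h2 (1 / z)))"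
      using s s0 by (simp add: ln_mult power_int_not_zero ln_powr
          flip: powr_real_of_int')
    ultimately show "Re (q s z) = ln (norm (F z))"
      by (simp add: q_def)
  qed
qed

section \<open>Discs without holes\<close>

lemma subharmonic_on_harmonic:
  assumes "\<And>x. x \<in> S \<Longrightarrow> harmonic_at u x"
  shows "subharmonic_on u S"
proof (rule subharmonic_onI_at)
  show "continuous_on S u"
    using assms harmonic_at_imp_isCont by (blast intro: continuous_at_imp_continuous_on)
  fix x h assume "x \<in> S" "h analytic_on {x}"
    and le: "\<forall>\<^sub>F z in nhds x. u z - Re (h z) \<le> u x - Re (h x)"
  then have "harmonic_at (\<lambda>z. u z - Re (h z)) x"
    using assms by (intro harmonic_at_diff harmonic_at_Re)
  from harmonic_local_max[OF this le]
  show "\<forall>\<^sub>F z in nhds x. u z - Re (h z) = u x - Re (h x)" .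
qed

lemma harmonic_strong_minimum:
  assumes "\<And>x. x \<in> S \<Longrightarrow> harmonic_at u x" "open S" "connected S"
    "x \<in> S" "\<And>z. z \<in> S \<Longrightarrow> u x \<le> u z" "z \<in> S"
  shows "u z = u x"
proof -
  have "- u z = - u x"
  proof (rule subharmonic_strong_maximum[of "\<lambda>z. - u z" S])
    show "subharmonic_on (\<lambda>z. - u z) S"
      using assms(1) harmonic_at_cmult[of u _ "-1"] by (intro subharmonic_on_harmonic) simp
  qed (use assms in auto)
  then show ?thesis by simp
qed

lemma harmonic_at_Re_analytic_on: "p analytic_on S \<Longrightarrow> x \<in> S \<Longrightarrow> harmonic_at (\<lambda>z. Re (p z)) x"
  using analytic_on_subset[of p S "{x}"] by (intro harmonic_at_Re) auto

lemma continuous_on_Re_analytic: "p analytic_on S \<Longrightarrow> continuous_on S (\<lambda>z. Re (p z))"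
  by (intro continuous_on_Re holomorphic_on_imp_continuous_on analytic_imp_holomorphic)

lemma subharmonic_majorant:
  assumes w: "subharmonic_on w (ball 0 t)" "continuous_on (cball 0 t) w"
    and p: "p analytic_on cball 0 t"
    and le: "\<And>z. norm z = t \<Longrightarrow> w z \<le> Re (p z)" and t: "0 < t" and z: "norm z \<le> t"
  shows "w z \<le> Re (p z)"
proof (cases "norm z = t")
  case False
  have z': "z \<in> ball 0 t" using z False by simp
  have "w z - Re (p z) \<le> 0"
  proof (rule subharmonic_maximum_principle[where S = "ball 0 t" and w = "\<lambda>z. w z - Re (p z)"])
    show "subharmonic_on (\<lambda>z. w z - Re (p z)) (ball 0 t)"
      by (intro subharmonic_on_diff_harmonic[OF w(1)] harmonic_at_Re_analytic_on[OF p]) auto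
    show "continuous_on (closure (ball 0 t)) (\<lambda>z. w z - Re (p z))"
      using w p t by (auto intro!: continuous_on_diff continuous_on_Re_analytic)
  qed (use le t z' in auto)
  then show ?thesis by simp
qed (use le in auto)

text \<open>This is Stirling's bound \<open>N ^ N / fact N \<le> exp N\<close> in logarithmic form.\<close>

lemma sum_ln_ratio_le: "(\<Sum>k=1..N. ln (real N / real k)) \<le> real N"
proof (induction N)
  case (Suc N)
  show ?case
  proof (cases "N = 0")
    case False
    have "ln (real (Suc N) / real k) = ln (real N / real k) + ln (1 + 1 / real N)" if "k \<in> {1..N}" for k
    proof -
      have "real (Suc N) / real k = (real N / real k) * (1 + 1 / real N)"
        using that False by (simp add: field_simps)
      also have "ln \<dots> = ln (real N / real k) + ln (1 + 1 / real N)"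
        using that False by (intro ln_mult_pos) (auto simp: add_pos_pos)
      finally show ?thesis .
    qed
    then have "(\<Sum>k=1..Suc N. ln (real (Suc N) / real k)) =
        (\<Sum>k=1..N. ln (real N / real k)) + real N * ln (1 + 1 / real N)"
      by (simp add: sum.distrib)
    also have "real N * ln (1 + 1 / real N) \<le> real N * (1 / real N)"
      using False by (intro mult_left_mono ln_add_one_self_le_self) auto
    finally show ?thesis using Suc False by simp
  qed auto
qed auto

text \<open>At most one point is chosen from each of \<open>n\<close> consecutive annuli of width \<open>1 / (8 n)\<close>. Then at most
  three of the points lie in the annulus of \<open>z\<close> or in a neighbouring one; their contribution is controlled
  by the distance \<open>d\<close>. For the other points the difference of the moduli is at least \<open>k / (8 n)\<close>,
  where each \<open>k\<close> occurs at most twice, and the logarithms of these ratios sum to \<open>O(n)\<close>.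
  Thus the potential of the points is \<open>O(n)\<close>, apart from the nearest three, wherever the points
  lie in their annuli.\<close>

lemma potential_spaced_points_le:
  fixes x :: "nat \<Rightarrow> complex" and n :: nat
  assumes B: "B \<subseteq> {..<n}"
    and x: "\<And>i. i \<in> B \<Longrightarrow> 1/8 + real i / (8 * n) \<le> norm (x i) \<and> norm (x i) < 1/8 + real (Suc i) / (8 * n)"
    and d: "0 < d" "d \<le> 1/2" "\<And>i. i \<in> B \<Longrightarrow> d \<le> norm (z - x i)" and z: "norm z \<le> 1"
  shows "(\<Sum>i\<in>B. ln (1 / (2 * norm (z - x i)))) \<le> 3 * ln (1 / (2 * d)) + 16 * real n"
proof (cases "n = 0")
  case True
  then show ?thesis using B d by (auto simp: ln_div)
next
  case False
  define N where "N = 8 * n"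
  have N: "real N > 0" using False by (simp add: N_def)
  define y where "y = N * (norm z - 1/8)"
  define l where "l = \<lfloor>y\<rfloor>"
  let ?g = "\<lambda>i. ln (1 / (2 * norm (z - x i)))"
  have fin: "finite B" using B finite_subset by auto
  define near where "near = {i\<in>B. \<bar>int i - l\<bar> \<le> 1}"
  define lo where "lo = {i\<in>B. int i - l \<le> -2}"
  define hi where "hi = {i\<in>B. int i - l \<ge> 2}"
  have split: "B = near \<union> (lo \<union> hi)" "near \<inter> (lo \<union> hi) = {}" "lo \<inter> hi = {}"
    by (auto simp: near_def lo_def hi_def)
  have g_far: "?g i \<le> ln (real N / real k) \<and> k \<in> {1..N}"
    if i: "i \<in> B" and k: "int k = \<bar>int i - l\<bar> - 1" "k \<ge> 1" for i k
  proof -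
    have yi: "real i \<le> N * (norm (x i) - 1/8)" "N * (norm (x i) - 1/8) < real i + 1"
      using x[OF i] N by (auto simp: N_def field_simps)
    have yl: "real_of_int l \<le> y" "y < l + 1" by (auto simp: l_def)
    have "real k = \<bar>real_of_int (int i - l)\<bar> - 1" using k(1) by linarith
    then have "real k \<le> \<bar>y - N * (norm (x i) - 1/8)\<bar>" using yi yl by auto
    also have "\<dots> = N * \<bar>norm z - norm (x i)\<bar>"
      using N by (simp add: y_def abs_mult flip: right_diff_distrib)
    finally have 1: "real k \<le> N * \<bar>norm z - norm (x i)\<bar>" .
    have xi1: "norm (x i) < 1"
    proof -
      have "real (Suc i) \<le> real n" using i B by (auto simp: subset_iff Suc_leI simp del: of_nat_Suc)
      then have "real (Suc i) / (8 * n) \<le> real n / (8 * n)" by (intro divide_right_mono) auto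
      also have "\<dots> = 1/8" using False by simp
      finally show ?thesis using x[OF i] by linarith
    qed
    have "\<bar>norm z - norm (x i)\<bar> \<le> 1" using xi1 z norm_ge_zero[of z] norm_ge_zero[of "x i"] by linarith
    then have "real k \<le> N" using 1 N by (smt (verit) mult_left_le)
    moreover have "real k \<le> N * norm (z - x i)"
      using 1 norm_triangle_ineq3[of z "x i"] N by (smt (verit) mult_left_mono)
    then have "real k \<le> real N * (2 * norm (z - x i))" 
      using mult_left_mono[of "norm (z - x i)" "2 * norm (z - x i)" "real N"] by simp
    then have "1 / (2 * norm (z - x i)) \<le> real N / real k"
    proof -
      have "0 < 2 * norm (z - x i)" "0 < real k" using d(3)[OF i] d(1) k(2) by linarith+
      then have "real k / (2 * norm (z - x i)) \<le> real N"
        using \<open>real k \<le> real N * (2 * norm (z - x i))\<close> by (simp only: pos_divide_le_eq)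
      then show ?thesis using \<open>0 < real k\<close> by (simp add: pos_le_divide_eq)
    qed
    moreover have "0 < 1 / (2 * norm (z - x i))" using d(3)[OF i] d(1) by auto
    ultimately show ?thesis using k(2) by (auto intro: ln_mono)
  qed
  have nonneg: "0 \<le> ln (real N / real k)" if "k \<in> {1..N}" for k
    using that by (intro ln_ge_zero) auto
  have far: "(\<Sum>i\<in>A. ?g i) \<le> real N"
    if A: "A \<subseteq> B" and k: "\<And>i. i \<in> A \<Longrightarrow> int (k i) = \<bar>int i - l\<bar> - 1 \<and> k i \<ge> 1"
      and inj: "inj_on k A" for A and k :: "nat \<Rightarrow> nat"
  proof -
    have "(\<Sum>i\<in>A. ?g i) \<le> (\<Sum>i\<in>A. ln (real N / real (k i)))"
      using A k g_far by (intro sum_mono) blast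
    also have "\<dots> = (\<Sum>j\<in>k ` A. ln (real N / real j))"
      using inj by (simp add: sum.reindex)
    also have "\<dots> \<le> (\<Sum>j=1..N. ln (real N / real j))"
    proof (rule sum_mono2)
      show "k ` A \<subseteq> {1..N}" using A k g_far by blast
    qed (use nonneg in auto)
    also have "\<dots> \<le> N" by (rule sum_ln_ratio_le)
    finally show ?thesis .
  qed
  have "(\<Sum>i\<in>lo. ?g i) \<le> N"
    by (rule far[of lo "\<lambda>i. nat (l - int i - 1)"]) (auto simp: lo_def inj_on_def)
  moreover have "(\<Sum>i\<in>hi. ?g i) \<le> N"
    by (rule far[of hi "\<lambda>i. nat (int i - l - 1)"]) (auto simp: hi_def inj_on_def)
  moreover have "(\<Sum>i\<in>near. ?g i) \<le> 3 * ln (1 / (2 * d))"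
  proof -
    have l0: "0 \<le> ln (1 / (2 * d))" using d by (intro ln_ge_zero) auto
    have "int ` near \<subseteq> {l-1..l+1}" by (auto simp: near_def)
    then have "card (int ` near) \<le> card {l-1..l+1}" by (intro card_mono) auto
    then have c: "card near \<le> 3" by (simp add: card_image)
    have "?g i \<le> ln (1 / (2 * d))" if "i \<in> near" for i
      using d(1) d(3)[of i] that by (intro ln_mono) (auto simp: near_def frac_le)
    then have "(\<Sum>i\<in>near. ?g i) \<le> card near * ln (1 / (2 * d))"
      using sum_bounded_above[of near ?g] by auto
    also have "\<dots> \<le> 3 * ln (1 / (2 * d))"
      using c l0 by (intro mult_right_mono) auto
    finally show ?thesis .
  qed
  moreover have "(\<Sum>i\<in>B. ?g i) = (\<Sum>i\<in>near. ?g i) + ((\<Sum>i\<in>lo. ?g i) + (\<Sum>i\<in>hi. ?g i))"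
    using fin split
    by (metis (no_types, lifting) finite_Un sum.union_disjoint)
  ultimately show ?thesis by (simp add: N_def)
qed

text \<open>A subharmonic function that is nearly nonpositive and vanishes at the origin cannot be very
  negative on a set that meets many circles about the origin. Choose a point of the set in each of
  \<open>m\<close> of the \<open>n\<close> annuli and compare \<open>w\<close> with the potential \<open>G\<close> of these points: near
  the points \<open>w\<close> is at most \<open>-1\<close> while \<open>G\<close> is \<open>O(n)\<close>, and on the unit circle \<open>G\<close> is nonpositive,
  so \<open>w + lam * G\<close> with \<open>lam\<close> of order \<open>1 / n\<close> is small everywhere. At the origin, however, \<open>G\<close> is at
  least \<open>m / 2\<close>, and \<open>m\<close> comparable to \<open>n\<close> is impossible.\<close>

lemma few_circles_meet_low_set:
  assumes w: "subharmonic_on w (ball 0 1)" "continuous_on (cball 0 1) w"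
    and le: "\<And>z. norm z \<le> 1 \<Longrightarrow> w z \<le> 1/100" and w0: "w 0 = 0"
    and K: "\<And>z. z \<in> K \<Longrightarrow> norm z \<le> 1 \<Longrightarrow> w z \<le> -2"
  obtains n :: nat where "n > 0"
    "2 * card {i. i < n \<and> (\<exists>x\<in>K. 1/8 + real i / (8 * n) \<le> norm x \<and> norm x < 1/8 + real (Suc i) / (8 * n))} < n"
proof -
  have "uniformly_continuous_on (cball 0 1) w"
    using w(2) by (intro compact_uniformly_continuous) auto
  then obtain d0 where d0: "d0 > 0"
    "\<And>x y. x \<in> cball 0 1 \<Longrightarrow> y \<in> cball 0 1 \<Longrightarrow> dist y x < d0 \<Longrightarrow> dist (w y) (w x) < 1"
    unfolding uniformly_continuous_on_def by (metis zero_less_one)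
  define d where "d = min (d0 / 2) (1/16)"
  have d: "0 < d" "d \<le> 1/16" "d < d0" using d0(1) by (auto simp: d_def)
  \<comment> \<open>The number of annuli is chosen after \<open>d\<close>, so that the three nearest points, each
    contributing at most \<open>ln (1 / (2 * d))\<close>, do not matter.\<close>
  obtain n :: nat where n: "real n \<ge> 3 * ln (1 / (2 * d)) + 1" using real_arch_simple by blast
  have "ln (1 / (2 * d)) \<ge> 0" using d by (intro ln_ge_zero) auto
  then have n0: "n > 0" using n by linarith
  define B where "B = {i. i < n \<and> (\<exists>x\<in>K. 1/8 + real i / (8 * n) \<le> norm x \<and> norm x < 1/8 + real (Suc i) / (8 * n))}"
  have fin: "finite B" by (simp add: B_def)
  have "2 * card B < n"
  proof (rule ccontr)
    assume "\<not> 2 * card B < n"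
    then have many: "real n \<le> 2 * card B" by linarith
    have "\<forall>i\<in>B. \<exists>x. x \<in> K \<and> 1/8 + real i / (8 * n) \<le> norm x \<and> norm x < 1/8 + real (Suc i) / (8 * n)"
      by (auto simp: B_def)
    then obtain x where x: "\<And>i. i \<in> B \<Longrightarrow> x i \<in> K"
      "\<And>i. i \<in> B \<Longrightarrow> 1/8 + real i / (8 * n) \<le> norm (x i) \<and> norm (x i) < 1/8 + real (Suc i) / (8 * n)"
      by metis
    have xn: "1/8 \<le> norm (x i)" "norm (x i) \<le> 1/4" if "i \<in> B" for i
    proof -
      have "0 \<le> real i / (8 * n)" "real (Suc i) / (8 * n) \<le> 1/8" using that n0 by (auto simp: B_def field_simps)
      then show "1/8 \<le> norm (x i)" "norm (x i) \<le> 1/4" using x(2)[OF that] by linarith+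
    qed
    define G where "G = (\<lambda>z. \<Sum>i\<in>B. ln (1 / (2 * norm (z - x i))))"
    define lam :: real where "lam = 1 / (17 * real n)"
    have lam: "lam > 0" using n0 by (simp add: lam_def)
    define S where "S = ball 0 1 - (\<Union>i\<in>B. cball (x i) d)"
    have oS: "open S" unfolding S_def using fin by (intro open_Diff) auto
    have clS: "closure S \<subseteq> cball 0 1 - (\<Union>i\<in>B. ball (x i) d)"
    proof (rule closure_minimal)
      show "S \<subseteq> cball 0 1 - (\<Union>i\<in>B. ball (x i) d)" by (auto simp: S_def)
      show "closed (cball 0 1 - (\<Union>i\<in>B. ball (x i) d))" by (intro closed_Diff) auto
    qed
    have nex: "z \<noteq> x i" if "z \<in> closure S" "i \<in> B" for z i
      using that clS d(1) by force
    have G_harm: "harmonic_at (\<lambda>z. ln (1 / (2 * norm (z - x i)))) z" if "z \<in> closure S" "i \<in> B" for z i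
    proof -
      have "harmonic_at (\<lambda>z. ln (norm (1 / (2 * (z - x i))))) z"
        using nex[OF that] by (intro harmonic_at_ln_norm analytic_intros) auto
      moreover have "norm (1 / (2 * (z - x i))) = 1 / (2 * norm (z - x i))" for z
        by (simp only: norm_divide norm_mult norm_one norm_numeral)
      ultimately show ?thesis by simp
    qed
    have G_le: "G z \<le> 17 * real n" if "z \<in> closure S" for z
    proof -
      have "G z \<le> 3 * ln (1 / (2 * d)) + 16 * real n"
        unfolding G_def
      proof (rule potential_spaced_points_le[OF _ x(2)])
        show "d \<le> norm (z - x i)" if "i \<in> B" for i
          using clS \<open>z \<in> closure S\<close> that by (force simp: dist_norm norm_minus_commute)
      qed (use clS that d in \<open>auto simp: B_def\<close>)
      then show ?thesis using n by linarith
    qed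
    have "w 0 + lam * G 0 \<le> 1/100"
    proof (rule subharmonic_maximum_principle[where S = S and w = "\<lambda>z. w z + lam * G z"])
      have "subharmonic_on (\<lambda>z. w z - (- lam) * G z) S"
      proof (rule subharmonic_on_diff_harmonic)
        show "subharmonic_on w S" by (rule subharmonic_on_subset[OF w(1)]) (auto simp: S_def)
        show "harmonic_at (\<lambda>z. - lam * G z) z" if "z \<in> S" for z
          unfolding G_def using that closure_subset
          by (intro harmonic_at_cmult harmonic_at_sum G_harm) auto
      qed
      then show "subharmonic_on (\<lambda>z. w z + lam * G z) S" by simp
      have "continuous_on (closure S) G"
        unfolding G_def using G_harm harmonic_at_imp_isCont
        by (intro continuous_on_sum continuous_at_imp_continuous_on) auto
      then show "continuous_on (closure S) (\<lambda>z. w z + lam * G z)"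
        using clS by (intro continuous_intros continuous_on_subset[OF w(2)]) auto
      show "bounded S" by (rule bounded_subset[OF bounded_ball[of 0 1]]) (auto simp: S_def)
      show "0 \<in> S" using xn d by (force simp: S_def)
      fix z assume z: "z \<in> frontier S"
      then have zc: "z \<in> closure S" and zS: "z \<notin> S" using oS by (auto simp: frontier_def interior_open)
      then have z1: "norm z \<le> 1" using clS by auto
      show "w z + lam * G z \<le> 1/100"
      proof (cases "norm z = 1")
        case True
        have "ln (1 / (2 * norm (z - x i))) \<le> 0" if "i \<in> B" for i
        proof -
          have "norm z - norm (x i) \<le> norm (z - x i)" by (rule norm_triangle_ineq2)
          then have "norm (z - x i) \<ge> 1/2" using xn[OF that] True by linarith
          then have "0 < 2 * norm (z - x i)" "1 \<le> 2 * norm (z - x i)" by linarith+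
          then have "0 < 1 / (2 * norm (z - x i))" "1 / (2 * norm (z - x i)) \<le> 1"
            using divide_le_eq_1_pos[of "2 * norm (z - x i)" 1] by auto
          then show ?thesis using ln_mono[of "1 / (2 * norm (z - x i))" 1] by simp
        qed
        then have "G z \<le> 0" unfolding G_def by (intro sum_nonpos) auto
        then have "lam * G z \<le> 0" using lam by (simp add: mult_le_0_iff)
        then show ?thesis using le[OF z1] by linarith
      next
        case False
        then obtain i where i: "i \<in> B" "dist (x i) z \<le> d" using zS z1 by (auto simp: S_def)
        have "dist (w z) (w (x i)) < 1"
          using i d xn[of i] z1 by (intro d0(2)) (auto simp: dist_commute)
        moreover have "w (x i) \<le> -2" using K[OF x(1)[OF i(1)]] xn[OF i(1)] by auto
        ultimately have "w z \<le> -1" by (auto simp: dist_real_def)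
        moreover have "lam * G z \<le> lam * (17 * real n)" using G_le[OF zc] lam by (intro mult_left_mono) auto
        then have "lam * G z \<le> 1" using n0 by (simp add: lam_def)
        ultimately show ?thesis by linarith
      qed
    qed (rule oS)
    moreover have "G 0 \<ge> card B * (1/2)"
    proof -
      have "ln (1 / (2 * norm (0 - x i))) \<ge> 1/2" if "i \<in> B" for i
      proof -
        have "ln 2 \<le> ln (1 / (2 * norm (0 - x i)))"
        proof (intro ln_mono)
          have "0 < 2 * norm (0 - x i)" "2 * (2 * norm (0 - x i)) \<le> 1" using xn[OF that] by auto
          then show "2 \<le> 1 / (2 * norm (0 - x i))" by (subst pos_le_divide_eq)
        qed simp
        then show ?thesis using ln2_ge_two_thirds by linarith
      qed
      then show ?thesis unfolding G_def by (rule sum_bounded_below)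
    qed
    then have "G 0 \<ge> real n / 4" using many by linarith
    then have "lam * G 0 \<ge> lam * (real n / 4)" using lam by (intro mult_left_mono) auto
    then have "lam * G 0 \<ge> 1/68" using n0 by (simp add: lam_def)
    ultimately show False using w0 by simp
  qed
  then show thesis using that[OF n0] by (simp add: B_def)
qed

text \<open>Let an annulus in which \<open>v - u = ln |F|\<close> surround a zero \<open>x\<close> of \<open>v\<close>. The harmonic extensions \<open>q\<close>
  and \<open>q'\<close> of \<open>v - u\<close> from two circles in the annulus satisfy \<open>q \<le> q'\<close>, so that the winding number
  is nonnegative. If it were zero, then \<open>q\<close> and \<open>q'\<close> would agree at the center, hence everywhere; then
  \<open>v - u\<close> would touch its majorant \<open>q'\<close> on the inner circle, and by the strong maximum principle \<open>v\<close> would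
  be harmonic in the disc. Being nonnegative with a zero, it would vanish, contrary to \<open>v 0 > 0\<close>. So the winding number is at
  least one, and the extensions grow at the center at least like the logarithm of the radius. In terms
  of Riesz measures: the measure of \<open>v\<close> enclosed by the annulus is a positive integer.\<close>

lemma ringed_hole_growth:
  fixes v u :: "complex \<Rightarrow> real"
  assumes v: "subharmonic_on v (ball 0 1)" "\<And>z. norm z < 1 \<Longrightarrow> 0 \<le> v z"
    and u: "\<And>z. norm z < 1 \<Longrightarrow> harmonic_at u z"
    and v0: "0 < v 0" and hole: "norm x < s" "v x = 0"
    and F: "F holomorphic_on {z. t1 < norm z \<and> norm z < t2}"
    and nz: "\<And>z. t1 < norm z \<Longrightarrow> norm z < t2 \<Longrightarrow> F z \<noteq> 0"
    and eq: "\<And>z. t1 < norm z \<Longrightarrow> norm z < t2 \<Longrightarrow> v z - u z = ln (norm (F z))"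
    and t: "0 \<le> t1" "t1 < s" "s < s'" "s' < t2" "t2 \<le> 1"
  obtains q q' where "q analytic_on cball 0 s" "q' analytic_on cball 0 s'"
    "\<And>z. norm z = s \<Longrightarrow> Re (q z) = v z - u z"
    "\<And>z. norm z = s' \<Longrightarrow> Re (q' z) = v z - u z"
    "Re (q' 0) \<ge> Re (q 0) + ln (s' / s)"
proof -
  let ?w = "\<lambda>z. v z - u z"
  have s0: "0 < s" "s' < 1" using t by auto
  have "t1 < (t1 + s) / 2" "(t1 + s) / 2 < (s' + t2) / 2" "(s' + t2) / 2 < t2"
    using t by auto
  from circle_harmonic_extension[OF F nz t(1) this]
  obtain N :: int and c Q where Q0: "\<forall>r. (t1 + s) / 2 < r \<and> r < (s' + t2) / 2 \<longrightarrow> Q r analytic_on cball 0 r \<and>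
       (\<forall>z. norm z = r \<longrightarrow> Re (Q r z) = ln (norm (F z))) \<and> Re (Q r 0) = of_int N * ln r + c"
    by blast
  have Q: "q analytic_on cball 0 r \<and> (\<forall>z. norm z = r \<longrightarrow> Re (q z) = ln (norm (F z))) \<and>
      Re (q 0) = of_int N * ln r + c"
    if "q = Q r" "(t1 + s) / 2 < r" "r < (s' + t2) / 2" for q r
    using Q0 that by blast
  have in1: "(t1 + s) / 2 < s" "s < (s' + t2) / 2" "(t1 + s) / 2 < s'" "s' < (s' + t2) / 2"
    using t by auto
  define q where "q = Q s"
  define q' where "q' = Q s'"
  have qa: "q analytic_on cball 0 s" and qa': "q' analytic_on cball 0 s'"
    using Q[OF q_def] Q[OF q'_def] in1 by auto
  have qe: "Re (q z) = ?w z" if "norm z = s" for z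
    using Q[OF q_def in1(1,2)] eq[of z] that t by simp
  have qe': "Re (q' z) = ?w z" if "norm z = s'" for z
    using Q[OF q'_def in1(3,4)] eq[of z] that t by simp
  have q0: "Re (q' 0) = Re (q 0) + of_int N * ln (s' / s)"
    using Q[OF q_def in1(1,2)] Q[OF q'_def in1(3,4)] s0 t by (simp add: ln_div algebra_simps)
  have sub: "subharmonic_on ?w (ball 0 1)"
    using v u by (intro subharmonic_on_diff_harmonic) auto
  have w_cont: "continuous_on (ball 0 1) ?w" using sub by (simp add: subharmonic_on_def)
  have maj': "?w z \<le> Re (q' z)" if "norm z \<le> s'" for z
  proof (rule subharmonic_majorant[OF _ _ qa'])
    show "subharmonic_on ?w (ball 0 s')"
      by (rule subharmonic_on_subset[OF sub]) (use s0 in auto)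
    show "continuous_on (cball 0 s') ?w"
      by (rule continuous_on_subset[OF w_cont]) (use s0 in auto)
  qed (use qe' that s0 t in auto)
  have qa'': "q' analytic_on cball 0 s"
    by (rule analytic_on_subset[OF qa']) (use t in auto)
  have q_sub: "subharmonic_on (\<lambda>z. Re (q z)) (ball 0 s)"
    by (intro subharmonic_on_harmonic harmonic_at_Re_analytic_on[OF qa]) auto
  have maj: "Re (q z) \<le> Re (q' z)" if "norm z \<le> s" for z
    by (rule subharmonic_majorant[OF q_sub continuous_on_Re_analytic[OF qa] qa''])
       (use qe maj' that s0 t in auto)
  have lnpos: "ln (s' / s) > 0" using t s0 by (simp add: ln_gt_zero)
  have "N \<noteq> 0"
  proof
    assume "N = 0"
    then have eq0: "Re (q' 0) = Re (q 0)" using q0 by simp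
    have "Re (q z) - Re (q' z) = Re (q 0) - Re (q' 0)" if "z \<in> ball 0 s" for z
    proof (rule subharmonic_strong_maximum[of "\<lambda>z. Re (q z) - Re (q' z)" "ball 0 s"])
      show "subharmonic_on (\<lambda>z. Re (q z) - Re (q' z)) (ball 0 s)"
        by (intro subharmonic_on_harmonic harmonic_at_diff harmonic_at_Re_analytic_on[OF qa]
              harmonic_at_Re_analytic_on[OF qa'']) auto
    qed (use that s0 maj eq0 in auto)
    then have "Re (q z) - Re (q' z) = 0" if "z \<in> ball 0 s" for z using that eq0 by simp
    then have cl: "Re (q (of_real s)) - Re (q' (of_real s)) = 0"
      using continuous_constant_on_closure[of "ball 0 s" "\<lambda>z. Re (q z) - Re (q' z)" 0 "of_real s"] s0
        continuous_on_diff[OF continuous_on_Re_analytic[OF qa] continuous_on_Re_analytic[OF qa'']]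
      by (simp add: closure_ball)
    have eq1: "?w z - Re (q' z) = ?w (of_real s) - Re (q' (of_real s))" if "z \<in> ball 0 s'" for z
    proof (rule subharmonic_strong_maximum[of "\<lambda>z. ?w z - Re (q' z)" "ball 0 s'"])
      have "subharmonic_on ?w (ball 0 s')"
        by (rule subharmonic_on_subset[OF sub]) (use s0 in auto)
      then show "subharmonic_on (\<lambda>z. ?w z - Re (q' z)) (ball 0 s')"
        by (rule subharmonic_on_diff_harmonic) (auto intro: harmonic_at_Re_analytic_on[OF qa'])
      show "?w z - Re (q' z) \<le> ?w (of_real s) - Re (q' (of_real s))" if "z \<in> ball 0 s'" for z
        using maj'[of z] that cl qe[of "of_real s"] s0 by simp
    qed (use that t s0 in auto)
    have "v z = Re (q' z) + u z" if "z \<in> ball 0 s'" for z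
      using eq1[OF that] cl qe[of "of_real s"] s0 by simp
    then have veq: "\<forall>z\<in>ball 0 s'. Re (q' z) + u z = v z" by simp
    have "v 0 = v x"
    proof (rule harmonic_strong_minimum[of "ball 0 s'"])
      fix z :: complex assume z: "z \<in> ball 0 s'"
      show "harmonic_at v z"
      proof (rule harmonic_at_cong)
        show "harmonic_at (\<lambda>z. Re (q' z) + u z) z"
          using z s0 by (intro harmonic_at_add harmonic_at_Re_analytic_on[OF qa'] u) auto
        show "\<forall>\<^sub>F z in nhds z. Re (q' z) + u z = v z"
          using eventually_nhds_in_open[OF open_ball z] by eventually_elim (use veq in blast)
      qed
      show "v x \<le> v z" using v(2)[of z] z s0 hole by simp
    qed (use hole t s0 in auto)
    then show False using v0 hole by simp
  qed
  moreover have "N \<ge> 0"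
  proof -
    have "of_int N * ln (s' / s) \<ge> 0" using maj[of 0] q0 s0 by simp
    then show ?thesis using lnpos by (simp add: zero_le_mult_iff)
  qed
  ultimately have "real_of_int N \<ge> 1" by simp
  then have "of_int N * ln (s' / s) \<ge> ln (s' / s)" using lnpos by simp
  then show thesis using that[OF qa qa' qe qe'] q0 by simp
qed

text \<open>Here \<open>u\<close> is a harmonic function that nearly majorizes \<open>v\<close> and touches it at the center.
  The complement of \<open>U\<close> cannot meet many circles, since \<open>v - u \<le> -2\<close> there.
  Hence at least half of the \<open>n\<close> thin annuli between the radii \<open>1/8\<close> and \<open>1/4\<close> lie in \<open>U\<close>. If there
  is a point outside \<open>U\<close> within radius \<open>1/8\<close>, then all of these annuli surround it, and each of them forces
  every harmonic majorant of \<open>v - u\<close> to gain at least \<open>1 / (4 n)\<close> at the center. The total gain is at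
  least \<open>1/8\<close>, whereas the constant \<open>1/100\<close> is a majorant.\<close>

theorem no_holes_near_center:
  fixes v u :: "complex \<Rightarrow> real"
  assumes v: "subharmonic_on v (ball 0 1)" "continuous_on (cball 0 1) v"
    "\<And>z. norm z \<le> 1 \<Longrightarrow> 0 \<le> v z"
    and u: "\<And>z. norm z \<le> 1 \<Longrightarrow> harmonic_at u z" "\<And>z. norm z \<le> 1 \<Longrightarrow> 2 \<le> u z"
    and le: "\<And>z. norm z \<le> 1 \<Longrightarrow> v z \<le> u z + 1/100" and v0: "v 0 = u 0"
    and U: "\<And>z. norm z \<le> 1 \<Longrightarrow> z \<notin> U \<Longrightarrow> v z = 0"
    and F: "F holomorphic_on U \<inter> ball 0 1" "\<And>z. z \<in> U \<inter> ball 0 1 \<Longrightarrow> F z \<noteq> 0"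
    and eq: "\<And>z. z \<in> U \<inter> ball 0 1 \<Longrightarrow> v z - u z = ln (norm (F z))"
  shows "ball 0 (1/8) \<subseteq> U"
proof (rule ccontr)
  assume "\<not> ball 0 (1/8) \<subseteq> U"
  then obtain x where x: "norm x < 1/8" "x \<notin> U" unfolding subset_iff mem_ball_0 by blast
  have vx: "v x = 0" using U[of x] x by simp
  have vpos: "0 < v 0" using v0 u(2)[of 0] by simp
  let ?w = "\<lambda>z. v z - u z"
  have sub: "subharmonic_on ?w (ball 0 1)"
    using v u by (intro subharmonic_on_diff_harmonic) auto
  have u_cont: "continuous_on (cball 0 1) u"
    using u(1) harmonic_at_imp_isCont by (intro continuous_at_imp_continuous_on) auto
  have w_cont: "continuous_on (cball 0 1) ?w" using v(2) u_cont by (intro continuous_intros)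
  obtain n :: nat where n: "n > 0"
    "2 * card {i. i < n \<and> (\<exists>x\<in>-U. 1/8 + real i / (8 * n) \<le> norm x \<and> norm x < 1/8 + real (Suc i) / (8 * n))} < n"
  proof (rule few_circles_meet_low_set[OF sub w_cont])
    show "?w z \<le> 1/100" if "norm z \<le> 1" for z using le[OF that] by simp
    show "?w z \<le> -2" if "z \<in> -U" "norm z \<le> 1" for z using u(2)[OF that(2)] U[OF that(2)] that by simp
  qed (use v0 in auto)
  define T where "T = (\<lambda>i. 1/8 + real i / (8 * real n))"
  define good where "good = {i. i < n \<and> {z. T i \<le> norm z \<and> norm z < T (Suc i)} \<subseteq> U}"
  define bad where "bad = {i. i < n \<and> (\<exists>x\<in>-U. T i \<le> norm x \<and> norm x < T (Suc i))}"
  have "{..<n} = good \<union> bad" by (auto simp: good_def bad_def)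
  then have "card {..<n} \<le> card good + card bad" by (metis card_Un_le)
  moreover have "2 * card bad < n" using n(2) by (simp add: bad_def T_def)
  ultimately have many: "real n / 2 \<le> card good" by simp
  have T_le: "T i \<le> 1/4" if "i \<le> n" for i
  proof -
    have "real i / (8 * real n) \<le> real n / (8 * real n)" using that n by (intro divide_right_mono) auto
    also have "\<dots> = 1/8" using n by simp
    finally show ?thesis unfolding T_def by linarith
  qed
  have T_ge: "1/8 \<le> T i" for i by (simp add: T_def)
  have T_Suc: "T (Suc i) = T i + 1 / (8 * real n)" for i by (simp add: T_def add_divide_distrib)
  \<comment> \<open>The least value at the center of a harmonic majorant of \<open>v - u\<close> on the circle of
    radius \<open>T i\<close> is bounded from below; the bound is accumulated annulus by annulus.\<close>
  define claim where "claim = (\<lambda>i. \<forall>p. p analytic_on cball 0 (T i) \<longrightarrow>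
      (\<forall>z. norm z = T i \<longrightarrow> ?w z \<le> Re (p z)) \<longrightarrow> card {j\<in>good. j < i} / (4 * real n) \<le> Re (p 0))"
  have maj: "?w z \<le> Re (p z)"
    if p: "p analytic_on cball 0 t" "\<And>z. norm z = t \<Longrightarrow> ?w z \<le> Re (p z)" and t: "0 < t" "t < 1"
      and z: "norm z \<le> t" for p t z
  proof (rule subharmonic_majorant[OF _ _ p(1) p(2) t(1) z])
    show "subharmonic_on ?w (ball 0 t)"
      by (rule subharmonic_on_subset[OF sub]) (use t in auto)
    show "continuous_on (cball 0 t) ?w"
      by (rule continuous_on_subset[OF w_cont]) (use t in auto)
  qed
  have "claim i" if "i \<le> n" for i
    using that
  proof (induction i)
    case 0
    have "0 \<le> Re (p 0)" if "p analytic_on cball 0 (T 0)" "\<forall>z. norm z = T 0 \<longrightarrow> ?w z \<le> Re (p z)" for p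
      using maj[OF that(1), of 0] that(2) v0 by (simp add: T_def)
    then show ?case by (simp add: claim_def)
  next
    case (Suc i)
    have IH: "claim i" using Suc by simp
    have Ti: "0 < T i" "T i < T (Suc i)" "T (Suc i) \<le> 1/4"
      using T_ge[of i] T_Suc[of i] n T_le[OF Suc.prems] by auto
    show ?case unfolding claim_def
    proof (intro allI impI)
      fix p assume p: "p analytic_on cball 0 (T (Suc i))" "\<forall>z. norm z = T (Suc i) \<longrightarrow> ?w z \<le> Re (p z)"
      have pw: "?w z \<le> Re (p z)" if "norm z \<le> T (Suc i)" for z
        using maj[OF p(1) _ _ _ that] p(2) Ti by auto
      show "card {j\<in>good. j < Suc i} / (4 * real n) \<le> Re (p 0)"
      proof (cases "i \<in> good")
        case False
        then have "{j\<in>good. j < Suc i} = {j\<in>good. j < i}" by (auto simp: less_Suc_eq)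
        moreover have "p analytic_on cball 0 (T i)"
          by (rule analytic_on_subset[OF p(1)]) (use Ti in auto)
        ultimately show ?thesis using IH pw Ti unfolding claim_def by auto
      next
        case True
        define s where "s = T i + 1 / (32 * real n)"
        define s' where "s' = T i + 3 / (32 * real n)"
        have s: "T i < s" "s < s'" "s' < T (Suc i)" using n by (auto simp: s_def s'_def T_Suc field_simps)
        have ann: "{z. T i < norm z \<and> norm z < T (Suc i)} \<subseteq> U \<inter> ball 0 1"
          using True Ti by (force simp: good_def)
        obtain q q' where q: "q analytic_on cball 0 s" "q' analytic_on cball 0 s'"
          "\<And>z. norm z = s \<Longrightarrow> Re (q z) = ?w z" "\<And>z. norm z = s' \<Longrightarrow> Re (q' z) = ?w z"
          "Re (q' 0) \<ge> Re (q 0) + ln (s' / s)"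
        proof (rule ringed_hole_growth[OF v(1) _ _ vpos _ vx, where F = F and ?t1.0 = "T i" and ?t2.0 = "T (Suc i)" and s = s and s' = s' and u = u])
          show "F holomorphic_on {z. T i < norm z \<and> norm z < T (Suc i)}"
            by (rule holomorphic_on_subset[OF F(1) ann])
          show "norm x < s" using x T_ge[of i] s by simp
          show "F z \<noteq> 0" "?w z = ln (norm (F z))" if "T i < norm z" "norm z < T (Suc i)" for z
          proof -
            have "z \<in> U \<inter> ball 0 1" using ann that by blast
            then show "F z \<noteq> 0" "?w z = ln (norm (F z))" using F(2) eq by blast+
          qed
        qed (use v u Ti s in auto)
        have "q analytic_on cball 0 (T i)" by (rule analytic_on_subset[OF q(1)]) (use s in auto)
        moreover have "?w z \<le> Re (q z)" if "norm z = T i" for z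
          by (rule maj[OF q(1)]) (use q(3) s Ti that in auto)
        ultimately have "card {j\<in>good. j < i} / (4 * real n) \<le> Re (q 0)"
          using IH unfolding claim_def by blast
        moreover have "Re (q' 0) \<le> Re (p 0)"
        proof (rule subharmonic_majorant[where w = "\<lambda>z. Re (q' z)" and t = s'])
          show "subharmonic_on (\<lambda>z. Re (q' z)) (ball 0 s')"
            by (intro subharmonic_on_harmonic harmonic_at_Re_analytic_on[OF q(2)]) auto
          show "p analytic_on cball 0 s'" by (rule analytic_on_subset[OF p(1)]) (use s in auto)
          show "continuous_on (cball 0 s') (\<lambda>z. Re (q' z))" by (rule continuous_on_Re_analytic[OF q(2)])
        qed (use q(4) pw s Ti in auto)
        moreover have "1 / (4 * real n) \<le> ln (s' / s)"
        proof -
          have s4: "0 < s" "s' \<le> 1/4" using s Ti by auto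
          have "1 - s / s' \<le> ln (s' / s)"
            using ln_le_minus_one[of "s / s'"] s s4 by (simp add: ln_div)
          moreover have "1 - s / s' = (s' - s) / s'" using s s4 by (simp add: field_simps)
          moreover have "(s' - s) / (1/4) \<le> (s' - s) / s'" using s s4 by (intro divide_left_mono) auto
          moreover have "(s' - s) / (1/4) = 1 / (4 * real n)" using n by (simp add: s_def s'_def field_simps)
          ultimately show ?thesis by linarith
        qed
        moreover have "{j\<in>good. j < Suc i} = insert i {j\<in>good. j < i}" using True by (auto simp: less_Suc_eq)
        then have "card {j\<in>good. j < Suc i} = Suc (card {j\<in>good. j < i})" by simp
        ultimately show ?thesis using q(5) by (simp add: add_divide_distrib)
      qed
    qed
  qed
  then have "claim n" by simp
  have "?w z \<le> Re (complex_of_real (1/100))" if "norm z = T n" for z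
    using le[of z] T_le[of n] that by (simp only: Re_complex_of_real) linarith
  then have "card {j\<in>good. j < n} / (4 * real n) \<le> Re (complex_of_real (1/100))"
    using \<open>claim n\<close>[unfolded claim_def, rule_format, of "\<lambda>_. complex_of_real (1/100)"]
    by (simp only: analytic_on_const simp_thms)
  moreover have "{j\<in>good. j < n} = good" by (auto simp: good_def)
  ultimately have "card good / (4 * real n) \<le> 1/100" by simp
  moreover have "(real n / 2) / (4 * real n) \<le> card good / (4 * real n)"
    using many by (intro divide_right_mono) auto
  ultimately show False using n by simp
qed

section \<open>Regular growth outside an exceptional set\<close>

text \<open>The Bertrand series, by Cauchy condensation. The shift \<open>n + 1\<close> inside the logarithm makes
  the terms monotone from the start, where \<open>ln 1 = 0\<close> would spoil it.\<close>

lemma summable_inverse_n_ln_powr: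
  assumes \<delta>: "0 < (\<delta>::real)"
  shows "summable (\<lambda>n. 1 / (real n * ln (real n) powr (1 + \<delta>)))"
proof -
  define f where "f = (\<lambda>n. 1 / (real n * ln (real n + 1) powr (1 + \<delta>)))"
  have "summable f \<longleftrightarrow> summable (\<lambda>n. 2^n * f (2^n))"
  proof (rule condensation_test)
    fix m :: nat assume m: "0 < m"
    have "real m * ln (real m + 1) powr (1 + \<delta>) \<le> real (Suc m) * ln (real (Suc m) + 1) powr (1 + \<delta>)"
      using m \<delta> by (intro mult_mono powr_mono2 ln_mono) auto
    moreover have "0 < real m * ln (real m + 1) powr (1 + \<delta>)" using m by (auto simp: ln_gt_zero)
    ultimately show "f (Suc m) \<le> f m" unfolding f_def by (intro divide_left_mono) auto
  qed (auto simp: f_def)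
  moreover have "summable (\<lambda>n. 2^n * f (2^n))"
  proof (rule summable_comparison_test_ev)
    show "summable (\<lambda>n. ln 2 powr (-(1 + \<delta>)) * (real n powr (-(1 + \<delta>))))"
      using \<delta> by (intro summable_mult) (simp add: summable_real_powr_iff)
    show "\<forall>\<^sub>F n in sequentially. norm (2^n * f (2^n)) \<le> ln 2 powr (-(1 + \<delta>)) * (real n powr (-(1 + \<delta>)))"
      using eventually_gt_at_top[of 0]
    proof eventually_elim
      case (elim n)
      have "real n * ln 2 \<le> ln (2 ^ n + 1)"
        by (subst ln_realpow[symmetric]) (auto intro!: ln_mono add_pos_pos)
      then have "(real n * ln 2) powr (1 + \<delta>) \<le> ln (2 ^ n + 1) powr (1 + \<delta>)"
        using \<delta> by (intro powr_mono2) auto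
      moreover have "0 < (real n * ln 2) powr (1 + \<delta>)" using elim by simp
      ultimately have "1 / ln (2 ^ n + 1) powr (1 + \<delta>) \<le> 1 / (real n * ln 2) powr (1 + \<delta>)"
        by (intro divide_left_mono mult_pos_pos) auto
      also have "\<dots> = ln 2 powr (-(1 + \<delta>)) * (real n powr (-(1 + \<delta>)))"
        using elim by (subst (1 2) powr_minus_divide) (simp add: powr_mult)
      finally show ?case by (simp add: f_def)
    qed
  qed
  ultimately have "summable (\<lambda>n. 2 powr (1 + \<delta>) * f n)" by (intro summable_mult) auto
  then show ?thesis
  proof (rule summable_comparison_test_ev[rotated])
    show "\<forall>\<^sub>F n in sequentially. norm (1 / (real n * ln (real n) powr (1 + \<delta>))) \<le> 2 powr (1 + \<delta>) * f n"
      using eventually_ge_at_top[of 2]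
    proof eventually_elim
      case (elim n)
      have n: "real n \<ge> 2" using elim by simp
      have "real n + 1 \<le> real n * real n"
        using mult_right_mono[OF n, of "real n"] n by linarith
      then have "ln (real n + 1) \<le> ln (real n * real n)" using n by (intro ln_mono) auto
      also have "\<dots> = 2 * ln (real n)" using n by (simp add: ln_mult)
      finally have "ln (real n + 1) powr (1 + \<delta>) \<le> (2 * ln (real n)) powr (1 + \<delta>)"
        using \<delta> by (intro powr_mono2) auto
      then have "real n * ln (real n + 1) powr (1 + \<delta>) \<le> 2 powr (1 + \<delta>) * (real n * ln (real n) powr (1 + \<delta>))"
        using n by (simp add: powr_mult mult_ac)
      moreover have "0 < ln (real n)" "0 < ln (real n + 1)" using n by (auto simp: ln_gt_zero)
      ultimately show ?case using n by (simp add: f_def divide_simps mult_ac)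
    qed
  qed
qed

lemma powr_increment_le:
  fixes p :: real and n :: nat
  assumes p: "1 \<le> p" and n: "0 < n"
  shows "real (Suc n) powr p - real n powr p \<le> p * 2 powr (p - 1) * real n powr (p - 1)"
proof -
  have "\<exists>z. real n < z \<and> z < real (Suc n) \<and>
      real (Suc n) powr p - real n powr p = (real (Suc n) - real n) * (p * z powr (p - 1))"
    by (rule MVT2) (use n in \<open>auto intro!: has_real_derivative_powr\<close>)
  then obtain z where z: "real n < z" "z < real (Suc n)"
    "real (Suc n) powr p - real n powr p = p * z powr (p - 1)" by auto
  have "z powr (p - 1) \<le> (2 * real n) powr (p - 1)"
    using z n p by (intro powr_mono2) auto
  then show ?thesis using z p by (simp add: powr_mult mult.assoc mult_left_mono)
qed

text \<open>A growth lemma of Borel type that controls the increment of \<open>a\<close> on both sides of \<open>r\<close>. Take the levels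
  \<open>A n = n ^ (1 / \<beta>)\<close>, whose gaps are \<open>O(A n ^ (1 - \<beta>))\<close>, and let \<open>s n\<close> be the place where \<open>a\<close> reaches the
  level \<open>A n\<close>. Between consecutive places \<open>a\<close> varies by no more than a gap, so it suffices that \<open>r\<close>
  is farther from every \<open>s n\<close> than the range allowed for \<open>x\<close>. The set \<open>E\<close> removes intervals about the points
  \<open>s n\<close> for that purpose. Their total measure with density \<open>1 / (1 - t)\<close> has a bound that depends on the levels only and not on \<open>a\<close>:
  a constant times the sum of \<open>1 / (n * (ln n) ^ (1 + \<delta>))\<close>.\<close>

theorem exceptional_set_exists:
  fixes a :: "real \<Rightarrow> real"
  assumes r0: "0 < r0" "r0 < 1" and mono: "\<And>x y. r0 \<le> x \<Longrightarrow> x \<le> y \<Longrightarrow> y < 1 \<Longrightarrow> a x \<le> a y"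
    and unbounded: "\<And>M. \<exists>r. r0 \<le> r \<and> r < 1 \<and> M \<le> a r"
    and \<beta>: "0 < \<beta>" "\<beta> \<le> 1/2" and \<delta>: "0 < \<delta>"
  shows "\<exists>E C. E \<subseteq> {r0..<1} \<and> E \<in> sets lebesgue \<and>
     (\<integral>\<^sup>+t\<in>E. ennreal (1 / (1 - t)) \<partial>lebesgue) < \<infinity> \<and> 0 < C \<and>
     (\<forall>\<^sub>F r in at_left 1. r \<notin> E \<longrightarrow>
        (\<forall>x. \<bar>x - r\<bar> < (1 - r) / (2 * a r powr \<beta> * ln (a r) powr (1 + \<delta>)) \<longrightarrow>
           r0 \<le> x \<and> x < 1 \<and> \<bar>a x - a r\<bar> \<le> C * a r powr (1 - \<beta>)))"
proof -
  define A where "A = (\<lambda>n::nat. real n powr (1 / \<beta>))"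
  define c where "c = (\<lambda>n::nat. 1 / (real n * ln (A n) powr (1 + \<delta>)))"
  define L where "L = (\<lambda>n. {r. r0 \<le> r \<and> r < 1 \<and> A n \<le> a r})"
  define s where "s = (\<lambda>n. Inf (L n))"
  \<comment> \<open>The index is shifted because the interval about \<open>s n\<close> also has to serve radii \<open>r\<close>
    to the left of \<open>s n\<close>, for which \<open>a r\<close> is only known to be at least \<open>A (n - 1)\<close>.\<close>
  define H where "H = (\<lambda>n. (1 - s n) * c (n - 1))"
  define I where "I = (\<lambda>n. {s n - H n .. s n + H n})"
  define E where "E = (\<Union>n\<in>{4..}. I n) \<inter> {r0..<1}"
  define p where "p = 1 / \<beta>"
  define C where "C = p * 2 powr (p - 1)"
  have p: "p \<ge> 2" using \<beta> by (simp add: p_def field_simps)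
  have C: "C > 0" using p by (simp add: C_def)
  have L_ne: "L n \<noteq> {}" for n using unbounded[of "A n"] by (auto simp: L_def)
  have L_bdd: "bdd_below (L n)" for n by (intro bdd_belowI[of _ r0]) (auto simp: L_def)
  have s_le: "s n \<le> r" if "r0 \<le> r" "r < 1" "A n \<le> a r" for n r
    unfolding s_def by (rule cInf_lower[OF _ L_bdd]) (use that in \<open>auto simp: L_def\<close>)
  have s_ge: "r \<le> s n" if "r0 \<le> r" "r < 1" "a r < A n" for n r
    unfolding s_def
  proof (rule cInf_greatest[OF L_ne])
    fix x assume "x \<in> L n"
    then show "r \<le> x" using mono[of x r] that by (force simp: L_def)
  qed
  have s_r0: "r0 \<le> s n" for n
    unfolding s_def by (rule cInf_greatest[OF L_ne]) (auto simp: L_def)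
  have s_1: "s n < 1" for n using L_ne[of n] s_le[of _ n] by (force simp: L_def)
  have lnA: "ln (A n) = p * ln (real n)" if "n > 0" for n
    using that by (simp add: A_def p_def ln_powr)
  have lnA_ge: "1 \<le> ln (A n)" if "n \<ge> 3" for n
  proof -
    have "ln 2 \<le> ln (real n)" using that by (intro ln_mono) auto
    then have "2 * (2/3) \<le> p * ln (real n)" using p ln2_ge_two_thirds by (intro mult_mono) auto
    then show ?thesis using that lnA by simp
  qed
  have A_mono: "A m \<le> A n" if "m \<le> n" for m n
    unfolding A_def using that \<beta> by (intro powr_mono2) auto
  have A_ge1: "A n \<ge> 1" if "n > 0" for n
    unfolding A_def using that \<beta> by (intro ge_one_powr_ge_zero) auto
  have A_pos: "A n > 0" if "n > 0" for n using that by (simp add: A_def)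
  have ell_ge: "1 \<le> ln (A n) powr (1 + \<delta>)" if "n \<ge> 3" for n
    using lnA_ge[OF that] \<delta> by (intro ge_one_powr_ge_zero) auto
  have c_pos: "c n > 0" if "n \<ge> 3" for n
    using ell_ge[OF that] that by (auto simp: c_def intro!: divide_pos_pos mult_pos_pos)
  have c_le: "c n \<le> 1/3" if "n \<ge> 3" for n
  proof -
    have "3 * 1 \<le> real n * ln (A n) powr (1 + \<delta>)" using that ell_ge[OF that] by (intro mult_mono) auto
    then show ?thesis unfolding c_def by (intro divide_left_mono) auto
  qed
  have c_anti: "c n \<le> c m" if "3 \<le> m" "m \<le> n" for m n
  proof -
    have "real m * ln (A m) powr (1 + \<delta>) \<le> real n * ln (A n) powr (1 + \<delta>)"
      using that lnA_ge[of m] A_mono[of m n] A_pos[of m] A_ge1[of m] \<delta>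
      by (intro mult_mono powr_mono2 ln_mono) auto
    moreover have "0 < real m * ln (A m) powr (1 + \<delta>)" using ell_ge[of m] that by (intro mult_pos_pos) auto
    ultimately show ?thesis unfolding c_def by (intro divide_left_mono) auto
  qed
  have "summable (\<lambda>n. p powr (-(1 + \<delta>)) * (1 / (real n * ln (real n) powr (1 + \<delta>))))"
    by (intro summable_mult summable_inverse_n_ln_powr \<delta>)
  then have c_sum: "summable c"
  proof (rule summable_comparison_test_ev[rotated])
    show "\<forall>\<^sub>F n in sequentially. norm (c n) \<le> p powr (-(1 + \<delta>)) * (1 / (real n * ln (real n) powr (1 + \<delta>)))"
      using eventually_ge_at_top[of 3]
    proof eventually_elim
      case (elim n)
      then show ?case using c_pos[OF elim] p lnA[of n]
        by (subst powr_minus_divide) (simp add: c_def powr_mult mult_ac)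
    qed
  qed
  have fin: "(\<integral>\<^sup>+t\<in>E. ennreal (1 / (1 - t)) \<partial>lebesgue) < \<infinity>"
  proof -
    define g where "g = (\<lambda>n t. ennreal (2 / (1 - s n)) * indicator (if 4 \<le> n then I n else {}) t)"
    have I_leb: "(if 4 \<le> n then I n else {}) \<in> sets lebesgue" for n by (simp add: I_def)
    have "(\<integral>\<^sup>+t\<in>E. ennreal (1 / (1 - t)) \<partial>lebesgue) \<le> (\<integral>\<^sup>+t. (\<Sum>n. g n t) \<partial>lebesgue)"
    proof (rule nn_integral_mono)
      fix t :: real
      show "ennreal (1 / (1 - t)) * indicator E t \<le> (\<Sum>n. g n t)"
      proof (cases "t \<in> E")
        case True
        then obtain n where n: "4 \<le> n" "t \<in> I n" by (auto simp: E_def)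
        have "H n \<le> (1 - s n) * (1/3)"
          unfolding H_def using c_le[of "n - 1"] n s_1[of n] by (intro mult_left_mono) auto
        then have "(1 - s n) / 2 \<le> 1 - t" using n s_1[of n] by (auto simp: I_def)
        then have "1 / (1 - t) \<le> 1 / ((1 - s n) / 2)"
          using s_1[of n] by (intro divide_left_mono mult_pos_pos) auto
        then have "1 / (1 - t) \<le> 2 / (1 - s n)" by simp
        then have "ennreal (1 / (1 - t)) * indicator E t \<le> g n t"
          using True n by (simp add: g_def ennreal_leI)
        also have "g n t = (\<Sum>i\<in>{n}. g i t)" by simp
        also have "\<dots> \<le> (\<Sum>n. g n t)" by (rule sum_le_suminf) auto
        finally show ?thesis .
      qed auto
    qed
    also have "\<dots> = (\<Sum>n. \<integral>\<^sup>+t. g n t \<partial>lebesgue)"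
      by (rule nn_integral_suminf) (use I_leb in \<open>auto simp: g_def\<close>)
    also have "\<dots> \<le> (\<Sum>n. ennreal (if 4 \<le> n then 4 * c (n - 1) else 0))"
    proof (rule suminf_le)
      fix n
      show "(\<integral>\<^sup>+t. g n t \<partial>lebesgue) \<le> ennreal (if 4 \<le> n then 4 * c (n - 1) else 0)"
      proof (cases "4 \<le> n")
        case True
        have H0: "0 \<le> H n"
          unfolding H_def using c_pos[of "n - 1"] True s_1[of n] by (intro mult_nonneg_nonneg less_imp_le) auto
        have "(\<integral>\<^sup>+t. g n t \<partial>lebesgue) = ennreal (2 / (1 - s n)) * emeasure lebesgue (I n)"
          unfolding g_def using True I_leb[of n] by (simp add: nn_integral_cmult_indicator)
        also have "emeasure lebesgue (I n) = ennreal (2 * H n)"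
          using H0 by (simp add: I_def)
        also have "ennreal (2 / (1 - s n)) * ennreal (2 * H n) = ennreal (2 / (1 - s n) * (2 * H n))"
          using H0 s_1[of n] by (intro ennreal_mult[symmetric]) auto
        also have "2 / (1 - s n) * (2 * H n) = 4 * c (n - 1)"
          using s_1[of n] by (simp add: H_def)
        finally show ?thesis using True by simp
      qed (simp add: g_def)
    qed auto
    also have "\<dots> < \<infinity>"
    proof -
      have "summable (\<lambda>n. c (Suc n - 1))" using c_sum by simp
      then have "summable (\<lambda>n. c (n - 1))" using summable_Suc_iff[of "\<lambda>n. c (n - 1)"] by blast
      then have "summable (\<lambda>n. 4 * c (n - 1))" by (rule summable_mult)
      then have S: "summable (\<lambda>n. if 4 \<le> n then 4 * c (n - 1) else 0)"
      proof (rule summable_comparison_test_ev[rotated])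
        show "\<forall>\<^sub>F n in sequentially. norm (if 4 \<le> n then 4 * c (n - 1) else 0) \<le> 4 * c (n - 1)"
          using eventually_ge_at_top[of 4]
        proof eventually_elim
          case (elim n)
          then have "0 < c (n - 1)" by (intro c_pos) auto
          then show ?case using elim by simp
        qed
      qed
      have "(\<Sum>n. ennreal (if 4 \<le> n then 4 * c (n - 1) else 0)) =
          ennreal (\<Sum>n. if 4 \<le> n then 4 * c (n - 1) else 0)"
        by (rule suminf_ennreal2[OF _ S]) (use c_pos in \<open>auto simp: less_imp_le\<close>)
      then show ?thesis by simp
    qed
    finally show ?thesis .
  qed
  have E_meas: "E \<in> sets lebesgue"
    unfolding E_def by (intro sets.Int sets.countable_UN') (auto simp: I_def)
  obtain r1 where r1: "r0 \<le> r1" "r1 < 1" "4 powr (1/\<beta>) \<le> a r1" using unbounded by blast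
  have near: "r0 \<le> x \<and> x < 1 \<and> \<bar>a x - a r\<bar> \<le> C * a r powr (1 - \<beta>)"
    if r: "r1 < r" "r < 1" "r \<notin> E"
      and x: "\<bar>x - r\<bar> < (1 - r) / (2 * a r powr \<beta> * ln (a r) powr (1 + \<delta>))" for r x
  proof -
    have rr: "r0 \<le> r" using r r1 by simp
    have ar: "4 powr (1/\<beta>) \<le> a r" using mono[of r1 r] r r1 by simp
    have ar0: "0 < a r" using ar by (smt (verit) powr_gt_zero)
    define n where "n = nat \<lfloor>a r powr \<beta>\<rfloor>"
    have "(4 powr (1/\<beta>)) powr \<beta> \<le> a r powr \<beta>" using ar \<beta> by (intro powr_mono2) auto
    then have a4: "4 \<le> a r powr \<beta>" using \<beta> by (simp add: powr_powr)
    have n: "real n \<le> a r powr \<beta>" "a r powr \<beta> < real (Suc n)" "4 \<le> n"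
      using a4 unfolding n_def by linarith+
    have aux: "(a r powr \<beta>) powr (1/\<beta>) = a r" using \<beta> ar0 by (simp add: powr_powr)
    have An: "A n \<le> a r"
      using powr_mono2[of "1/\<beta>" "real n" "a r powr \<beta>"] n \<beta> aux by (simp add: A_def)
    have ASn: "a r < A (Suc n)"
      using powr_less_mono2[of "1/\<beta>" "a r powr \<beta>" "real (Suc n)"] n \<beta> aux by (simp add: A_def)
    have s1: "s n \<le> r" by (rule s_le[OF rr r(2) An])
    have s2: "r \<le> s (Suc n)" by (rule s_ge[OF rr r(2) ASn])
    define h where "h = (1 - r) / (2 * a r powr \<beta> * ln (a r) powr (1 + \<delta>))"
    have h_le: "h \<le> (1 - r) / 2 * c n"
    proof -
      have "ln (A n) powr (1 + \<delta>) \<le> ln (a r) powr (1 + \<delta>)"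
        using An A_pos[of n] A_ge1[of n] n lnA_ge[of n] \<delta> by (intro powr_mono2 ln_mono) auto
      then have "real n * ln (A n) powr (1 + \<delta>) \<le> a r powr \<beta> * ln (a r) powr (1 + \<delta>)"
        using n by (intro mult_mono) auto
      moreover have "0 < real n * ln (A n) powr (1 + \<delta>)" using ell_ge[of n] n by (intro mult_pos_pos) auto
      ultimately have "1 / (a r powr \<beta> * ln (a r) powr (1 + \<delta>)) \<le> c n"
        unfolding c_def by (intro divide_left_mono) auto
      then have "(1 - r) / 2 * (1 / (a r powr \<beta> * ln (a r) powr (1 + \<delta>))) \<le> (1 - r) / 2 * c n"
        using r by (intro mult_left_mono) auto
      then show ?thesis by (simp add: h_def mult.assoc)
    qed
    have nI: "r \<notin> I n" "r \<notin> I (Suc n)" using r(3) n rr r(2) by (auto simp: E_def)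
    have H0: "0 \<le> H n" "0 \<le> H (Suc n)"
      unfolding H_def using c_pos[of "n - 1"] c_pos[of n] n s_1[of n] s_1[of "Suc n"]
      by (auto intro!: mult_nonneg_nonneg less_imp_le)
    have l: "s n + H n < r" using nI(1) s1 H0 by (auto simp: I_def)
    have u: "r < s (Suc n) - H (Suc n)" using nI(2) s2 H0 by (auto simp: I_def)
    have xb: "r - h < x" "x < r + h" using x by (auto simp: h_def)
    have cn: "0 < c n" "c n \<le> 1/3" using c_pos[of n] c_le[of n] n by auto
    have "h \<le> H n"
    proof -
      have "(1 - r) / 2 * c n \<le> (1 - s n) * c (n - 1)"
        using s1 c_anti[of "n - 1" n] n cn r by (intro mult_mono) auto
      then show ?thesis using h_le by (simp add: H_def)
    qed
    then have xs: "s n < x" using l xb by linarith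
    have xs': "x < s (Suc n)"
    proof (rule ccontr)
      assume "\<not> x < s (Suc n)"
      then have "s (Suc n) < r + h" using xb by linarith
      moreover have "(1 - r) / 2 * c n \<le> (1 - r) / 2 * 1" using cn r by (intro mult_left_mono) auto
      then have "h \<le> (1 - r) / 2" using h_le by simp
      ultimately have "(1 - r) / 2 \<le> 1 - s (Suc n)" by argo
      then have "(1 - r) / 2 * c n \<le> (1 - s (Suc n)) * c n" using cn by (intro mult_right_mono) auto
      then have "h \<le> H (Suc n)" using h_le by (simp add: H_def)
      then show False using u xb \<open>\<not> x < s (Suc n)\<close> by linarith
    qed
    have x1: "r0 \<le> x" "x < 1" using xs xs' s_r0[of n] s_1[of "Suc n"] by linarith+
    have "A n \<le> a x"
    proof -
      obtain t where "t \<in> L n" "t < x"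
        using xs L_ne L_bdd unfolding s_def by (meson cInf_less_iff)
      then show ?thesis using mono[of t x] x1 by (auto simp: L_def)
    qed
    moreover have "a x < A (Suc n)" using s_le[of x "Suc n"] x1 xs' by force
    ultimately have "\<bar>a x - a r\<bar> \<le> A (Suc n) - A n" using An ASn by linarith
    also have "\<dots> \<le> C * real n powr (p - 1)"
      using powr_increment_le[of p n] p n by (simp add: A_def C_def p_def)
    also have "\<dots> \<le> C * (a r powr \<beta>) powr (p - 1)"
      using C n p by (intro mult_left_mono powr_mono2) auto
    also have "(a r powr \<beta>) powr (p - 1) = a r powr (1 - \<beta>)"
    proof -
      have "\<beta> * (p - 1) = 1 - \<beta>" using \<beta> by (simp add: p_def right_diff_distrib)
      then show ?thesis by (simp only: powr_powr)
    qed
    finally show ?thesis using x1 by simp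
  qed
  have ev: "\<forall>\<^sub>F r in at_left 1. r \<notin> E \<longrightarrow>
        (\<forall>x. \<bar>x - r\<bar> < (1 - r) / (2 * a r powr \<beta> * ln (a r) powr (1 + \<delta>)) \<longrightarrow>
           r0 \<le> x \<and> x < 1 \<and> \<bar>a x - a r\<bar> \<le> C * a r powr (1 - \<beta>))"
    using eventually_at_left_real[OF r1(2)] by eventually_elim (use near in auto)
  show ?thesis
  proof (intro exI conjI)
    show "E \<subseteq> {r0..<1}" by (auto simp: E_def)
  qed (fact fin E_meas C ev)+
qed

section \<open>The subharmonic function of a direct tract\<close>

text \<open>At a zero of \<open>v\<close>, a local maximum of \<open>v - Re h\<close> is a local maximum of \<open>- Re h\<close> by
  nonnegativity, so \<open>Re h\<close> is locally constant and then \<open>v\<close> vanishes nearby.\<close>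

lemma subharmonic_on_nonneg:
  assumes "continuous_on S v" "open S" "\<And>x. x \<in> S \<Longrightarrow> 0 \<le> v x"
    and harm: "\<And>x. x \<in> S \<Longrightarrow> v x \<noteq> 0 \<Longrightarrow> harmonic_at v x"
  shows "subharmonic_on v S"
proof (rule subharmonic_onI_at)
  fix x h assume x: "x \<in> S" and h: "h analytic_on {x}"
    and le: "\<forall>\<^sub>F z in nhds x. v z - Re (h z) \<le> v x - Re (h x)"
  show "\<forall>\<^sub>F z in nhds x. v z - Re (h z) = v x - Re (h x)"
  proof (cases "v x = 0")
    case True
    have nn: "\<forall>\<^sub>F z in nhds x. 0 \<le> v z"
      using eventually_nhds_in_open[OF assms(2) x] by eventually_elim (rule assms(3))
    have "\<forall>\<^sub>F z in nhds x. Re (- h z) \<le> Re (- h x)"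
      using le nn by eventually_elim (use True in auto)
    then have "\<forall>\<^sub>F z in nhds x. Re (- h z) = Re (- h x)"
      using h by (intro Re_local_max_imp_locally_const analytic_intros)
    then show ?thesis using nn le by eventually_elim (use True in auto)
  next
    case False
    then have "harmonic_at (\<lambda>z. v z - Re (h z)) x"
      by (intro harmonic_at_diff harm harmonic_at_Re x h)
    from harmonic_local_max[OF this le] show ?thesis .
  qed
qed (rule assms(1))

lemma is_pole_imp_eventually_large:
  assumes "is_pole f z"
  shows "\<forall>\<^sub>F w in at z. R < norm (f w)"
proof -
  have "filterlim (\<lambda>w. norm (f w)) at_top (at z)"
    using assms unfolding is_pole_def by (rule filterlim_at_infinity_imp_norm_at_top)
  then show ?thesis by (simp add: filterlim_at_top_dense)
qed

lemma open_superlevel_with_poles: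
  assumes mero: "f nicely_meromorphic_on D" and "open D"
  shows "open {z \<in> D. is_pole f z \<or> R < norm (f z)}" (is "open ?S")
  unfolding open_subopen[of ?S]
proof
  fix z assume z: "z \<in> ?S"
  have "\<forall>\<^sub>F w in nhds z. is_pole f w \<or> R < norm (f w)"
  proof (cases "is_pole f z")
    case True
    then show ?thesis
      using is_pole_imp_eventually_large[OF True, of R]
      by (auto simp: eventually_at_filter elim: eventually_mono)
  next
    case False
    then have "isCont f z"
      using nicely_meromorphic_on_imp_analytic_at[OF mero] z analytic_at_imp_isCont by blast
    then have "((\<lambda>w. norm (f w)) \<longlongrightarrow> norm (f z)) (nhds z)"
      by (simp add: continuous_at_imp_continuous_at_within isCont_def tendsto_nhds_iff tendsto_norm)
    then have "\<forall>\<^sub>F w in nhds z. R < norm (f w)"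
      using order_tendstoD(1) z False by blast
    then show ?thesis by eventually_elim auto
  qed
  moreover have "\<forall>\<^sub>F w in nhds z. w \<in> D" using z assms(2) by (intro eventually_nhds_in_open) auto
  ultimately have "\<forall>\<^sub>F w in nhds z. w \<in> ?S" by eventually_elim auto
  then show "\<exists>T. open T \<and> z \<in> T \<and> T \<subseteq> ?S" by (auto simp: eventually_nhds)
qed

locale disc_tract =
  fixes f :: "complex \<Rightarrow> complex" and R :: real and U :: "complex set"
  assumes mero: "f nicely_meromorphic_on ball 0 1" and tract: "direct_tract f R U"
begin

abbreviation v where "v \<equiv> tract_fun f R U"

lemma R_pos: "0 < R" using tract by (simp add: direct_tract_def)

lemma open_U: "open U"
  using tract open_superlevel_with_poles[OF mero open_ball] open_components
  unfolding direct_tract_def by blast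

lemma U_props:
  assumes "z \<in> U"
  shows "norm z < 1" "\<not> is_pole f z" "R < norm (f z)" "f z \<noteq> 0" "f analytic_on {z}"
proof -
  have "z \<in> {z \<in> ball 0 1. is_pole f z \<or> R < norm (f z)}"
    using tract assms in_components_subset unfolding direct_tract_def by blast
  moreover show np: "\<not> is_pole f z" using tract assms unfolding direct_tract_def by blast
  ultimately show "norm z < 1" "R < norm (f z)" by auto
  then show "f z \<noteq> 0" "f analytic_on {z}"
    using R_pos np nicely_meromorphic_on_imp_analytic_at[OF mero] by auto
qed

lemma analytic_on_U: "f analytic_on U"
  using U_props(5) analytic_on_analytic_at by blast

lemma v_in: "z \<in> U \<Longrightarrow> v z = ln (norm (f z) / R)"
  using R_pos by (simp add: tract_fun_def norm_divide)

lemma v_out: "z \<notin> U \<Longrightarrow> v z = 0"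
  by (simp add: tract_fun_def)

lemma v_pos: "z \<in> U \<Longrightarrow> 0 < v z"
proof -
  assume z: "z \<in> U"
  then have "1 < norm (f z) / R" using U_props(3)[OF z] R_pos by (simp add: less_divide_eq)
  then show "0 < v z" unfolding v_in[OF z] by (rule ln_gt_zero)
qed

lemma v_nonneg: "0 \<le> v z"
  using v_pos[of z] v_out[of z] by (cases "z \<in> U") auto

lemma harmonic_at_v: "z \<in> U \<Longrightarrow> harmonic_at v z"
proof (rule harmonic_at_cong[where u = "\<lambda>z. ln (norm (f z / of_real R))"])
  assume z: "z \<in> U"
  show "harmonic_at (\<lambda>z. ln (norm (f z / of_real R))) z"
    using U_props[OF z] R_pos by (intro harmonic_at_ln_norm analytic_intros) auto
  show "\<forall>\<^sub>F z in nhds z. ln (norm (f z / of_real R)) = v z"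
    using eventually_nhds_in_open[OF open_U z] by eventually_elim (simp add: tract_fun_def)
qed

text \<open>Outside \<open>U\<close> there are two kinds of points: those of other components of the superlevel set, near
  which \<open>v\<close> vanishes, and those where \<open>f\<close> is finite with \<open>|f| \<le> R\<close>, near which \<open>ln (|f| / R)\<close> has
  small positive part.\<close>

lemma isCont_v:
  assumes z: "norm z < 1"
  shows "isCont v z"
proof (cases "z \<in> U")
  case True
  then show ?thesis by (intro harmonic_at_imp_isCont harmonic_at_v)
next
  case zU: False
  define S where "S = {z \<in> ball 0 1. is_pole f z \<or> R < norm (f z)}"
  have oS: "open S" unfolding S_def by (rule open_superlevel_with_poles[OF mero open_ball])
  have US: "U \<in> components S" using tract by (simp add: direct_tract_def S_def)
  show ?thesis
  proof (cases "z \<in> S")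
    case True
    define V where "V = connected_component_set S z"
    have V: "V \<in> components S" "z \<in> V" "open V"
      using True oS by (auto simp: V_def componentsI intro: open_connected_component)
    have "V \<inter> U = {}" using components_nonoverlap[OF V(1) US] V(2) zU by blast
    then have "\<forall>\<^sub>F w in nhds z. v w = 0"
      using eventually_nhds_in_open[OF V(3,2)] by (auto elim!: eventually_mono intro: v_out)
    then show ?thesis using isCont_cong[of v "\<lambda>_. 0" z] by simp
  next
    case False
    then have np: "\<not> is_pole f z" and le: "norm (f z) \<le> R" using z by (auto simp: S_def)
    have "isCont f z"
      using nicely_meromorphic_on_imp_analytic_at[OF mero] z np analytic_at_imp_isCont by auto
    then have lim: "((\<lambda>w. norm (f w)) \<longlongrightarrow> norm (f z)) (nhds z)"
      by (simp add: isCont_def tendsto_nhds_iff tendsto_norm)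
    have "(v \<longlongrightarrow> 0) (nhds z)"
    proof (rule tendstoI)
      fix e :: real assume e: "e > 0"
      have "norm (f z) < R * exp e" using le R_pos e by (smt (verit) exp_gt_one mult_less_cancel_left1 mult.commute)
      then have "\<forall>\<^sub>F w in nhds z. norm (f w) < R * exp e" using order_tendstoD(2)[OF lim] by blast
      then show "\<forall>\<^sub>F w in nhds z. dist (v w) 0 < e"
      proof eventually_elim
        case (elim w)
        show ?case
        proof (cases "w \<in> U")
          case True
          have "norm (f w) / R < exp e" using elim R_pos by (simp add: field_simps)
          moreover have "0 < norm (f w) / R" using U_props(3)[OF True] R_pos by (intro divide_pos_pos) auto
          ultimately have "ln (norm (f w) / R) < e" by (metis exp_gt_zero ln_exp ln_less_cancel_iff)
          then show ?thesis using v_pos[OF True] v_in[OF True] by simp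
        qed (use e in \<open>simp add: v_out\<close>)
      qed
    qed
    then show ?thesis using v_out[OF zU] by (simp add: isCont_def tendsto_nhds_iff)
  qed
qed

lemma continuous_on_v: "S \<subseteq> ball 0 1 \<Longrightarrow> continuous_on S v"
  using isCont_v by (intro continuous_at_imp_continuous_on) auto

lemma subharmonic_v: "subharmonic_on v (ball 0 1)"
  by (rule subharmonic_on_nonneg)
     (use v_nonneg v_out harmonic_at_v continuous_on_v in \<open>blast+\<close>)

lemma circle_max_attained:
  assumes "0 \<le> r" "r < 1"
  shows "\<exists>z. norm z = r \<and> v z = circle_max v r" and "norm z = r \<Longrightarrow> v z \<le> circle_max v r"
proof -
  have ne: "sphere (0::complex) r \<noteq> {}" using assms by simp
  have c: "continuous_on (sphere 0 r) v" by (rule continuous_on_v) (use assms in auto)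
  obtain x where x: "x \<in> sphere 0 r" "\<And>y. y \<in> sphere 0 r \<Longrightarrow> v y \<le> v x"
    using continuous_attains_sup[OF compact_sphere ne c] by blast
  have "circle_max v r = v x"
    unfolding circle_max_def by (rule cSup_eq_maximum) (use x in auto)
  then show "\<exists>z. norm z = r \<and> v z = circle_max v r" "norm z = r \<Longrightarrow> v z \<le> circle_max v r"
    using x by auto
qed

lemma circle_max_nonneg: "0 \<le> r \<Longrightarrow> r < 1 \<Longrightarrow> 0 \<le> circle_max v r"
  using circle_max_attained(1)[of r] v_nonneg by metis

text \<open>Hadamard's three circles theorem: in an annulus \<open>v\<close> is compared with the affine function of
  \<open>ln |z|\<close> that agrees with the maxima on the two boundary circles.\<close>

lemma convex_circle_max: "convex_on {..<0} (\<lambda>t. circle_max v (exp t))"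
proof (rule convex_on_linorderI)
  fix t x y :: real
  assume t: "0 < t" "t < 1" and xy: "x \<in> {..<0}" "y \<in> {..<0}" "x < y"
  define b where "b = (\<lambda>t. circle_max v (exp t))"
  define m where "m = (1 - t) * x + t * y"
  define \<alpha> where "\<alpha> = (b y - b x) / (y - x)"
  have m: "x < m" "m < y"
  proof -
    have "0 < t * (y - x)" "0 < (1 - t) * (y - x)" using t xy by (auto intro!: mult_pos_pos)
    then show "x < m" "m < y" by (auto simp: m_def algebra_simps)
  qed
  obtain z where z: "norm z = exp m" "v z = b m"
    using circle_max_attained(1)[of "exp m"] m xy by (auto simp: b_def)
  let ?u = "\<lambda>z. \<alpha> * ln (norm z) + (b x - \<alpha> * x)"
  define A where "A = {z::complex. exp x < norm z \<and> norm z < exp y}"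
  have clA: "closure A \<subseteq> {z. exp x \<le> norm z \<and> norm z \<le> exp y}"
    unfolding A_def by (intro closure_minimal closed_Collect_conj closed_Collect_le continuous_intros) auto
  have oA: "open A" unfolding A_def by (rule open_annulus)
  have u: "harmonic_at ?u z" if "z \<in> closure A" for z
    using that clA by (intro harmonic_at_add harmonic_at_cmult harmonic_at_ln_norm)
                      (auto intro: harmonic_at_const)
  have "v z - ?u z \<le> 0"
  proof (rule subharmonic_maximum_principle[where S = A and w = "\<lambda>z. v z - ?u z"])
    have "A \<subseteq> ball 0 1" using xy by (auto simp: A_def) (smt (verit) exp_less_one_iff)
    then show "subharmonic_on (\<lambda>z. v z - ?u z) A"
      using u closure_subset
      by (intro subharmonic_on_diff_harmonic subharmonic_on_subset[OF subharmonic_v]) auto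
    have "closure A \<subseteq> ball 0 1" using clA xy by (auto dest!: subsetD) (smt (verit) exp_less_one_iff)
    then show "continuous_on (closure A) (\<lambda>z. v z - ?u z)"
      using u harmonic_at_imp_isCont
      by (intro continuous_on_diff continuous_on_v continuous_at_imp_continuous_on) auto
    show "bounded A" by (rule bounded_subset[OF bounded_ball[of 0 "exp y"]]) (auto simp: A_def)
    show "z \<in> A" using z m by (simp add: A_def)
    fix w assume "w \<in> frontier A"
    then have "w \<in> closure A" "w \<notin> A" using oA by (auto simp: frontier_def interior_open)
    then consider "norm w = exp x" | "norm w = exp y" using clA by (force simp: A_def)
    then show "v w - ?u w \<le> 0"
    proof cases
      case 1
      then show ?thesis using circle_max_attained(2)[of "exp x" w] xy by (simp add: b_def)
    next
      case 2
      have "\<alpha> * (y - x) = b y - b x" using xy by (simp add: \<alpha>_def)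
      then show ?thesis using 2 circle_max_attained(2)[of "exp y" w] xy by (simp add: b_def algebra_simps)
    qed
  qed (rule oA)
  then have "b m \<le> b x + \<alpha> * (m - x)" using z by (simp add: algebra_simps)
  also have "\<alpha> * (m - x) = t * (b y - b x)"
  proof -
    have "m - x = t * (y - x)" by (simp add: m_def algebra_simps)
    then show ?thesis using xy by (simp add: \<alpha>_def)
  qed
  finally have "b m \<le> (1 - t) * b x + t * b y" by (simp add: algebra_simps)
  then show "circle_max v (exp ((1 - t) *\<^sub>R x + t *\<^sub>R y)) \<le> (1 - t) * circle_max v (exp x) + t * circle_max v (exp y)"
    by (simp add: b_def m_def)
qed auto

end

text \<open>The difference quotients of a convex function increase, so the right derivative is the infimum
  of those to the right and dominates those to the left.\<close>

lemma convex_right_derivative_subgradient: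
  fixes b :: "real \<Rightarrow> real"
  assumes b: "convex_on I b" and I: "open I" "x \<in> I" and y: "y \<in> I"
  shows "b x + vector_derivative b (at_right x) * (y - x) \<le> b y"
proof -
  define q where "q = (\<lambda>t. (b t - b x) / (t - x))"
  define J where "J = {t\<in>I. x < t}"
  define D where "D = Inf (q ` J)"
  obtain e where e: "e > 0" "ball x e \<subseteq> I" using I by (meson openE)
  have "x + e/2 \<in> J" "x - e/2 \<in> I" using e by (auto simp: J_def dist_real_def subset_iff)
  then have J: "J \<noteq> {}" and xl: "x - e/2 \<in> I" by auto
  have left_right: "q s \<le> q t" if "s \<in> I" "s < x" "t \<in> J" for s t
  proof -
    have "(b s - b x) / (s - x) \<le> (b s - b t) / (s - t)" "(b s - b t) / (s - t) \<le> (b x - b t) / (x - t)"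
      using convex_on_slope_le[OF b, of s t x] that by (auto simp: J_def)
    moreover have "(b x - b t) / (x - t) = q t"
      by (metis q_def minus_diff_eq minus_divide_divide)
    ultimately show ?thesis by (simp add: q_def)
  qed
  have q_mono: "q s \<le> q t" if "s \<in> J" "t \<in> J" "s \<le> t" for s t
  proof (cases "s = t")
    case False
    then have "(b x - b s) / (x - s) \<le> (b x - b t) / (x - t)"
      using convex_on_slope_le(1)[OF b I(2), of t s] that by (auto simp: J_def)
    then show ?thesis unfolding q_def by (metis minus_diff_eq minus_divide_divide)
  qed auto
  have bdd: "bdd_below (q ` J)"
    using left_right[OF xl] e(1) by (intro bdd_belowI[of _ "q (x - e/2)"]) auto
  have D_le: "D \<le> q t" if "t \<in> J" for t
    unfolding D_def by (rule cInf_lower[OF _ bdd]) (use that in auto)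
  have D_ge: "q s \<le> D" if "s \<in> I" "s < x" for s
    unfolding D_def by (rule cInf_greatest) (use J left_right[OF that] in auto)
  have "(q \<longlongrightarrow> D) (at_right x)"
  proof (rule tendstoI)
    fix d :: real assume "d > 0"
    then obtain t where t: "t \<in> J" "q t < D + d"
      using cInf_lessD[of "q ` J" "D + d"] J by (auto simp: D_def)
    have "x < t" using t by (simp add: J_def)
    then have "\<forall>\<^sub>F s in at_right x. s \<in> {x<..<t}" by (rule eventually_at_right_real)
    moreover have "\<forall>\<^sub>F s in at_right x. s \<in> I"
      using eventually_at_in_open'[OF I] by (rule filter_leD[rotated]) (simp add: at_le)
    ultimately show "\<forall>\<^sub>F s in at_right x. dist (q s) D < d"
    proof eventually_elim
      case (elim s)
      then have "s \<in> J" by (auto simp: J_def)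
      then have "D \<le> q s" "q s \<le> q t" using D_le q_mono t elim by auto
      then show ?case using t by (simp add: dist_real_def)
    qed
  qed
  then have "(b has_real_derivative D) (at_right x)"
    unfolding has_field_derivative_iff q_def .
  then have "(b has_vector_derivative D) (at_right x)"
    by (simp add: has_real_derivative_iff_has_vector_derivative)
  then have vd: "vector_derivative b (at_right x) = D"
    by (intro vector_derivative_within) auto
  show ?thesis
  proof (cases y x rule: linorder_cases)
    case less
    then have "q y * (x - y) \<le> D * (x - y)" using D_ge[OF y] by (intro mult_right_mono) auto
    moreover have "q y * (x - y) = b x - b y" using less by (simp add: q_def field_simps)
    ultimately show ?thesis unfolding vd by (simp add: algebra_simps)
  next
    case greater
    then have "D * (y - x) \<le> q y * (y - x)" using D_le[of y] y by (intro mult_right_mono) (auto simp: J_def)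
    moreover have "q y * (y - x) = b y - b x" using greater by (simp add: q_def)
    ultimately show ?thesis unfolding vd by linarith
  qed simp
qed

text \<open>The convexity of \<open>B\<close> enters through this inequality: it yields the monotonicity of \<open>a\<close> as well as
  the upper and lower estimates of \<open>B\<close> near \<open>r\<close>.\<close>

lemma (in disc_tract) circle_max_subgradient:
  assumes "0 < r" "r < 1" "0 < s" "s < 1"
  shows "circle_max v r + log_right_deriv (circle_max v) r * (ln s - ln r) \<le> circle_max v s"
  using convex_right_derivative_subgradient[OF convex_circle_max open_lessThan, of "ln r" "ln s"] assms
  by (simp add: log_right_deriv_def ln_less_zero)

lemma Limsup_log_ratio_imp_unbounded:
  assumes ls: "Limsup (at_left 1) (\<lambda>r. ereal (ln (g r) / ln (1 / (1 - r)))) > ereal c" and c: "c > 0"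
    and r0: "r0 < (1::real)" and pos: "\<And>r. r0 \<le> r \<Longrightarrow> r < 1 \<Longrightarrow> 0 < g r"
  shows "\<exists>r. r0 \<le> r \<and> r < 1 \<and> M \<le> g r"
proof (rule ccontr)
  assume neg: "\<not> (\<exists>r. r0 \<le> r \<and> r < 1 \<and> M \<le> g r)"
  define K where "K = max 1 M"
  have lim: "filterlim (\<lambda>r::real. ln (1 / (1 - r))) at_top (at_left 1)" by real_asymp
  have "\<forall>\<^sub>F r in at_left 1. ln (1 / (1 - r)) > max 1 (ln K / c)"
    using lim unfolding filterlim_at_top_dense by blast
  moreover have "\<forall>\<^sub>F r in at_left 1. r \<in> {r0<..<1}" by (rule eventually_at_left_real[OF r0])
  ultimately have "\<forall>\<^sub>F r in at_left 1. ereal (ln (g r) / ln (1 / (1 - r))) \<le> ereal c"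
  proof eventually_elim
    case (elim r)
    have "g r \<le> K" "0 < g r" using neg pos[of r] elim by (force simp: K_def)+
    then have "ln (g r) \<le> ln K" by (intro ln_mono) auto
    moreover have "ln K / c < ln (1 / (1 - r))" "0 < ln (1 / (1 - r))" using elim by linarith+
    ultimately have "ln (g r) \<le> c * ln (1 / (1 - r))"
      using c by (simp only: pos_divide_less_eq) (simp add: mult.commute)
    then have "ln (g r) / ln (1 / (1 - r)) \<le> c"
      using \<open>0 < ln (1 / (1 - r))\<close> by (simp only: pos_divide_le_eq)
    then show ?case by simp
  qed
  then have "Limsup (at_left 1) (\<lambda>r. ereal (ln (g r) / ln (1 / (1 - r)))) \<le> ereal c"
    by (rule Limsup_bounded)
  then show False using ls by simp
qed

section \<open>Functions that are close to a power\<close>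

lemma norm_exp_minus_one_le:
  fixes z :: complex
  assumes "norm z \<le> 1/2"
  shows "norm (exp z - 1) \<le> 2 * norm z"
  using norm_exp_bounds(2)[OF assms] norm_ge_zero[of z] by linarith

text \<open>The Borel--Caratheodory inequality: the Schwarz lemma for \<open>g / (4 A - g)\<close>, which maps the disc to
  the unit disc because \<open>Re g < 2 A\<close>.\<close>

lemma borel_caratheodory_ball:
  assumes g: "g holomorphic_on ball c t" and g0: "g c = 0" and t: "0 < t" and A: "0 < A"
    and le: "\<And>z. z \<in> ball c t \<Longrightarrow> Re (g z) \<le> A" and z: "norm (z - c) \<le> 3/4 * t"
  shows "norm (g z) \<le> 12 * A"
proof -
  define h where "h = (\<lambda>y. g (c + of_real t * y) / (of_real (4 * A) - g (c + of_real t * y)))"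
  have inb: "c + of_real t * y \<in> ball c t" if "norm y < 1" for y
    using that t by (simp add: dist_norm norm_mult)
  have re: "Re (g (c + of_real t * y)) < 2 * A" if "norm y < 1" for y
    using le[OF inb[OF that]] A by linarith
  have ne: "of_real (4 * A) - g (c + of_real t * y) \<noteq> 0" if "norm y < 1" for y
  proof
    assume "of_real (4 * A) - g (c + of_real t * y) = 0"
    then have "Re (g (c + of_real t * y)) = 4 * A" by (metis Re_complex_of_real eq_iff_diff_eq_0)
    then show False using re[OF that] A by linarith
  qed
  have h_lt: "norm (h y) < 1" if y: "norm y < 1" for y
  proof -
    define w where "w = g (c + of_real t * y)"
    have "(norm w)\<^sup>2 < (norm (of_real (4 * A) - w))\<^sup>2"
    proof -
      have "(norm (of_real (4 * A) - w))\<^sup>2 - (norm w)\<^sup>2 = 8 * A * (2 * A - Re w)"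
      proof -
        have "(norm (of_real (4 * A) - w))\<^sup>2 = (4 * A - Re w)\<^sup>2 + (Im w)\<^sup>2" "(norm w)\<^sup>2 = (Re w)\<^sup>2 + (Im w)\<^sup>2"
          by (simp_all add: cmod_power2)
        then show ?thesis by (simp add: power2_eq_square algebra_simps)
      qed
      moreover have "8 * A * (2 * A - Re w) > 0" using re[OF y] A by (simp add: w_def)
      ultimately show ?thesis by linarith
    qed
    then have "norm w < norm (of_real (4 * A) - w)" by (rule power2_less_imp_less) simp
    then show ?thesis using ne[OF y] by (simp add: h_def w_def norm_divide)
  qed
  have hol: "h holomorphic_on ball 0 1"
  proof -
    have "(\<lambda>y. g (c + of_real t * y)) holomorphic_on ball 0 1"
      by (rule holomorphic_on_compose_gen[OF _ g, unfolded o_def])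
         (use inb in \<open>auto intro!: holomorphic_intros\<close>)
    then show ?thesis unfolding h_def using ne by (intro holomorphic_intros) auto
  qed
  define y where "y = (z - c) / of_real t"
  have y: "norm y \<le> 3/4" "z = c + of_real t * y"
    using z t by (simp_all add: y_def norm_divide pos_divide_le_eq)
  have "norm (h y) \<le> norm y"
    by (rule Schwarz_Lemma(1)[OF hol]) (use h_lt g0 y in \<open>auto simp: h_def\<close>)
  then have hy: "norm (h y) \<le> 3/4" using y by linarith
  have "h y * (of_real (4 * A) - g z) = g z"
    using ne[of y] y by (simp add: h_def)
  then have "g z * (1 + h y) = of_real (4 * A) * h y" by (simp add: algebra_simps)
  then have "norm (g z) * norm (1 + h y) = 4 * A * norm (h y)"
    using A by (metis abs_of_pos mult_pos_pos norm_mult norm_of_real zero_less_numeral)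
  also have "\<dots> \<le> 4 * A * (3/4)" using hy A by (intro mult_left_mono) auto
  finally have 1: "norm (g z) * norm (1 + h y) \<le> 3 * A" by simp
  have "1/4 \<le> norm (1 + h y)" using norm_triangle_ineq2[of 1 "- h y"] hy by simp
  then have "norm (g z) * (1/4) \<le> norm (g z) * norm (1 + h y)" by (intro mult_left_mono) auto
  then show ?thesis using 1 by simp
qed

text \<open>A function without zeros whose logarithmic modulus is nearly nonpositive and vanishes at the
  center has a logarithm that is small by the Borel--Caratheodory inequality; the derivative of the logarithm is
  controlled by Cauchy's estimate.\<close>

theorem near_one_if_log_norm_small:
  assumes F: "F holomorphic_on ball c t" and nz: "\<And>z. z \<in> ball c t \<Longrightarrow> F z \<noteq> 0"
    and Fc: "F c = 1" and t: "0 < t" and \<eta>: "0 < \<eta>" "\<eta> \<le> 1/24"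
    and le: "\<And>z. z \<in> ball c t \<Longrightarrow> ln (norm (F z)) \<le> \<eta>" and z: "norm (z - c) \<le> t / 2"
  shows "norm (F z - 1) \<le> 24 * \<eta>" and "norm (deriv F z / F z) \<le> 52 * \<eta> / t"
proof -
  have ex: "\<exists>g. g holomorphic_on ball c t \<and> (\<forall>z\<in>ball c t. F z = exp (g z))"
  proof (rule contractible_imp_holomorphic_log)
    show "contractible (ball c t)" by (rule convex_imp_contractible) auto
  qed (use F nz in auto)
  then obtain g0 where g0: "g0 holomorphic_on ball c t" "\<And>z. z \<in> ball c t \<Longrightarrow> F z = exp (g0 z)"
    by auto
  define g where "g = (\<lambda>z. g0 z - g0 c)"
  have g: "g holomorphic_on ball c t" unfolding g_def using g0 by (intro holomorphic_intros)
  have Fg: "F z = exp (g z)" if "z \<in> ball c t" for z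
    using g0(2)[OF that] g0(2)[of c] Fc t by (simp add: g_def exp_diff)
  have g_le: "norm (g w) \<le> 12 * \<eta>" if "norm (w - c) \<le> 3/4 * t" for w
  proof (rule borel_caratheodory_ball[OF g _ t \<eta>(1) _ that])
    show "Re (g z) \<le> \<eta>" if "z \<in> ball c t" for z
      using le[OF that] Fg[OF that] by simp
  qed (simp add: g_def)
  have zb: "z \<in> ball c t" using z t by (simp add: dist_norm norm_minus_commute)
  have "norm (g z) \<le> 12 * \<eta>" using g_le[of z] z t by simp
  then show "norm (F z - 1) \<le> 24 * \<eta>"
    using Fg[OF zb] norm_exp_minus_one_le[of "g z"] \<eta> by simp
  have dF: "deriv F z / F z = deriv g z"
  proof -
    have "(g has_field_derivative deriv g z) (at z)"
      by (rule holomorphic_derivI[OF g open_ball zb])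
    then have "((\<lambda>z. exp (g z)) has_field_derivative exp (g z) * deriv g z) (at z)"
      by (auto intro!: derivative_eq_intros)
    then have "(F has_field_derivative exp (g z) * deriv g z) (at z)"
      by (rule has_field_derivative_transform_within_open[OF _ open_ball zb]) (simp add: Fg)
    then show ?thesis using Fg[OF zb] by (simp add: DERIV_imp_deriv)
  qed
  have sub: "cball z (t/4) \<subseteq> cball c (3/4 * t)"
  proof
    fix w assume "w \<in> cball z (t/4)"
    then have "norm (w - z) \<le> t/4" by (simp add: dist_norm norm_minus_commute)
    then have "norm (w - c) \<le> 3/4 * t" using norm_triangle_ineq[of "w - z" "z - c"] z by simp
    then show "w \<in> cball c (3/4 * t)" by (simp add: dist_norm norm_minus_commute)
  qed
  have sub2: "cball z (t/4) \<subseteq> ball c t" using sub t by (force simp: subset_iff)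
  have "norm ((deriv ^^ 1) g z) \<le> fact 1 * (13 * \<eta>) / (t/4) ^ 1"
  proof (rule Cauchy_higher_deriv_bound[where y = 0])
    show "g holomorphic_on ball z (t/4)"
      by (rule holomorphic_on_subset[OF g]) (use sub2 in auto)
    show "continuous_on (cball z (t/4)) g"
      using holomorphic_on_imp_continuous_on[OF g] sub2 by (rule continuous_on_subset)
    show "g w \<in> ball 0 (13 * \<eta>)" if "w \<in> ball z (t/4)" for w
    proof -
      have "w \<in> cball c (3/4 * t)" using sub that ball_subset_cball by blast
      then have "norm (g w) \<le> 12 * \<eta>" by (intro g_le) (simp add: dist_norm norm_minus_commute)
      then show ?thesis using \<eta> by simp
    qed
  qed (use t in auto)
  then show "norm (deriv F z / F z) \<le> 52 * \<eta> / t" using dF by (simp add: field_simps)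
qed

text \<open>Both quotients lie in the right half plane, so their principal logarithms add up without
  a multiple of \<open>2 * pi * \<i>\<close>.\<close>

lemma quot_power_shift:
  assumes a: "a \<ge> 2" and x: "norm x \<le> 1" and w: "w \<noteq> 0" "0 < Re (z / w)"
  shows "quot_power (z + x * z / of_real a) w a = quot_power z w a * exp (of_real a * Ln (1 + x / of_real a))"
proof -
  let ?y = "1 + x / of_real a"
  have "norm (x / of_real a) \<le> 1/2" using a x by (simp add: norm_divide field_simps)
  moreover have "Re ?y = 1 + Re (x / of_real a)" by (simp only: plus_complex.sel one_complex.sel)
  ultimately have ry: "0 < Re ?y" using abs_Re_le_cmod[of "x / of_real a"] by linarith
  have nz: "z / w \<noteq> 0" "?y \<noteq> 0" using w ry by (metis less_irrefl zero_complex.simps(1))+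
  have "(z + x * z / of_real a) / w = (z / w) * ?y" by (simp add: algebra_simps add_divide_distrib)
  moreover have "Ln ((z / w) * ?y) = Ln (z / w) + Ln ?y"
    using Re_Ln_pos_lt_imp[OF w(2)] Re_Ln_pos_lt_imp[OF ry] by (intro Ln_times_simple nz) auto
  ultimately show ?thesis by (simp add: quot_power_def algebra_simps exp_add)
qed

lemma norm_scaled_Ln_minus_le:
  assumes a: "a \<ge> 2" and x: "norm x \<le> 1"
  shows "norm (of_real a * Ln (1 + x / of_real a) - x) \<le> 2 / a"
proof -
  have n: "norm (x / of_real a) \<le> 1 / a" using a x by (simp add: norm_divide divide_right_mono)
  then have h: "norm (x / of_real a) \<le> 1/2" using a by (smt (verit) frac_le)
  have "norm (Ln (1 + x / of_real a) - x / of_real a) \<le> norm (x / of_real a)^2 / (1 - norm (x / of_real a))"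
    by (rule Ln_approx_linear) (use h in linarith)
  also have "\<dots> \<le> (1/a)^2 / (1/2)" using n h a by (intro frac_le power_mono) auto
  finally have "a * norm (Ln (1 + x / of_real a) - x / of_real a) \<le> a * ((1/a)^2 / (1/2))"
    using a by (intro mult_left_mono) auto
  also have "\<dots> = 2 / a" using a by (simp add: power2_eq_square)
  also have "a * norm (Ln (1 + x / of_real a) - x / of_real a) =
      norm (of_real a * (Ln (1 + x / of_real a) - x / of_real a))" using a by (simp add: norm_mult)
  also have "of_real a * (Ln (1 + x / of_real a) - x / of_real a) = of_real a * Ln (1 + x / of_real a) - x"
    using a by (simp add: algebra_simps)
  finally show ?thesis .
qed

text \<open>All derivatives are treated at once by rescaling. If \<open>f\<close> is close to a multiple of \<open>(z / w) ^ a\<close>,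
  then \<open>x \<mapsto> f (z + x * z / a) / f z\<close> is close to \<open>(1 + x / a) ^ a\<close> and hence to \<open>exp x\<close> in the unit disc,
  and the derivatives of the exponential function at the origin are all \<open>1\<close>. The rescaled disc has radius
  \<open>|z| / a\<close>, which is why \<open>a * t\<close> has to be bounded from below.\<close>

theorem higher_log_deriv_estimate:
  fixes f F :: "complex \<Rightarrow> complex"
  assumes f: "f holomorphic_on ball w t" and nz: "\<And>z. z \<in> ball w t \<Longrightarrow> f z \<noteq> 0"
    and F: "\<And>z. z \<in> ball w t \<Longrightarrow> f z = f w * quot_power z w a * F z"
    and close: "\<And>z. z \<in> ball w (t/2) \<Longrightarrow> norm (F z - 1) \<le> \<kappa>" and \<kappa>: "0 \<le> \<kappa>" "\<kappa> \<le> 1/4"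
    and a: "4 \<le> a" and w: "0 < norm w" "norm w \<le> 1" and t: "0 < t" "t \<le> norm w"
    and big: "8 \<le> a * t" and z: "norm (z - w) < t / 4" and q: "0 < q"
  shows "norm (((deriv ^^ q) f z / f z) / (of_real a ^ q / z ^ q) - 1) \<le> fact q * (24 * \<kappa> + 48 / a)"
proof -
  have tw: "t / 4 + norm z / a \<le> t / 2" and zn: "norm z \<le> 2" "z \<noteq> 0" and rz: "0 < Re (z / w)"
  proof -
    have "norm z \<le> norm w + t / 4" using z norm_triangle_ineq[of "z - w" w] by simp
    then show z2: "norm z \<le> 2" using t w by linarith
    have "norm z / a \<le> 2 / a" using z2 a by (intro divide_right_mono) auto
    also have "\<dots> \<le> t / 4" using big a by (simp add: field_simps)
    finally show "t / 4 + norm z / a \<le> t / 2" by linarith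
    have "norm (z / w - 1) = norm (z - w) / norm w" using w by (simp add: diff_divide_distrib flip: norm_divide)
    also have "\<dots> < 1" using z t w by (simp add: divide_less_eq)
    finally have "\<bar>Re (z / w - 1)\<bar> < 1" using abs_Re_le_cmod le_less_trans by blast
    then show "0 < Re (z / w)" by simp
    then show "z \<noteq> 0" by auto
  qed
  have inb: "z + x * z / of_real a \<in> ball w (t/2)" if "norm x \<le> 1" for x
  proof -
    have "norm (x * z / of_real a) \<le> norm z / a"
      using that a by (simp add: norm_divide norm_mult divide_right_mono mult_left_le_one_le)
    then show ?thesis
      using norm_triangle_ineq[of "z - w" "x * z / of_real a"] z tw
      by (simp add: dist_norm norm_minus_commute algebra_simps)
  qed
  have inb': "ball w (t/2) \<subseteq> ball w t" using t by auto
  have zb: "z \<in> ball w t" "z \<in> ball w (t/2)" using z t by (auto simp: dist_norm norm_minus_commute)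
  define \<phi> where "\<phi> = (\<lambda>x. f (z / of_real a * x + z) / f z)"
  have a0: "a > 0" using a by simp
  have arg: "z / of_real a * x + z = z + x * z / of_real a" for x by (simp add: field_simps)
  have \<phi>_eq: "\<phi> x = F (z + x * z / of_real a) / F z * exp (of_real a * Ln (1 + x / of_real a))"
    if "norm x \<le> 1" for x
  proof -
    have "f (z + x * z / of_real a) = f w * (quot_power z w a * exp (of_real a * Ln (1 + x / of_real a))) *
        F (z + x * z / of_real a)"
      using F[of "z + x * z / of_real a"] inb[OF that] inb' quot_power_shift[of a x w z] a w rz that by auto
    moreover have "f z = f w * quot_power z w a * F z" by (rule F[OF zb(1)])
    moreover have "f z \<noteq> 0" by (rule nz[OF zb(1)])
    moreover have "\<phi> x = f (z + x * z / of_real a) / f z" by (simp only: \<phi>_def arg)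
    ultimately show ?thesis by simp
  qed
  have \<phi>_close: "norm (\<phi> x - exp x) \<le> 24 * \<kappa> + 24 / a" if x: "norm x \<le> 1" for x
  proof -
    define p where "p = F (z + x * z / of_real a) / F z"
    define e where "e = exp (of_real a * Ln (1 + x / of_real a) - x)"
    have Fz: "norm (F z - 1) \<le> \<kappa>" "norm (F (z + x * z / of_real a) - 1) \<le> \<kappa>"
      using close inb[OF x] zb by auto
    have Fz1: "norm (F z) \<ge> 3/4" using norm_triangle_ineq2[of 1 "1 - F z"] Fz(1) \<kappa> by (simp add: norm_minus_commute)
    then have Fz0: "F z \<noteq> 0" by auto
    have "p - 1 = (F (z + x * z / of_real a) - 1 - (F z - 1)) / F z"
      using Fz0 by (simp add: p_def diff_divide_distrib)
    then have "norm (p - 1) = norm (F (z + x * z / of_real a) - 1 - (F z - 1)) / norm (F z)"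
      by (simp add: norm_divide)
    also have "\<dots> \<le> (2 * \<kappa>) / (3/4)"
      using Fz Fz1 \<kappa> norm_triangle_ineq4[of "F (z + x * z / of_real a) - 1" "F z - 1"] by (intro frac_le) auto
    finally have p1: "norm (p - 1) \<le> 8/3 * \<kappa>" by simp
    have "norm (of_real a * Ln (1 + x / of_real a) - x) \<le> 2 / a"
      by (rule norm_scaled_Ln_minus_le) (use a x in auto)
    moreover have "2 / a \<le> 1/2" using a by (simp add: field_simps)
    ultimately have e1: "norm (e - 1) \<le> 4 / a"
      using norm_exp_minus_one_le[of "of_real a * Ln (1 + x / of_real a) - x"] by (simp add: e_def)
    have e2: "norm e \<le> 2" using e1 norm_triangle_ineq2[of e 1] a by (smt (verit) divide_le_eq_1 norm_one)
    have "p * e - 1 = (p - 1) * e + (e - 1)" by (simp add: algebra_simps)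
    then have "norm (p * e - 1) \<le> norm (p - 1) * norm e + norm (e - 1)"
      by (metis norm_mult norm_triangle_ineq)
    also have "\<dots> \<le> 8/3 * \<kappa> * 2 + 4 / a" using p1 e1 e2 \<kappa> by (intro add_mono mult_mono) auto
    finally have pe: "norm (p * e - 1) \<le> 8 * \<kappa> + 4 / a" using \<kappa> by simp
    have "\<phi> x = exp x * (p * e)" using \<phi>_eq[OF x] by (simp add: p_def e_def exp_diff)
    then have "norm (\<phi> x - exp x) = norm (exp x) * norm (p * e - 1)"
      by (metis mult.right_neutral norm_mult right_diff_distrib)
    also have "norm (exp x) \<le> 3"
    proof -
      have "norm (exp x) \<le> exp 1" using x abs_Re_le_cmod[of x] by simp
      then show ?thesis using exp_le by linarith
    qed
    then have "norm (exp x) * norm (p * e - 1) \<le> 3 * (8 * \<kappa> + 4 / a)" using pe by (intro mult_mono) auto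
    finally show ?thesis using a0 by (simp add: field_simps)
  qed
  have hol: "\<phi> holomorphic_on S" if "S \<subseteq> cball 0 1" for S
  proof -
    have "(\<lambda>x. f (z / of_real a * x + z)) holomorphic_on S"
    proof (rule holomorphic_on_compose_gen[OF _ f, unfolded o_def])
      show "(\<lambda>x. z / of_real a * x + z) ` S \<subseteq> ball w t"
      proof
        fix y assume "y \<in> (\<lambda>x. z / of_real a * x + z) ` S"
        then obtain x where x: "x \<in> S" "y = z / of_real a * x + z" by blast
        then have "norm x \<le> 1" using that by auto
        then show "y \<in> ball w t" using inb inb' unfolding x(2) arg by blast
      qed
    qed (intro holomorphic_intros)
    then show ?thesis unfolding \<phi>_def using nz[OF zb(1)] by (intro holomorphic_intros) auto
  qed
  have "norm ((deriv ^^ q) (\<lambda>x. \<phi> x - exp x) 0) \<le> fact q * (24 * \<kappa> + 48 / a) / 1 ^ q"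
  proof (rule Cauchy_higher_deriv_bound[where y = 0])
    have "\<phi> holomorphic_on cball 0 1" by (rule hol) auto
    then have h: "(\<lambda>x. \<phi> x - exp x) holomorphic_on cball 0 1" by (intro holomorphic_intros)
    then show "continuous_on (cball 0 1) (\<lambda>x. \<phi> x - exp x)" by (rule holomorphic_on_imp_continuous_on)
    show "(\<lambda>x. \<phi> x - exp x) holomorphic_on ball 0 1" by (rule holomorphic_on_subset[OF h]) auto
    show "\<phi> x - exp x \<in> ball 0 (24 * \<kappa> + 48 / a)" if "x \<in> ball 0 1" for x
    proof -
      have "norm (\<phi> x - exp x) \<le> 24 * \<kappa> + 24 / a" using that by (intro \<phi>_close) auto
      also have "\<dots> < 24 * \<kappa> + 48 / a" using a0 by (simp add: divide_strict_right_mono)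
      finally show ?thesis by simp
    qed
  qed (use q in auto)
  moreover have "(deriv ^^ q) (\<lambda>x. \<phi> x - exp x) 0 = (deriv ^^ q) \<phi> 0 - (deriv ^^ q) exp 0"
    by (rule higher_deriv_diff[of _ "ball 0 1"]) (auto intro: hol holomorphic_intros)
  moreover have "(deriv ^^ n) exp = (exp :: complex \<Rightarrow> complex)" for n
    by (induction n) (auto intro!: ext DERIV_imp_deriv DERIV_exp)
  then have "(deriv ^^ q) exp 0 = (1::complex)" by simp
  moreover have "(deriv ^^ q) \<phi> 0 = ((deriv ^^ q) f z / f z) / (of_real a ^ q / z ^ q)"
  proof -
    have hf: "(\<lambda>y. f y / f z) holomorphic_on ball w t" using f nz[OF zb(1)] by (intro holomorphic_intros) auto
    have "(deriv ^^ q) \<phi> 0 = (z / of_real a) ^ q * (deriv ^^ q) (\<lambda>y. f y / f z) (z / of_real a * 0 + z)"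
      unfolding \<phi>_def
    proof (rule higher_deriv_compose_linear'[OF hf, of "ball 0 1"])
      show "z / of_real a * x + z \<in> ball w t" if "x \<in> ball 0 1" for x
        using inb[of x] inb' that unfolding arg by auto
    qed auto
    also have "\<dots> = (z / of_real a) ^ q * (deriv ^^ q) (\<lambda>y. (1 / f z) * f y) z" by simp
    also have "(deriv ^^ q) (\<lambda>y. (1 / f z) * f y) z = (1 / f z) * (deriv ^^ q) f z"
      by (rule higher_deriv_cmult[OF f zb(1) open_ball])
    finally show ?thesis using zn a0 by (simp add: field_simps power_divide)
  qed
  ultimately show ?thesis by simp
qed

section \<open>Behaviour near a maximum point\<close>

lemma Re_quotient_pos:
  fixes z w :: complex
  assumes "norm (z - w) < norm w"
  shows "0 < Re (z / w)" "z \<noteq> 0" "w \<noteq> 0"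
proof -
  show w: "w \<noteq> 0" using assms norm_ge_zero[of "z - w"] by auto
  have "norm (z / w - 1) = norm (z - w) / norm w" using w by (simp add: diff_divide_distrib flip: norm_divide)
  also have "\<dots> < 1" using assms w by (simp add: divide_less_eq)
  finally have "\<bar>Re (z / w - 1)\<bar> < 1" using abs_Re_le_cmod le_less_trans by blast
  then show "0 < Re (z / w)" by simp
  then show "z \<noteq> 0" by auto
qed

lemma norm_quot_power:
  assumes "z \<noteq> 0" "w \<noteq> 0"
  shows "norm (quot_power z w s) = exp (s * ln (norm z / norm w))"
  using assms by (simp add: quot_power_def norm_divide)

lemma quot_power_nonzero [simp]: "quot_power z w s \<noteq> 0"
  by (simp add: quot_power_def)

lemma quot_power_self [simp]: "w \<noteq> 0 \<Longrightarrow> quot_power w w s = 1"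
  by (simp add: quot_power_def)

lemma DERIV_quot_power:
  assumes "norm (z - w) < norm w"
  shows "((\<lambda>z. quot_power z w s) has_field_derivative quot_power z w s * (of_real s / z)) (at z)"
proof -
  have "z / w \<notin> \<real>\<^sub>\<le>\<^sub>0" using Re_quotient_pos(1)[OF assms] by (auto simp: complex_nonpos_Reals_iff)
  then show ?thesis
    unfolding quot_power_def using Re_quotient_pos[OF assms]
    by (auto intro!: derivative_eq_intros simp: field_simps)
qed

lemma holomorphic_quot_power: "(\<lambda>z. quot_power z w s) holomorphic_on ball w (norm w)"
  unfolding holomorphic_on_open[OF open_ball]
  by (auto simp: dist_norm norm_minus_commute intro!: exI DERIV_quot_power)

context disc_tract
begin

abbreviation B where "B \<equiv> circle_max v"
abbreviation a where "a \<equiv> log_right_deriv (circle_max v)"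

text \<open>The subgradient inequality at \<open>|z|\<close> bounds \<open>B |z|\<close> by \<open>B r + a |z| * ln (|z| / r)\<close>, and replacing
  \<open>a |z|\<close> by \<open>a r\<close> costs the variation of \<open>a\<close> times the variation of the logarithm.\<close>

lemma growth_near_maximum_point:
  assumes r: "1/2 \<le> r" "r < 1" and zr: "norm zr = r" and \<rho>: "0 < \<rho>" "2 * \<rho> \<le> 1 - r"
    and V: "\<And>x. \<bar>x - r\<bar> < 2 * \<rho> \<Longrightarrow> \<bar>a x - a r\<bar> \<le> V" and z: "norm (z - zr) \<le> \<rho>"
  shows "v z \<le> B r + a r * ln (norm z / r) + 4 * V * \<rho>"
proof -
  define x where "x = norm z"
  have "\<bar>x - r\<bar> \<le> \<rho>" unfolding x_def using norm_triangle_ineq3[of z zr] z zr by linarith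
  then have xr: "\<bar>x - r\<bar> < 2 * \<rho>" "1/4 \<le> x" "x < 1" "\<bar>x - r\<bar> \<le> \<rho>" using \<rho> r by linarith+
  have Vx: "\<bar>a x - a r\<bar> \<le> V" by (rule V[OF xr(1)])
  have "ln x - ln r \<le> (x - r) / r" "ln r - ln x \<le> (r - x) / x"
    using ln_diff_le[of x r] ln_diff_le[of r x] xr r by auto
  moreover have "(x - r) / r \<le> \<rho> / (1/4)" "(r - x) / x \<le> \<rho> / (1/4)"
    using xr r \<rho> by (intro frac_le; linarith)+
  ultimately have l: "\<bar>ln x - ln r\<bar> \<le> 4 * \<rho>" by auto
  have "v z \<le> B x" by (rule circle_max_attained(2)) (use xr in \<open>auto simp: x_def\<close>)
  also have "\<dots> \<le> B r + a x * (ln x - ln r)"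
    using circle_max_subgradient[of x r] xr r by (simp add: algebra_simps)
  also have "\<dots> = B r + a r * (ln x - ln r) + (a x - a r) * (ln x - ln r)" by (simp add: algebra_simps)
  also have "(a x - a r) * (ln x - ln r) \<le> \<bar>a x - a r\<bar> * \<bar>ln x - ln r\<bar>"
    by (metis abs_ge_self abs_mult)
  also have "\<dots> \<le> V * (4 * \<rho>)" using Vx l by (intro mult_mono) auto
  finally have "v z \<le> B r + a r * (ln x - ln r) + V * (4 * \<rho>)" by simp
  moreover have "ln (x / r) = ln x - ln r" using xr r by (intro ln_divide_pos) auto
  ultimately show ?thesis by (simp add: x_def mult_ac)
qed

text \<open>The harmonic function \<open>u = B r + a r * ln (|z| / r)\<close> nearly majorizes \<open>v\<close> in the disc of radius \<open>\<rho>\<close> and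
  touches it at \<open>zr\<close>. It also stays large there, however slowly \<open>B\<close> grows: by convexity, \<open>B \<ge> 0\<close> at a
  point \<open>x\<close> twice as far from \<open>r\<close> as \<open>r - \<rho>\<close> on the logarithmic scale shows that \<open>u\<close> drops at most by about half of
  \<open>B r\<close>. So the disc, rescaled to the unit disc, has no holes near its center.\<close>

theorem disc_around_maximum_point_in_tract:
  assumes r: "1/2 \<le> r" "r < 1" and zr: "norm zr = r" "v zr = B r" and B: "6 \<le> B r" and a: "0 \<le> a r"
    and \<rho>: "0 < \<rho>" "2 * \<rho> \<le> 1 - r" and small: "4 * V * \<rho> \<le> 1/100"
    and V: "\<And>x. \<bar>x - r\<bar> < 2 * \<rho> \<Longrightarrow> \<bar>a x - a r\<bar> \<le> V"
  shows "ball zr (\<rho> / 8) \<subseteq> U"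
proof -
  have \<rho>r: "\<rho> \<le> 1/4" "\<rho> < r" using \<rho> r by linarith+
  have V0: "0 \<le> V" using V[of r] \<rho> by simp
  define l where "l = ln r - ln (r - \<rho>)"
  have l4: "l \<le> 4 * \<rho>"
  proof -
    have "l \<le> (r - (r - \<rho>)) / (r - \<rho>)" unfolding l_def using \<rho>r r by (intro ln_diff_le) auto
    also have "\<dots> \<le> \<rho> / (1/4)" using \<rho>r r \<rho> by (intro frac_le) auto
    finally show ?thesis by simp
  qed
  have l0: "0 \<le> l" unfolding l_def using \<rho>r r \<rho> by simp
  \<comment> \<open>The radius \<open>x\<close> is chosen so that \<open>ln (r / x)\<close> is twice \<open>ln (r / (r - \<rho>))\<close>; it still exceeds
    \<open>r - 2 * \<rho>\<close>, so that the bound on the variation of \<open>a\<close> applies to it.\<close>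
  define x where "x = (r - \<rho>)\<^sup>2 / r"
  have "x = r - 2 * \<rho> + \<rho>\<^sup>2 / r" using r by (simp add: x_def power2_eq_square field_simps)
  moreover have "0 < \<rho>\<^sup>2 / r" "\<rho>\<^sup>2 / r < \<rho>" using \<rho> \<rho>r r by (auto simp: power2_eq_square divide_less_eq)
  ultimately have x: "r - 2 * \<rho> < x" "x < r" using \<rho> by linarith+
  have x0: "0 < x" using \<rho>r r by (simp add: x_def)
  have lnx: "ln r - ln x = 2 * l"
    using \<rho>r r by (simp add: x_def l_def ln_div ln_realpow)
  have "0 \<le> B x" by (rule circle_max_nonneg) (use x x0 r in auto)
  then have "a x * (2 * l) \<le> B r"
    using circle_max_subgradient[of x r] x x0 r lnx by simp
  moreover have "(a r - V) * (2 * l) \<le> a x * (2 * l)"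
    using V[of x] x \<rho> l0 by (intro mult_right_mono) auto
  ultimately have "2 * (a r * l) \<le> B r + 2 * (V * l)" by (simp add: algebra_simps)
  moreover have "V * l \<le> V * (4 * \<rho>)" using l4 V0 by (intro mult_left_mono) auto
  ultimately have al: "a r * l \<le> B r / 2 + 1/100" using small by simp
  define Z where "Z = (\<lambda>\<zeta>. zr + of_real \<rho> * \<zeta>)"
  define u where "u = (\<lambda>\<zeta>. B r + a r * ln (norm (Z \<zeta>) / r))"
  define F where "F = (\<lambda>\<zeta>. f (Z \<zeta>) / (of_real (R * exp (B r)) * quot_power (Z \<zeta>) zr (a r)))"
  define U' where "U' = {\<zeta>. Z \<zeta> \<in> U}"
  have zr0: "zr \<noteq> 0" using zr r by auto
  have Zd: "norm (Z \<zeta> - zr) = \<rho> * norm \<zeta>" for \<zeta> using \<rho> by (simp add: Z_def norm_mult)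
  have Zle: "norm (Z \<zeta> - zr) \<le> \<rho>" if "norm \<zeta> \<le> 1" for \<zeta>
    unfolding Zd using that \<rho> by (simp add: mult_left_le)
  have Zn: "r - \<rho> \<le> norm (Z \<zeta>)" "norm (Z \<zeta>) < 1" "norm (Z \<zeta> - zr) < norm zr" "Z \<zeta> \<noteq> 0"
    if "norm \<zeta> \<le> 1" for \<zeta>
  proof -
    show "r - \<rho> \<le> norm (Z \<zeta>)" "norm (Z \<zeta>) < 1" "norm (Z \<zeta> - zr) < norm zr"
      using Zle[OF that] norm_triangle_ineq3[of "Z \<zeta>" zr] zr \<rho> \<rho>r r by linarith+
    then show "Z \<zeta> \<noteq> 0" using \<rho>r by auto
  qed
  have Z_an: "Z analytic_on S" for S unfolding Z_def by (intro analytic_intros)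
  have v_harm: "harmonic_at (\<lambda>\<zeta>. v (Z \<zeta>)) \<zeta>" if "Z \<zeta> \<in> U" for \<zeta>
  proof (rule harmonic_at_cong)
    have an: "(\<lambda>\<zeta>. f (Z \<zeta>)) analytic_on {\<zeta>}"
      using analytic_on_compose[OF Z_an[of "{\<zeta>}"], of f] U_props(5)[OF that] by (simp add: o_def)
    show "harmonic_at (\<lambda>\<zeta>. ln (norm (f (Z \<zeta>) / of_real R))) \<zeta>"
      using U_props[OF that] R_pos an by (intro harmonic_at_ln_norm analytic_intros) auto
    have "(Z \<longlongrightarrow> Z \<zeta>) (nhds \<zeta>)"
      using analytic_at_imp_isCont[OF Z_an] by (simp add: isCont_def tendsto_nhds_iff)
    then have "\<forall>\<^sub>F \<xi> in nhds \<zeta>. Z \<xi> \<in> U" by (rule topological_tendstoD[OF _ open_U that])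
    then show "\<forall>\<^sub>F \<xi> in nhds \<zeta>. ln (norm (f (Z \<xi>) / of_real R)) = v (Z \<xi>)"
      by eventually_elim (simp add: tract_fun_def)
  qed
  have v_cont: "continuous_on (cball 0 1) (\<lambda>\<zeta>. v (Z \<zeta>))"
  proof (rule continuous_on_compose2[OF continuous_on_v])
    show "continuous_on (cball 0 1) Z" unfolding Z_def by (intro continuous_intros)
  qed (use Zn in auto)
  have "ball 0 (1/8) \<subseteq> U'"
  proof (rule no_holes_near_center[where v = "\<lambda>\<zeta>. v (Z \<zeta>)" and u = u and F = F])
    show "continuous_on (cball 0 1) (\<lambda>\<zeta>. v (Z \<zeta>))" by (rule v_cont)
    show "subharmonic_on (\<lambda>\<zeta>. v (Z \<zeta>)) (ball 0 1)"
    proof (rule subharmonic_on_nonneg)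
      show "continuous_on (ball 0 1) (\<lambda>\<zeta>. v (Z \<zeta>))" by (rule continuous_on_subset[OF v_cont]) auto
      show "harmonic_at (\<lambda>\<zeta>. v (Z \<zeta>)) \<zeta>" if "v (Z \<zeta>) \<noteq> 0" for \<zeta>
        using v_harm v_out that by blast
    qed (use v_nonneg in auto)
    show "harmonic_at u \<zeta>" if "norm \<zeta> \<le> 1" for \<zeta>
    proof -
      have "harmonic_at (\<lambda>\<zeta>. ln (norm (Z \<zeta> / of_real r))) \<zeta>"
        using Zn(4)[OF that] r Z_an by (intro harmonic_at_ln_norm analytic_intros) auto
      moreover have "norm (Z \<zeta> / of_real r) = norm (Z \<zeta>) / r" for \<zeta> using r by (simp add: norm_divide)
      ultimately show ?thesis unfolding u_def by (auto intro!: harmonic_at_add harmonic_at_cmult)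
    qed
    show "2 \<le> u \<zeta>" if "norm \<zeta> \<le> 1" for \<zeta>
    proof -
      have "ln ((r - \<rho>) / r) \<le> ln (norm (Z \<zeta>) / r)"
        using Zn[OF that] \<rho>r r by (intro ln_mono divide_right_mono) auto
      then have "- l \<le> ln (norm (Z \<zeta>) / r)" using \<rho>r r by (simp add: l_def ln_div)
      then have "a r * (- l) \<le> a r * ln (norm (Z \<zeta>) / r)" using a by (intro mult_left_mono) auto
      then show ?thesis using al B unfolding u_def by simp
    qed
    show "v (Z \<zeta>) \<le> u \<zeta> + 1/100" if "norm \<zeta> \<le> 1" for \<zeta>
      using growth_near_maximum_point[OF r zr(1) \<rho> V Zle[OF that]] small unfolding u_def by simp
    show "v (Z 0) = u 0" using zr r by (simp add: u_def Z_def)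
    show "v (Z \<zeta>) = 0" if "\<zeta> \<notin> U'" for \<zeta> using that v_out by (simp add: U'_def)
    have "(\<lambda>\<zeta>. f (Z \<zeta>)) holomorphic_on U' \<inter> ball 0 1"
      by (rule holomorphic_on_compose_gen[OF _ analytic_imp_holomorphic[OF analytic_on_U], unfolded o_def])
         (auto simp: U'_def intro: analytic_imp_holomorphic Z_an)
    moreover have "(\<lambda>\<zeta>. quot_power (Z \<zeta>) zr (a r)) holomorphic_on U' \<inter> ball 0 1"
    proof (rule holomorphic_on_compose_gen[OF _ holomorphic_quot_power, unfolded o_def])
      show "Z holomorphic_on U' \<inter> ball 0 1" by (rule analytic_imp_holomorphic[OF Z_an])
      show "Z ` (U' \<inter> ball 0 1) \<subseteq> ball zr (norm zr)"
        using Zn(3) by (auto simp: dist_norm norm_minus_commute)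
    qed
    ultimately show "F holomorphic_on U' \<inter> ball 0 1"
      unfolding F_def using R_pos by (intro holomorphic_intros) auto
    show "F \<zeta> \<noteq> 0" if "\<zeta> \<in> U' \<inter> ball 0 1" for \<zeta>
      using that U_props(4)[of "Z \<zeta>"] R_pos by (simp add: F_def U'_def)
    show "v (Z \<zeta>) - u \<zeta> = ln (norm (F \<zeta>))" if "\<zeta> \<in> U' \<inter> ball 0 1" for \<zeta>
    proof -
      have ZU: "Z \<zeta> \<in> U" and n1: "norm \<zeta> \<le> 1" using that by (auto simp: U'_def)
      have fz: "0 < norm (f (Z \<zeta>))" using U_props(4)[OF ZU] by simp
      have "norm (F \<zeta>) = (norm (f (Z \<zeta>)) / R) / exp (u \<zeta>)"
        using norm_quot_power[OF Zn(4)[OF n1] zr0] R_pos zr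
        by (simp add: F_def u_def norm_divide norm_mult exp_add)
      then have "ln (norm (F \<zeta>)) = ln (norm (f (Z \<zeta>)) / R) - ln (exp (u \<zeta>))"
        using fz R_pos by (simp only:) (rule ln_divide_pos; simp)
      then show ?thesis using v_in[OF ZU] by simp
    qed
  qed (rule v_nonneg)
  then have sub: "Z \<zeta> \<in> U" if "norm \<zeta> < 1/8" for \<zeta> using that by (auto simp: U'_def)
  show ?thesis
  proof
    fix z assume "z \<in> ball zr (\<rho> / 8)"
    then have "norm (z - zr) < \<rho> / 8" by (simp add: dist_norm norm_minus_commute)
    then have "norm ((z - zr) / of_real \<rho>) < 1/8" using \<rho> by (simp add: norm_divide divide_less_eq)
    from sub[OF this] show "z \<in> U" using \<rho> by (simp add: Z_def)
  qed
qed

text \<open>The disc about \<open>zr\<close> now lies in the tract, so the quotient \<open>F\<close> of \<open>f\<close> and the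
  power is holomorphic and free of zeros, its logarithmic modulus is \<open>v - u\<close>, which is nearly nonpositive, and
  it equals \<open>1\<close> at \<open>zr\<close>.\<close>

theorem asymptotics_near_maximum_point:
  assumes r: "1/2 \<le> r" "r < 1" and zr: "norm zr = r" "v zr = B r" and B: "6 \<le> B r" and a: "4 \<le> a r"
    and \<rho>: "0 < \<rho>" "2 * \<rho> \<le> 1 - r" and small: "4 * V * \<rho> \<le> 1/400" and V0: "0 < V"
    and V: "\<And>x. \<bar>x - r\<bar> < 2 * \<rho> \<Longrightarrow> \<bar>a x - a r\<bar> \<le> V"
    and z: "norm (z - zr) < \<rho> / 32"
  shows "norm (f z / (f zr * quot_power z zr (a r)) - 1) \<le> 96 * V * \<rho>"
    and "norm ((deriv f z / f z) / (of_real (a r) / z) - 1) \<le> 1664 * V / a r"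
    and "0 < q \<Longrightarrow> 64 \<le> a r * \<rho> \<Longrightarrow>
      norm (((deriv ^^ q) f z / f z) / (of_real (a r) ^ q / z ^ q) - 1) \<le> fact q * (24 * (96 * V * \<rho>) + 48 / a r)"
proof -
  have sub: "ball zr (\<rho> / 8) \<subseteq> U"
    by (rule disc_around_maximum_point_in_tract[OF r zr B _ \<rho> _ V]) (use a small in auto)
  define t where "t = \<rho> / 8"
  define \<eta> where "\<eta> = 4 * V * \<rho>"
  define F where "F = (\<lambda>z. f z / (f zr * quot_power z zr (a r)))"
  have t: "0 < t" "t \<le> norm zr" "t \<le> \<rho>" using \<rho> r zr by (auto simp: t_def)
  have \<eta>: "0 < \<eta>" "\<eta> \<le> 1/400" using V0 \<rho> small by (auto simp: \<eta>_def)
  have zr0: "zr \<noteq> 0" using zr r by auto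
  have zrU: "zr \<in> U" using sub \<rho> by auto
  have f0: "f w \<noteq> 0" if "w \<in> ball zr t" for w using U_props(4)[of w] sub that by (auto simp: t_def)
  have fzr: "f zr \<noteq> 0" by (rule U_props(4)[OF zrU])
  have f_hol: "f holomorphic_on ball zr t"
    using analytic_on_U sub by (auto simp: t_def intro: analytic_imp_holomorphic analytic_on_subset)
  have sub_zr: "ball zr t \<subseteq> ball zr (norm zr)" using t by auto
  have F_hol: "F holomorphic_on ball zr t"
    unfolding F_def using fzr
    by (intro holomorphic_intros f_hol holomorphic_on_subset[OF holomorphic_quot_power sub_zr]) auto
  have near: "norm (w - zr) < norm zr" "w \<noteq> 0" "norm (w - zr) \<le> \<rho>" if "w \<in> ball zr t" for w
    using that t Re_quotient_pos(2)[of w zr] by (auto simp: dist_norm norm_minus_commute)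
  have F_le: "ln (norm (F w)) \<le> \<eta>" if w: "w \<in> ball zr t" for w
  proof -
    have wU: "w \<in> U" using sub w by (auto simp: t_def)
    have "ln (norm (F w)) = ln (norm (f w)) - ln (norm (f zr)) - a r * ln (norm w / r)"
      using f0[OF w] fzr norm_quot_power[OF near(2)[OF w] zr0, of "a r"] zr
      by (simp add: F_def norm_divide norm_mult ln_div ln_mult)
    also have "ln (norm (f w)) - ln (norm (f zr)) = v w - v zr"
      using v_in[OF wU] v_in[OF zrU] f0[OF w] fzr R_pos by (simp add: ln_div)
    finally show ?thesis
      using growth_near_maximum_point[OF r zr(1) \<rho> V near(3)[OF w]] zr(2) by (simp add: \<eta>_def)
  qed
  have F1: "norm (F w - 1) \<le> 24 * \<eta>" "norm (deriv F w / F w) \<le> 52 * \<eta> / t"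
    if "norm (w - zr) \<le> t / 2" for w
    using near_one_if_log_norm_small[OF F_hol _ _ t(1) \<eta>(1) _ F_le that] f0 fzr zr0 \<eta> by (simp_all add: F_def)
  have zt: "norm (z - zr) \<le> t / 2" "z \<in> ball zr t" "norm (z - zr) < t / 4"
    using z \<rho> by (auto simp: t_def dist_norm norm_minus_commute)
  show "norm (f z / (f zr * quot_power z zr (a r)) - 1) \<le> 96 * V * \<rho>"
    using F1(1)[OF zt(1)] by (simp add: F_def \<eta>_def)
  have fF: "f w = f zr * quot_power w zr (a r) * F w" for w using fzr by (simp add: F_def)
  have z0: "z \<noteq> 0" and Fz: "F z \<noteq> 0" using near[OF zt(2)] f0[OF zt(2)] fzr by (auto simp: F_def)
  show "norm ((deriv f z / f z) / (of_real (a r) / z) - 1) \<le> 1664 * V / a r"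
  proof -
    have dF: "(F has_field_derivative deriv F z) (at z)" by (rule holomorphic_derivI[OF F_hol open_ball zt(2)])
    have "((\<lambda>w. f zr * quot_power w zr (a r) * F w) has_field_derivative
        (f zr * quot_power z zr (a r) * F z) * (of_real (a r) / z + deriv F z / F z)) (at z)"
      using Fz by (auto intro!: derivative_eq_intros DERIV_quot_power near(1)[OF zt(2)] dF simp: field_simps)
    then have "(f has_field_derivative f z * (of_real (a r) / z + deriv F z / F z)) (at z)"
      by (simp flip: fF)
    then have "deriv f z / f z = of_real (a r) / z + deriv F z / F z"
      using f0[OF zt(2)] by (simp add: DERIV_imp_deriv)
    then have "(deriv f z / f z) / (of_real (a r) / z) - 1 = z / of_real (a r) * (deriv F z / F z)"
      using a z0 by (simp add: field_simps)
    then have "norm ((deriv f z / f z) / (of_real (a r) / z) - 1) = norm z / a r * norm (deriv F z / F z)"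
      using a by (simp add: norm_mult norm_divide)
    also have "\<dots> \<le> 1 / a r * (52 * \<eta> / t)"
    proof (intro mult_mono divide_right_mono F1(2)[OF zt(1)])
      have "z \<in> U" using sub zt by (auto simp: t_def)
      then show "norm z \<le> 1" using U_props(1) by force
    qed (use a in auto)
    also have "\<dots> = 1664 * V / a r" using \<rho> by (simp add: \<eta>_def t_def)
    finally show ?thesis .
  qed
  assume q: "0 < q" and big: "64 \<le> a r * \<rho>"
  have "norm (((deriv ^^ q) f z / f z) / (of_real (a r) ^ q / z ^ q) - 1) \<le> fact q * (24 * (24 * \<eta>) + 48 / a r)"
  proof (rule higher_log_deriv_estimate[OF f_hol f0, where F = F])
    show "norm (F w - 1) \<le> 24 * \<eta>" if "w \<in> ball zr (t / 2)" for w
      by (rule F1(1)) (use that in \<open>simp add: dist_norm norm_minus_commute\<close>)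
    show "8 \<le> a r * t" using big by (simp add: t_def)
    show "f w = f zr * quot_power w zr (a r) * F w" for w by (rule fF)
  qed (use \<eta> a zr r t zt q in auto)
  then show "norm (((deriv ^^ q) f z / f z) / (of_real (a r) ^ q / z ^ q) - 1) \<le> fact q * (24 * (96 * V * \<rho>) + 48 / a r)"
    by (simp add: \<eta>_def)
qed

end

section \<open>Asymptotics along the maximum modulus points\<close>

lemma eventually_at_left_one_iff:
  "(\<forall>\<^sub>F r in at_left (1::real). P r) \<longleftrightarrow> (\<exists>r1<1. \<forall>r. r1 < r \<and> r < 1 \<longrightarrow> P r)"
  by (subst eventually_at_left[of 0]) auto

theorem theorem1p2:
  fixes f :: "complex \<Rightarrow> complex" and U :: "complex set" and v :: "complex \<Rightarrow> real"
    and B a \<epsilon> :: "real \<Rightarrow> real" and R r0 \<beta> \<delta> \<rho>0 :: real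
  assumes mero: "f nicely_meromorphic_on ball 0 1"
    and tract: "direct_tract f R U"
    and v_eq: "v = tract_fun f R U"
    and B_eq: "B = circle_max v"
    and a_eq: "a = log_right_deriv B"
    and r0: "0 < r0" "r0 < 1"
    and B_ge: "\<And>r. r0 \<le> r \<Longrightarrow> r < 1 \<Longrightarrow> B r \<ge> 2"
    and a_ge: "\<And>r. r0 \<le> r \<Longrightarrow> r < 1 \<Longrightarrow> a r \<ge> 2"
    and \<beta>: "0 < \<beta>" "\<beta> \<le> 1 / 2"
    and \<delta>: "0 < \<delta>"
    and \<epsilon>_eq: "\<epsilon> = tract_eps \<beta> \<delta> a"
    and order_B: "Limsup (at_left 1) (\<lambda>r. ereal (ln (B r) / ln (1 / (1 - r)))) > ereal \<rho>0"
    and \<rho>0: "\<rho>0 > 0"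
    and order_a: "Limsup (at_left 1) (\<lambda>r. ereal (ln (a r) / ln (1 / (1 - r))))
                    > (if \<beta> = 1 / 2 then \<infinity> else ereal ((1 + \<rho>0) / (1 - 2 * \<beta>)))"
  shows "\<exists>E. E \<subseteq> {r0..<1} \<and> E \<in> sets lebesgue \<and>
     (\<integral>\<^sup>+t\<in>E. ennreal (1 / (1 - t)) \<partial>lebesgue) < \<infinity> \<and>
     (\<forall>\<eta>>0. \<forall>\<^sub>F r in at_left 1. r \<notin> E \<longrightarrow>
        (\<forall>zr z. norm zr = r \<and> v zr = B r \<and> norm (z - zr) < \<epsilon> r / 2048 \<longrightarrow>
           norm (f z / (f zr * quot_power z zr (a r)) - 1) < \<eta> \<and>
           norm ((deriv f z / f z) / (of_real (a r) / z) - 1) < \<eta>)) \<and>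
     (\<forall>(rs :: nat \<Rightarrow> real) (M :: nat).
        (\<forall>n. r0 \<le> rs n \<and> rs n < 1) \<and> rs \<longlonglongrightarrow> 1 \<and>
        filterlim (\<lambda>n. (1 - rs n) powr (1 + \<rho>0) * a (rs n) powr (1 - 2 * \<beta>)) at_top sequentially \<and>
        M > 0 \<longrightarrow>
        (\<forall>\<^sub>F n in sequentially. \<forall>r. rs n \<le> r \<and> r \<le> 1 - (1 - rs n) powr (1 + \<rho>0) \<and> r \<notin> E \<longrightarrow>
           \<epsilon> r / 2048 = 1 / (2048 * a r powr (1 - \<beta>) * ln (a r) powr (1 + \<delta>))) \<and>
        (\<forall>\<eta>>0. \<forall>\<^sub>F n in sequentially.
           \<forall>r. rs n \<le> r \<and> r \<le> 1 - (1 - rs n) powr (1 + \<rho>0) \<and> r \<notin> E \<longrightarrow>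
             (\<forall>zr z. norm zr = r \<and> v zr = B r \<and> norm (z - zr) < \<epsilon> r / 2048 \<longrightarrow>
                norm (f z / (f zr * quot_power z zr (a r)) - 1) < \<eta> \<and>
                (\<forall>q\<in>{1..M}.
                   norm (((deriv ^^ q) f z / f z) / (of_real (a r) ^ q / z ^ q) - 1) < \<eta>))))"
proof -
  interpret disc_tract f R U
    using mero tract by unfold_locales
  have B: "B = circle_max (tract_fun f R U)" and a: "a = log_right_deriv (circle_max (tract_fun f R U))"
    using v_eq B_eq a_eq by simp_all
  have subgr: "B r + a r * (ln s - ln r) \<le> B s" if "0 < r" "r < 1" "0 < s" "s < 1" for r s
    using circle_max_subgradient[OF that] unfolding B a .
  have a_mono: "a x \<le> a y" if "r0 \<le> x" "x \<le> y" "y < 1" for x y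
  proof (cases "x = y")
    case False
    have "B x + a x * (ln y - ln x) \<le> B y" "B y + a y * (ln x - ln y) \<le> B x"
      using subgr[of x y] subgr[of y x] that r0 by auto
    then have "a x * (ln y - ln x) \<le> a y * (ln y - ln x)" by (simp add: algebra_simps)
    moreover have "0 < ln y - ln x" using that r0 False by simp
    ultimately show ?thesis by (simp only: mult_le_cancel_right_pos)
  qed simp
  have B_mono: "B x \<le> B y" if "r0 \<le> x" "x \<le> y" "y < 1" for x y
  proof -
    have "0 \<le> a x * (ln y - ln x)" using a_ge[of x] that r0 by (intro mult_nonneg_nonneg) auto
    then show ?thesis using subgr[of x y] that r0 by simp
  qed
  have B_unb: "\<exists>r. r0 \<le> r \<and> r < 1 \<and> M \<le> B r" for M
    by (rule Limsup_log_ratio_imp_unbounded[OF order_B \<rho>0 r0(2)]) (use B_ge in force)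
  have \<beta>': "\<beta> < 1/2" using order_a \<beta> by (cases "\<beta> = 1/2") auto
  have a_unb: "\<exists>r. r0 \<le> r \<and> r < 1 \<and> M \<le> a r" for M
  proof (rule Limsup_log_ratio_imp_unbounded[OF _ _ r0(2)])
    show "ereal ((1 + \<rho>0) / (1 - 2 * \<beta>)) < Limsup (at_left 1) (\<lambda>r. ereal (ln (a r) / ln (1 / (1 - r))))"
      using order_a \<beta>' by simp
  qed (use \<beta>' \<rho>0 a_ge in \<open>auto intro!: divide_pos_pos, force\<close>)
  have to_inf: "filterlim g at_top (at_left 1)"
    if mono: "\<And>x y. r0 \<le> x \<Longrightarrow> x \<le> y \<Longrightarrow> y < 1 \<Longrightarrow> g x \<le> g y"
      and unb: "\<And>M. \<exists>r. r0 \<le> r \<and> r < 1 \<and> M \<le> g r" for g :: "real \<Rightarrow> real"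
    unfolding filterlim_at_top
  proof
    fix M
    obtain r1 where r1: "r0 \<le> r1" "r1 < 1" "M \<le> g r1" using unb by blast
    show "\<forall>\<^sub>F r in at_left 1. M \<le> g r"
      using eventually_at_left_real[OF r1(2)]
    proof eventually_elim
      case (elim r)
      then show ?case using mono[of r1 r] r1 by simp
    qed
  qed
  have a_lim: "filterlim a at_top (at_left 1)" by (rule to_inf[OF a_mono a_unb])
  have B_lim: "filterlim B at_top (at_left 1)" by (rule to_inf[OF B_mono B_unb])
  obtain E C where E: "E \<subseteq> {r0..<1}" "E \<in> sets lebesgue" "(\<integral>\<^sup>+t\<in>E. ennreal (1 / (1 - t)) \<partial>lebesgue) < \<infinity>" "0 < C"
    and E_ev: "\<forall>\<^sub>F r in at_left 1. r \<notin> E \<longrightarrow>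
        (\<forall>x. \<bar>x - r\<bar> < (1 - r) / (2 * a r powr \<beta> * ln (a r) powr (1 + \<delta>)) \<longrightarrow>
           r0 \<le> x \<and> x < 1 \<and> \<bar>a x - a r\<bar> \<le> C * a r powr (1 - \<beta>))"
    using exceptional_set_exists[OF r0 a_mono a_unb \<beta> \<delta>] by blast
  define l where "l = (\<lambda>r. ln (a r) powr (1 + \<delta>))"
  have tend: "((\<lambda>r. 48 * C * (1 / l r)) \<longlongrightarrow> 0) (at_left 1)" "((\<lambda>r. 1664 * C * (a r powr (- \<beta>))) \<longlongrightarrow> 0) (at_left 1)"
    "((\<lambda>r. 1 / a r) \<longlongrightarrow> 0) (at_left 1)" "filterlim (\<lambda>r. a r powr \<beta> / l r) at_top (at_left 1)"
  proof -
    have "((\<lambda>x. 48 * C * (1 / ln x powr (1 + \<delta>))) \<longlongrightarrow> 0) at_top" using \<delta> by real_asymp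
    from filterlim_compose[OF this a_lim] show "((\<lambda>r. 48 * C * (1 / l r)) \<longlongrightarrow> 0) (at_left 1)" by (simp add: l_def)
    have "((\<lambda>x. 1664 * C * x powr (- \<beta>)) \<longlongrightarrow> 0) at_top" using \<beta> by real_asymp
    from filterlim_compose[OF this a_lim] show "((\<lambda>r. 1664 * C * (a r powr (- \<beta>))) \<longlongrightarrow> 0) (at_left 1)" by simp
    have "((\<lambda>x::real. 1 / x) \<longlongrightarrow> 0) at_top" by real_asymp
    from filterlim_compose[OF this a_lim] show "((\<lambda>r. 1 / a r) \<longlongrightarrow> 0) (at_left 1)" .
    have "filterlim (\<lambda>x. x powr \<beta> / ln x powr (1 + \<delta>)) at_top at_top" using \<beta> \<delta> by real_asymp
    from filterlim_compose[OF this a_lim] show "filterlim (\<lambda>r. a r powr \<beta> / l r) at_top (at_left 1)"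
      by (simp add: l_def)
  qed
  \<comment> \<open>In the application \<open>V = C * a r powr (1 - \<beta>)\<close> and \<open>\<rho> = \<epsilon> r / 2\<close>. The second term in the
    minimum defining \<open>\<epsilon>\<close> makes the product \<open>96 * V * \<rho>\<close> at most \<open>err\<close>; the first term keeps
    the disc inside the range where the variation of \<open>a\<close> is controlled.\<close>
  define err where "err = (\<lambda>r. 48 * C * (1 / l r))"
  have err_lim: "(err \<longlongrightarrow> 0) (at_left 1)" unfolding err_def by (rule tend(1))
  have core: "\<forall>\<^sub>F r in at_left 1. r \<notin> E \<longrightarrow>
      (\<forall>zr z. norm zr = r \<and> v zr = B r \<and> norm (z - zr) < \<epsilon> r / 2048 \<longrightarrow>
         norm (f z / (f zr * quot_power z zr (a r)) - 1) \<le> err r \<and>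
         norm ((deriv f z / f z) / (of_real (a r) / z) - 1) \<le> 1664 * C * (a r powr (- \<beta>)) \<and>
         (\<forall>q>0. 128 \<le> a r * \<epsilon> r \<longrightarrow>
            norm (((deriv ^^ q) f z / f z) / (of_real (a r) ^ q / z ^ q) - 1) \<le> fact q * (24 * err r + 48 * (1 / a r))))"
  proof -
    have "\<forall>\<^sub>F r in at_left 1. 4 \<le> a r" using a_lim unfolding filterlim_at_top by blast
    moreover have "\<forall>\<^sub>F r in at_left 1. 6 \<le> B r" using B_lim unfolding filterlim_at_top by blast
    moreover have "\<forall>\<^sub>F r in at_left 1. r \<in> {max (1/2) r0<..<1}" using r0 by (intro eventually_at_left_real) auto
    moreover have "\<forall>\<^sub>F r in at_left 1. err r < 1/400"
      by (rule order_tendstoD(2)[OF err_lim]) simp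
    ultimately show ?thesis using E_ev
    proof eventually_elim
      case (elim r)
      show ?case
      proof (intro impI allI)
        fix zr z assume rE: "r \<notin> E" and asm: "norm zr = r \<and> v zr = B r \<and> norm (z - zr) < \<epsilon> r / 2048"
        have r: "1/2 \<le> r" "r < 1" and ar: "4 \<le> a r" and Br: "6 \<le> B r" using elim by auto
        have zr: "norm zr = r" "tract_fun f R U zr = B r" and z: "norm (z - zr) < \<epsilon> r / 2048"
          using asm v_eq by auto
        have ln1: "1 \<le> ln (a r)"
        proof -
          have "ln 4 \<le> ln (a r)" using ar by (intro ln_mono) auto
          moreover have "ln (4::real) = 2 * ln 2" using ln_realpow[of 2 2] by simp
          ultimately show ?thesis using ln2_ge_two_thirds by linarith
        qed
        have l1: "1 \<le> l r" unfolding l_def using ln1 \<delta> by (intro ge_one_powr_ge_zero) auto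
        have ab: "1 \<le> a r powr \<beta>" using ar \<beta> by (intro ge_one_powr_ge_zero) auto
        define V where "V = C * a r powr (1 - \<beta>)"
        define \<rho> where "\<rho> = \<epsilon> r / 2"
        have eps: "\<epsilon> r = min ((1 - r) / (2 * a r powr \<beta> * l r)) (1 / (a r powr (1 - \<beta>) * l r))"
          by (simp add: \<epsilon>_eq tract_eps_def l_def)
        have "0 < \<epsilon> r" unfolding eps using r l1 ab ar by (auto intro!: divide_pos_pos mult_pos_pos)
        then have \<rho>0': "0 < \<rho>" by (simp add: \<rho>_def)
        have e1: "2 * \<rho> \<le> (1 - r) / (2 * a r powr \<beta> * l r)" by (simp add: \<rho>_def eps)
        also have "\<dots> \<le> (1 - r) / 1"
        proof (rule divide_left_mono)
          have "1 * 1 \<le> (2 * a r powr \<beta>) * l r" using ab l1 by (intro mult_mono) auto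
          then show "1 \<le> 2 * a r powr \<beta> * l r" by simp
        qed (use r l1 ab in \<open>auto intro!: mult_pos_pos\<close>)
        finally have \<rho>1: "2 * \<rho> \<le> 1 - r" by simp
        have V0: "0 < V" using E(4) ar by (simp add: V_def)
        have VV: "\<bar>a x - a r\<bar> \<le> V" if "\<bar>x - r\<bar> < 2 * \<rho>" for x
          using elim(5) rE that e1 unfolding V_def l_def by fastforce
        have "V * \<epsilon> r \<le> V * (1 / (a r powr (1 - \<beta>) * l r))"
          unfolding eps using V0 by (intro mult_left_mono) auto
        also have "\<dots> = C * (1 / l r)" using ar by (simp add: V_def)
        finally have Ve: "96 * V * \<rho> \<le> err r" by (simp add: \<rho>_def err_def)
        have "0 < V * \<rho>" using V0 \<rho>0' by simp
        then have "4 * V * \<rho> \<le> 96 * V * \<rho>" by simp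
        then have small: "4 * V * \<rho> \<le> 1/400" using Ve elim(4) by linarith
        have z': "norm (z - zr) < \<rho> / 32" using z \<rho>0' by (simp add: \<rho>_def)
        note main = asymptotics_near_maximum_point[OF r zr(1) _ _ _ \<rho>0' \<rho>1 small V0 _ z', folded B a, OF zr(2) Br ar VV]
        have "1664 * V / a r = 1664 * C * (a r powr (- \<beta>))"
          using ar by (simp add: V_def powr_diff powr_minus_divide)
        moreover have "norm (((deriv ^^ q) f z / f z) / (of_real (a r) ^ q / z ^ q) - 1) \<le> fact q * (24 * err r + 48 * (1 / a r))"
          if q: "q > 0" "128 \<le> a r * \<epsilon> r" for q
        proof -
          have "norm (((deriv ^^ q) f z / f z) / (of_real (a r) ^ q / z ^ q) - 1) \<le> fact q * (24 * (96 * V * \<rho>) + 48 / a r)"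
            by (rule main(3)) (use q in \<open>auto simp: \<rho>_def\<close>)
          also have "\<dots> \<le> fact q * (24 * err r + 48 * (1 / a r))"
            using Ve by (intro mult_left_mono add_mono) auto
          finally show ?thesis .
        qed
        ultimately show "norm (f z / (f zr * quot_power z zr (a r)) - 1) \<le> err r \<and>
         norm ((deriv f z / f z) / (of_real (a r) / z) - 1) \<le> 1664 * C * (a r powr (- \<beta>)) \<and>
         (\<forall>q>0. 128 \<le> a r * \<epsilon> r \<longrightarrow>
            norm (((deriv ^^ q) f z / f z) / (of_real (a r) ^ q / z ^ q) - 1) \<le> fact q * (24 * err r + 48 * (1 / a r)))"
          using main(1,2) Ve by auto
      qed
    qed
  qed
  have part1: "\<forall>\<^sub>F r in at_left 1. r \<notin> E \<longrightarrow>
        (\<forall>zr z. norm zr = r \<and> v zr = B r \<and> norm (z - zr) < \<epsilon> r / 2048 \<longrightarrow>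
           norm (f z / (f zr * quot_power z zr (a r)) - 1) < \<eta> \<and>
           norm ((deriv f z / f z) / (of_real (a r) / z) - 1) < \<eta>)" if \<eta>: "\<eta> > 0" for \<eta>
    using core order_tendstoD(2)[OF err_lim \<eta>] order_tendstoD(2)[OF tend(2) \<eta>]
  proof eventually_elim
    case (elim r)
    show ?case
    proof (intro impI allI)
      fix zr z assume "r \<notin> E" "norm zr = r \<and> v zr = B r \<and> norm (z - zr) < \<epsilon> r / 2048"
      with elim(1) have "norm (f z / (f zr * quot_power z zr (a r)) - 1) \<le> err r \<and>
         norm ((deriv f z / f z) / (of_real (a r) / z) - 1) \<le> 1664 * C * (a r powr (- \<beta>))" by blast
      with elim(2,3) show "norm (f z / (f zr * quot_power z zr (a r)) - 1) < \<eta> \<and>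
           norm ((deriv f z / f z) / (of_real (a r) / z) - 1) < \<eta>" by linarith
    qed
  qed
  have part2: "(\<forall>\<^sub>F n in sequentially. \<forall>r. rs n \<le> r \<and> r \<le> 1 - (1 - rs n) powr (1 + \<rho>0) \<and> r \<notin> E \<longrightarrow>
           \<epsilon> r / 2048 = 1 / (2048 * a r powr (1 - \<beta>) * ln (a r) powr (1 + \<delta>))) \<and>
        (\<forall>\<eta>>0. \<forall>\<^sub>F n in sequentially.
           \<forall>r. rs n \<le> r \<and> r \<le> 1 - (1 - rs n) powr (1 + \<rho>0) \<and> r \<notin> E \<longrightarrow>
             (\<forall>zr z. norm zr = r \<and> v zr = B r \<and> norm (z - zr) < \<epsilon> r / 2048 \<longrightarrow>
                norm (f z / (f zr * quot_power z zr (a r)) - 1) < \<eta> \<and>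
                (\<forall>q\<in>{1..M}.
                   norm (((deriv ^^ q) f z / f z) / (of_real (a r) ^ q / z ^ q) - 1) < \<eta>)))"
    if rs: "\<And>n. r0 \<le> rs n \<and> rs n < 1" "rs \<longlonglongrightarrow> 1"
      and lim: "filterlim (\<lambda>n. (1 - rs n) powr (1 + \<rho>0) * a (rs n) powr (1 - 2 * \<beta>)) at_top sequentially"
    for rs :: "nat \<Rightarrow> real" and M :: nat
  proof -
    have ev2: "\<forall>\<^sub>F n in sequentially. 2 \<le> (1 - rs n) powr (1 + \<rho>0) * a (rs n) powr (1 - 2 * \<beta>)"
      using lim unfolding filterlim_at_top by blast
    \<comment> \<open>For \<open>rs n \<le> r\<close> up to the right end point the quantity \<open>(1 - r) * a r powr (1 - 2 * \<beta>)\<close> is at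
      least the one in the hypothesis on \<open>rs\<close>, and the second term of the minimum is the smaller one
      as soon as it exceeds \<open>2\<close>.\<close>
    have eps: "\<epsilon> r = 1 / (a r powr (1 - \<beta>) * l r) \<and> r < 1"
      if n: "2 \<le> (1 - rs n) powr (1 + \<rho>0) * a (rs n) powr (1 - 2 * \<beta>)"
        and r: "rs n \<le> r" "r \<le> 1 - (1 - rs n) powr (1 + \<rho>0)" for n r
    proof -
      have "0 < (1 - rs n) powr (1 + \<rho>0)" using rs(1)[of n] by simp
      then have r1: "r < 1" using r by linarith
      have rr: "r0 \<le> r" using r rs(1)[of n] by linarith
      have ar: "2 \<le> a r" using a_ge[OF rr r1] .
      have l0: "0 < l r" using ar by (simp add: l_def)
      have "a (rs n) powr (1 - 2 * \<beta>) \<le> a r powr (1 - 2 * \<beta>)"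
        using a_mono[of "rs n" r] a_ge[of "rs n"] rs(1)[of n] r r1 \<beta> by (intro powr_mono2) auto
      then have "(1 - rs n) powr (1 + \<rho>0) * a (rs n) powr (1 - 2 * \<beta>) \<le> (1 - r) * a r powr (1 - 2 * \<beta>)"
        using r r1 by (intro mult_mono) auto
      then have "2 \<le> (1 - r) * a r powr (1 - 2 * \<beta>)" using n by linarith
      then have "2 * (a r powr \<beta> * l r) \<le> (1 - r) * a r powr (1 - 2 * \<beta>) * (a r powr \<beta> * l r)"
        using l0 by (intro mult_right_mono) auto
      also have "\<dots> = (1 - r) * (a r powr (1 - \<beta>) * l r)"
        by (simp flip: powr_add)
      finally have "1 / (a r powr (1 - \<beta>) * l r) \<le> (1 - r) / (2 * a r powr \<beta> * l r)"
        using l0 ar by (simp add: divide_simps mult_ac)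
      then show ?thesis using r1 by (simp add: \<epsilon>_eq tract_eps_def l_def min_def)
    qed
    have first: "\<forall>\<^sub>F n in sequentially. \<forall>r. rs n \<le> r \<and> r \<le> 1 - (1 - rs n) powr (1 + \<rho>0) \<and> r \<notin> E \<longrightarrow>
           \<epsilon> r / 2048 = 1 / (2048 * a r powr (1 - \<beta>) * ln (a r) powr (1 + \<delta>))"
      using ev2
    proof eventually_elim
      case (elim n)
      then show ?case using eps[OF elim] by (simp add: l_def)
    qed
    have second: "\<forall>\<^sub>F n in sequentially.
           \<forall>r. rs n \<le> r \<and> r \<le> 1 - (1 - rs n) powr (1 + \<rho>0) \<and> r \<notin> E \<longrightarrow>
             (\<forall>zr z. norm zr = r \<and> v zr = B r \<and> norm (z - zr) < \<epsilon> r / 2048 \<longrightarrow>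
                norm (f z / (f zr * quot_power z zr (a r)) - 1) < \<eta> \<and>
                (\<forall>q\<in>{1..M}.
                   norm (((deriv ^^ q) f z / f z) / (of_real (a r) ^ q / z ^ q) - 1) < \<eta>))"
      if \<eta>: "\<eta> > 0" for \<eta>
    proof -
      have "((\<lambda>r. fact M * (24 * err r + 48 * (1 / a r))) \<longlongrightarrow> fact M * (24 * 0 + 48 * 0)) (at_left 1)"
        by (intro tendsto_intros tend err_lim)
      then have t: "((\<lambda>r. fact M * (24 * err r + 48 * (1 / a r))) \<longlongrightarrow> 0) (at_left 1)" by simp
      have big: "\<forall>\<^sub>F r in at_left 1. 128 \<le> a r powr \<beta> / l r"
        using tend(4) unfolding filterlim_at_top by blast
      have rng: "\<forall>\<^sub>F r in at_left 1. r \<in> {r0<..<1}" by (rule eventually_at_left_real[OF r0(2)])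
      have "\<forall>\<^sub>F r in at_left 1. r \<notin> E \<longrightarrow> \<epsilon> r = 1 / (a r powr (1 - \<beta>) * l r) \<longrightarrow>
          (\<forall>zr z. norm zr = r \<and> v zr = B r \<and> norm (z - zr) < \<epsilon> r / 2048 \<longrightarrow>
                norm (f z / (f zr * quot_power z zr (a r)) - 1) < \<eta> \<and>
                (\<forall>q\<in>{1..M}.
                   norm (((deriv ^^ q) f z / f z) / (of_real (a r) ^ q / z ^ q) - 1) < \<eta>))"
        using core order_tendstoD(2)[OF err_lim \<eta>] order_tendstoD(2)[OF t \<eta>] big rng
      proof eventually_elim
        case (elim r)
        show ?case
        proof (intro impI allI)
          fix zr z
          assume rE: "r \<notin> E" and e: "\<epsilon> r = 1 / (a r powr (1 - \<beta>) * l r)"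
            and asm: "norm zr = r \<and> v zr = B r \<and> norm (z - zr) < \<epsilon> r / 2048"
          have ar: "2 \<le> a r" using a_ge[of r] elim(5) by auto
          have l0: "0 < l r" using ar by (simp add: l_def)
          have "a r * \<epsilon> r = a r powr \<beta> / l r"
            unfolding e using ar l0 by (simp add: powr_diff field_simps)
          \<comment> \<open>Here the disc is large on the scale \<open>1 / a r\<close>, as the derivatives of higher order require.\<close>
          then have ae: "128 \<le> a r * \<epsilon> r" using elim(4) by simp
          have err0: "0 \<le> 24 * err r + 48 * (1 / a r)" using E(4) l0 ar by (simp add: err_def)
          have "norm (((deriv ^^ q) f z / f z) / (of_real (a r) ^ q / z ^ q) - 1) < \<eta>" if "q \<in> {1..M}" for q
          proof -
            have "norm (((deriv ^^ q) f z / f z) / (of_real (a r) ^ q / z ^ q) - 1) \<le> fact q * (24 * err r + 48 * (1 / a r))"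
              using elim(1) rE asm ae that by auto
            also have "\<dots> \<le> fact M * (24 * err r + 48 * (1 / a r))"
              using that err0 by (intro mult_right_mono fact_mono) auto
            also have "\<dots> < \<eta>" by (rule elim(3))
            finally show ?thesis .
          qed
          moreover have "norm (f z / (f zr * quot_power z zr (a r)) - 1) \<le> err r"
            using elim(1) rE asm by blast
          then have "norm (f z / (f zr * quot_power z zr (a r)) - 1) < \<eta>" using elim(2) by linarith
          ultimately show "norm (f z / (f zr * quot_power z zr (a r)) - 1) < \<eta> \<and>
                (\<forall>q\<in>{1..M}.
                   norm (((deriv ^^ q) f z / f z) / (of_real (a r) ^ q / z ^ q) - 1) < \<eta>)" by blast
        qed
      qed
      then obtain r1 where r1: "r1 < 1" "\<And>r. r1 < r \<Longrightarrow> r < 1 \<Longrightarrow> r \<notin> E \<Longrightarrow> \<epsilon> r = 1 / (a r powr (1 - \<beta>) * l r) \<Longrightarrow>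
          (\<forall>zr z. norm zr = r \<and> v zr = B r \<and> norm (z - zr) < \<epsilon> r / 2048 \<longrightarrow>
                norm (f z / (f zr * quot_power z zr (a r)) - 1) < \<eta> \<and>
                (\<forall>q\<in>{1..M}.
                   norm (((deriv ^^ q) f z / f z) / (of_real (a r) ^ q / z ^ q) - 1) < \<eta>))"
        unfolding eventually_at_left_one_iff by blast
      have "\<forall>\<^sub>F n in sequentially. r1 < rs n" using order_tendstoD(1)[OF rs(2) r1(1)] .
      with ev2 show ?thesis
      proof eventually_elim
        case (elim n)
        show ?case
        proof (rule allI, rule impI)
          fix r assume r: "rs n \<le> r \<and> r \<le> 1 - (1 - rs n) powr (1 + \<rho>0) \<and> r \<notin> E"
          have e: "\<epsilon> r = 1 / (a r powr (1 - \<beta>) * l r)" and r1': "r < 1" using eps[OF elim(1)] r by blast+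
          have "r1 < r" using elim(2) r by linarith
          moreover have "r \<notin> E" using r by blast
          ultimately show "\<forall>zr z. norm zr = r \<and> v zr = B r \<and> norm (z - zr) < \<epsilon> r / 2048 \<longrightarrow>
                norm (f z / (f zr * quot_power z zr (a r)) - 1) < \<eta> \<and>
                (\<forall>q\<in>{1..M}.
                   norm (((deriv ^^ q) f z / f z) / (of_real (a r) ^ q / z ^ q) - 1) < \<eta>)"
            using r1' e by (intro r1(2))
        qed
      qed
    qed
    show ?thesis using first second by blast
  qed
  show ?thesis
  proof (rule exI[of _ E], intro conjI)
    show "\<forall>\<eta>>0. \<forall>\<^sub>F r in at_left 1. r \<notin> E \<longrightarrow>
        (\<forall>zr z. norm zr = r \<and> v zr = B r \<and> norm (z - zr) < \<epsilon> r / 2048 \<longrightarrow>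
           norm (f z / (f zr * quot_power z zr (a r)) - 1) < \<eta> \<and>
           norm ((deriv f z / f z) / (of_real (a r) / z) - 1) < \<eta>)"
      using part1 by blast
  qed (use E part2 in blast)+
qed

end
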